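(* Let $\mathfrak g$ be a regular symmetrizable Kac–Moody Lie superalgebra, let $\Delta$ be its set of roots, and let $G(\mathfrak g)$ be its Cartan graph. Then: (1) $G(\mathfrak g)$ is path simply connected. (2) The set of roots $\Delta$ of $\mathfrak g$ can be identified with the orbit set $\Delta(G(\mathfrak g))$ of the Cartan graph $G(\mathfrak g)$. (3) As edge-colored graphs, $OR(\mathfrak g)$ is isomorphic to $RB(G(\mathfrak g))$. (4) In particular, $OR(\mathfrak g)$ is a connected rainbow boomerang graph.
   Context: Rainbow boomerang graphs. An edge-colored graph is a graph with a map from its edges onto a set of colors; it is properly colored if for each vertex the incident edges have pairwise distinct colors. A walk is a finite alternating sequence $v_0e_1v_1\dots e_kv_k$ ($k\ge0$ its length) with $e_i$ having ends $v_{i-1},v_i$; it is shortest if no shorter walk joins the same pair of vertices, and rainbow if its edge colors are pairwise distinct. A rainbow boomerang graph is a properly colored edge-colored graph in which a walk is shortest if and only if it is rainbow. An isomorphism of edge-colored graphs is a graph isomorphism together with a bijection of color sets compatible with the colorings. The superalgebra. Everything is over $\mathbb C$. Let $I=\{1,\dots,\theta\}$, $A=(a_{ij})$ a $\theta\times\theta$ matrix, $p:I\to\mathbb Z/2$. Take $\mathfrak h$ of dimension $2\theta-\operatorname{rank}A$ with linearly independent $\alpha_i\in\mathfrak h^*$ and linearly independent $h_i\in\mathfrak h$, $\alpha_j(h_i)=a_{ij}$. $\mathfrak g=\mathfrak g(A,p)$ is the Lie superalgebra generated by $\mathfrak h$ (even) and $e_i,f_i$ (parity $p(i)$) with $[h,e_i]=\alpha_i(h)e_i$,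 $[h,f_i]=-\alpha_i(h)f_i$, $[e_i,f_j]=\delta_{ij}h_i$, $[\mathfrak h,\mathfrak h]=0$, modulo the largest ideal meeting $\mathfrak h$ trivially. Its set of roots is $\Delta=\{\alpha\in\mathfrak h^*\mid\mathfrak g_\alpha\ne0\}\setminus\{0\}$, where $\mathfrak g_\alpha=\{x\in\mathfrak g\mid[h,x]=\alpha(h)x\ \forall h\in\mathfrak h\}$. A simple root $\alpha_i$ is isotropic if $p(i)=\bar1$ and $a_{ii}=0$. For an isotropic simple root $\alpha$ of a base $\Pi$ the odd reflection $r_\alpha$ is the map on $\Pi$ with $r_\alpha(\alpha)=-\alpha$, $r_\alpha(\beta)=\alpha+\beta$ if $\alpha+\beta\in\Delta$, and $r_\alpha(\beta)=\beta$ otherwise; $r_\alpha(\Pi)$ is again a base, for which $\mathfrak g$ is again of the form $\mathfrak g(A',p')$. $\mathfrak g$ is regular symmetrizable Kac–Moody if $A=DB$ with $D$ invertible diagonal and $B$ symmetric, and, for $A$ and every matrix obtained from it by finite sequences of odd reflections: no even simple root has $a_{ii}=0$; $a_{ij}=0\iff a_{ji}=0$; and all $\operatorname{ad}f_i$ are locally nilpotent. Borel subalgebras. $\mathfrak B(\mathfrak g)$ is the set of Borel subalgebras of $\mathfrak g$ containing a fixed Borel subalgebra of the even part $\mathfrak g_{\bar0}$; any two of them are related by a finite sequence of odd reflections. For $\mathfrak b\in\mathfrak B(\mathfrak g)$, $\Delta^{\mathfrak b+}$ is its set of positive roots and $\Pi^{\mathfrak b}$ its set of simple roots. Put $\Delta^{\mathrm{pure}+}=\bigcap_{\mathfrak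 b\in\mathfrak B(\mathfrak g)}\Delta^{\mathfrak b+}$. The graph $OR(\mathfrak g)$: vertex set $\mathfrak B(\mathfrak g)$; color set $\Delta^{\mathfrak b+}\setminus\Delta^{\mathrm{pure}+}$ for a fixed $\mathfrak b$; two vertices are joined by an edge if they are related by an odd reflection, and the edge is colored by the unique $\alpha\in\Delta^{\mathfrak b+}\setminus\Delta^{\mathrm{pure}+}$ belonging to the positive system of one of the two vertices but not of the other. Cartan graphs. A semi Cartan graph is an edge-colored graph (loops and multiple edges allowed) with vertex set $V$, non-empty finite color set $I$, and generalized Cartan matrices $A^x=(a^x_{ij})_{i,j\in I}$ ($x\in V$) such that each vertex is incident to exactly one edge of each color (possibly a loop), and the $i$-th rows of $A^x,A^y$ agree if $x,y$ are joined by an edge of color $i$. Let $r_ix$ be the vertex joined to $x$ by the edge of color $i$, let $(\mathbb Z^I)^x$ be a copy of $\mathbb Z^I$ with standard basis $\{\alpha_i^x\}$, and $s_i^x:(\mathbb Z^I)^x\to(\mathbb Z^I)^{r_ix}$, $\alpha_j^x\mapsto\alpha_j^{r_ix}-a_{ij}^x\alpha_i^{r_ix}$. $W(G)$ is the groupoid on $V$ whose morphisms $x\to y$ are the linear maps $s_{i_t}\cdots s_{i_1}\operatorname{id}_x$ with $r_{i_t}\cdots r_{i_1}x=y$. Put $R^x=\{w\alpha_i^y\mid y\in V,\ w\in\operatorname{Hom}_{W(G)}(y,x),\ i\in I\}$ and $R^{x+}=R^x\cap\sum_i\mathbb Z_{\ge0}\alpha_i^x$. A semi Cartan graph is finite if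 $\#R^x<\infty$. It is a Cartan graph if $R^x=R^{x+}\cup(-R^{x+})$ for all $x$, and $w\in\operatorname{Hom}_{W(G)}(y,x)$ with $w\alpha_i^y\in R^{x+}$ for all $i$ implies $w=\operatorname{id}_x$ (in particular $x=y$). Path subgroupoid. For a connected semi Cartan graph $G$, $P(G)$ is the subgroupoid of $W(G)$ generated by the morphisms $s_{i_t}\cdots s_{i_1}\operatorname{id}_x$ with $r_{i_{s+1}}\cdots r_{i_1}x\neq r_{i_s}\cdots r_{i_1}x$ for $0\le s\le t-1$. $G$ is path simply connected if $\#\operatorname{Hom}_{P(G)}(x,y)=1$ for all $x,y$. For $\alpha\in R^x$, $\operatorname{orb}(\alpha)=\{w\alpha\mid y\in V,\ w\in\operatorname{Hom}_{P(G)}(x,y)\}$, and the orbit set is $\Delta(G)=\{\operatorname{orb}(\alpha)\mid\alpha\in R^x\}$ (independent of $x$). In the path simply connected case, for $O\in\Delta(G)$ let $O_x$ be the unique element of $O\cap R^x$; put $\Delta(G)^{x+}=\{O\mid O_x\in R^{x+}\}$ and $\Delta(G)^{\mathrm{pure}+}=\bigcap_x\Delta(G)^{x+}$. For a path simply connected Cartan graph $G$, $RB(G)$ is the edge-colored graph obtained from $G$ by removing loops, with color set $C=\Delta(G)^{x+}\setminus\Delta(G)^{\mathrm{pure}+}$ ($x$ fixed), in which an edge of $G$ of color $i$ between $z$ and $y$ is recolored by the unique $O\in C$ with $O_z\in\{\pm\alpha_i^z\}$. The Cartan graph $G(\mathfrak g)$. An ordered root basis $(\mathfrak b,\le)$ is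 a $\mathfrak b\in\mathfrak B(\mathfrak g)$ with a total order on $\Pi^{\mathfrak b}$, written $\Pi^{\mathfrak b}=\{\alpha_1^{\mathfrak b},\dots,\alpha_\theta^{\mathfrak b}\}$ in that order; an odd reflection $r_\beta$ sends it to the ordered root basis whose $j$-th simple root is $r_\beta(\alpha_j^{\mathfrak b})$. Fix one ordered root basis. Let $E(\mathfrak g)$ be the edge-colored graph whose vertices are the ordered root bases obtained from the fixed one by finite sequences of odd reflections, with color set $I=\{1,\dots,\theta\}$, an edge of color $i$ joining two vertices related by the odd reflection in the $i$-th simple root, and a loop of color $i$ at each vertex whose $i$-th simple root is non-isotropic. By a known result there is a unique family of generalized Cartan matrices $\{A^{(\mathfrak b,\le)}\}$ such that labeling the vertices by these matrices makes $E(\mathfrak g)$ a finite connected Cartan graph and such that, for each vertex $(\mathfrak b,\le)$, there is an additive bijection $R^{(\mathfrak b,\le)+}\simeq\Delta^{\mathfrak b+}\setminus2\Delta^{\mathfrak b+}$ given by $\alpha_i^{(\mathfrak b,\le)}\mapsto\alpha_i^{\mathfrak b}$. This Cartan graph is $G(\mathfrak g)$.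
   Formalization: In (2) the orbit set is identified with Δ∖2Δ (roots that are not twice a root), not with all of Δ; for osp(1|2), Δ={±δ,±2δ} has four elements but the orbit set has two. Without doubled roots this is all of Δ. *)

theory Defs
  imports "HOL-Analysis.Analysis" "HOL-Library.Z2"
begin

section \<open>Edge-colored graphs\<close>

text \<open>
  Undirected multigraphs; \<open>ends\<close> gives the set of ends of an edge, which is a singleton for a loop.
\<close>

record ('v, 'e, 'c) ecgraph =
  verts :: "'v set"
  edges :: "'e set"
  ends :: "'e \<Rightarrow> 'v set"
  col :: "'e \<Rightarrow> 'c"
  colors :: "'c set"

definition edge_colored_graph :: "('v, 'e, 'c, 'm) ecgraph_scheme \<Rightarrow> bool" where
  "edge_colored_graph G \<longleftrightarrow>
     (\<forall>e\<in>edges G. \<exists>u\<in>verts G. \<exists>v\<in>verts G. ends G e = {u, v}) \<and>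
     col G ` edges G = colors G"

definition properly_colored :: "('v, 'e, 'c, 'm) ecgraph_scheme \<Rightarrow> bool" where
  "properly_colored G \<longleftrightarrow>
     (\<forall>v\<in>verts G. \<forall>e\<in>edges G. \<forall>e'\<in>edges G.
        v \<in> ends G e \<and> v \<in> ends G e' \<and> e \<noteq> e' \<longrightarrow> col G e \<noteq> col G e')"

text \<open>
  A walk \<open>v\<^sub>0 e\<^sub>1 v\<^sub>1 \<dots> e\<^sub>k v\<^sub>k\<close> is given by its list of vertices
  and its list of edges; its length is the length of the latter.
\<close>

definition is_walk :: "('v, 'e, 'c, 'm) ecgraph_scheme \<Rightarrow> 'v list \<Rightarrow> 'e list \<Rightarrow> bool" where
  "is_walk G vs es \<longleftrightarrow>
     length vs = Suc (length es) \<and> set vs \<subseteq> verts G \<and> set es \<subseteq> edges G \<and>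
     (\<forall>i<length es. ends G (es ! i) = {vs ! i, vs ! Suc i})"

definition shortest_walk :: "('v, 'e, 'c, 'm) ecgraph_scheme \<Rightarrow> 'v list \<Rightarrow> 'e list \<Rightarrow> bool" where
  "shortest_walk G vs es \<longleftrightarrow>
     is_walk G vs es \<and>
     (\<forall>vs' es'. is_walk G vs' es' \<and> hd vs' = hd vs \<and> last vs' = last vs \<longrightarrow>
        length es \<le> length es')"

definition rainbow_walk :: "('v, 'e, 'c, 'm) ecgraph_scheme \<Rightarrow> 'v list \<Rightarrow> 'e list \<Rightarrow> bool" where
  "rainbow_walk G vs es \<longleftrightarrow> is_walk G vs es \<and> distinct (map (col G) es)"

definition connected_graph :: "('v, 'e, 'c, 'm) ecgraph_scheme \<Rightarrow> bool" where
  "connected_graph G \<longleftrightarrow>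
     verts G \<noteq> {} \<and>
     (\<forall>u\<in>verts G. \<forall>v\<in>verts G. \<exists>vs es. is_walk G vs es \<and> hd vs = u \<and> last vs = v)"

definition rainbow_boomerang :: "('v, 'e, 'c, 'm) ecgraph_scheme \<Rightarrow> bool" where
  "rainbow_boomerang G \<longleftrightarrow>
     edge_colored_graph G \<and> properly_colored G \<and>
     (\<forall>vs es. is_walk G vs es \<longrightarrow> (shortest_walk G vs es \<longleftrightarrow> rainbow_walk G vs es))"

definition ec_isomorphic ::
  "('v, 'e, 'c, 'm) ecgraph_scheme \<Rightarrow> ('w, 'f, 'd, 'n) ecgraph_scheme \<Rightarrow> bool" where
  "ec_isomorphic G G' \<longleftrightarrow>
     (\<exists>f g k. bij_betw f (verts G) (verts G') \<and> bij_betw g (edges G) (edges G') \<and>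
        bij_betw k (colors G) (colors G') \<and>
        (\<forall>e\<in>edges G. ends G' (g e) = f ` ends G e \<and> col G' (g e) = k (col G e)))"


section \<open>The Lie superalgebra \<open>\<gg>(A,p)\<close>\<close>

text \<open>
  The Cartan subalgebra \<open>\<hh>\<close> is taken to be \<open>\<complex>\<^sup>d\<close> (type \<^typ>\<open>complex^'h\<close>,
  \<open>d = CARD('h)\<close>), and a linear functional on it is represented by its vector of coordinates
  with respect to the dual basis, so \<open>\<hh>\<^sup>*\<close> is \<^typ>\<open>complex^'h\<close> as well. A datum consists of
  \<open>A\<close>, \<open>p\<close>, the family of the \<open>\<alpha>\<^sub>i\<close> (\<open>rt\<close>) and the family of the
  \<open>h\<^sub>i\<close> (\<open>crt\<close>). Parities are elements of the field \<^typ>\<open>bit\<close> with two elements.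
\<close>

record ('i, 'h) km_datum =
  cmat :: "complex^'i^'i"
  par :: "'i \<Rightarrow> bit"
  rt :: "'i \<Rightarrow> complex^'h"
  crt :: "'i \<Rightarrow> complex^'h"

definition ev :: "complex^'h \<Rightarrow> complex^'h \<Rightarrow> complex" where
  "ev \<alpha> x = (\<Sum>k\<in>UNIV. \<alpha> $ k * x $ k)"

definition realization :: "('i::finite, 'h::finite) km_datum \<Rightarrow> bool" where
  "realization D \<longleftrightarrow>
     CARD('h) = 2 * CARD('i) - rank (cmat D) \<and>
     inj (rt D) \<and> vec.independent (range (rt D)) \<and>
     inj (crt D) \<and> vec.independent (range (crt D)) \<and>
     (\<forall>i j. ev (rt D j) (crt D i) = cmat D $ i $ j)"

text \<open>
  Terms in the generators \<open>x \<in> \<hh>\<close>, \<open>e\<^sub>i\<close>, \<open>f\<^sub>i\<close>. Zero is the term \<open>Hgen 0\<close>.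
\<close>

datatype ('i, 'h) tm =
    Hgen "complex^'h" | Egen 'i | Fgen 'i
  | Add "('i, 'h) tm" "('i, 'h) tm"
  | Scal complex "('i, 'h) tm"
  | Br "('i, 'h) tm" "('i, 'h) tm"

inductive homog :: "('i::finite, 'h::finite) km_datum \<Rightarrow> bit \<Rightarrow> ('i, 'h) tm \<Rightarrow> bool" for D where
  homog_zero: "homog D a (Hgen 0)"
| homog_H: "homog D 0 (Hgen x)"
| homog_E: "homog D (par D i) (Egen i)"
| homog_F: "homog D (par D i) (Fgen i)"
| homog_Add: "homog D a s \<Longrightarrow> homog D a t \<Longrightarrow> homog D a (Add s t)"
| homog_Scal: "homog D a s \<Longrightarrow> homog D a (Scal c s)"
| homog_Br: "homog D a s \<Longrightarrow> homog D b t \<Longrightarrow> homog D (a + b) (Br s t)"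

definition sgn_bit :: "bit \<Rightarrow> complex" where
  "sgn_bit a = (if a = 0 then 1 else -1)"

text \<open>
  \<open>tm_eq D\<close> is the least congruence on terms containing the axioms of a complex vector
  space, those of a Lie superalgebra, and the defining relations. So \<open>tm\<close> modulo \<open>tm_eq D\<close>
  is the Lie superalgebra presented by these generators and relations.
\<close>

inductive tm_eq :: "('i::finite, 'h::finite) km_datum \<Rightarrow> ('i, 'h) tm \<Rightarrow> ('i, 'h) tm \<Rightarrow> bool" for D where
  eq_refl: "tm_eq D s s"
| eq_sym: "tm_eq D s t \<Longrightarrow> tm_eq D t s"
| eq_trans: "tm_eq D s t \<Longrightarrow> tm_eq D t u \<Longrightarrow> tm_eq D s u"
| cong_Add: "tm_eq D s s' \<Longrightarrow> tm_eq D t t' \<Longrightarrow> tm_eq D (Add s t) (Add s' t')"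
| cong_Scal: "tm_eq D s s' \<Longrightarrow> tm_eq D (Scal c s) (Scal c s')"
| cong_Br: "tm_eq D s s' \<Longrightarrow> tm_eq D t t' \<Longrightarrow> tm_eq D (Br s t) (Br s' t')"
| vs_assoc: "tm_eq D (Add (Add s t) u) (Add s (Add t u))"
| vs_comm: "tm_eq D (Add s t) (Add t s)"
| vs_zero: "tm_eq D (Add s (Hgen 0)) s"
| vs_neg: "tm_eq D (Add s (Scal (-1) s)) (Hgen 0)"
| vs_distr1: "tm_eq D (Scal c (Add s t)) (Add (Scal c s) (Scal c t))"
| vs_distr2: "tm_eq D (Scal (c + d) s) (Add (Scal c s) (Scal d s))"
| vs_mult: "tm_eq D (Scal (c * d) s) (Scal c (Scal d s))"
| vs_one: "tm_eq D (Scal 1 s) s"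
| Br_Add1: "tm_eq D (Br (Add s t) u) (Add (Br s u) (Br t u))"
| Br_Add2: "tm_eq D (Br u (Add s t)) (Add (Br u s) (Br u t))"
| Br_Scal1: "tm_eq D (Br (Scal c s) t) (Scal c (Br s t))"
| Br_Scal2: "tm_eq D (Br s (Scal c t)) (Scal c (Br s t))"
| skew: "homog D a s \<Longrightarrow> homog D b t \<Longrightarrow> tm_eq D (Br s t) (Scal (- sgn_bit (a * b)) (Br t s))"
| jacobi: "homog D a s \<Longrightarrow> homog D b t \<Longrightarrow>
     tm_eq D (Br s (Br t u)) (Add (Br (Br s t) u) (Scal (sgn_bit (a * b)) (Br t (Br s u))))"
| H_add: "tm_eq D (Hgen (x + y)) (Add (Hgen x) (Hgen y))"
| H_scal: "tm_eq D (Hgen (c *s x)) (Scal c (Hgen x))"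
| rel_HH: "tm_eq D (Br (Hgen x) (Hgen y)) (Hgen 0)"
| rel_HE: "tm_eq D (Br (Hgen x) (Egen i)) (Scal (ev (rt D i) x) (Egen i))"
| rel_HF: "tm_eq D (Br (Hgen x) (Fgen i)) (Scal (- ev (rt D i) x) (Fgen i))"
| rel_EF: "tm_eq D (Br (Egen i) (Fgen j)) (Hgen (if i = j then crt D i else 0))"

text \<open>
  Ideals (graded, as always for superalgebras) of the presented superalgebra, as
  sets of terms saturated under \<open>tm_eq D\<close>.
\<close>

definition tm_ideal :: "('i::finite, 'h::finite) km_datum \<Rightarrow> ('i, 'h) tm set \<Rightarrow> bool" where
  "tm_ideal D J \<longleftrightarrow>
     (\<forall>s\<in>J. \<forall>t. tm_eq D s t \<longrightarrow> t \<in> J) \<and>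
     Hgen 0 \<in> J \<and>
     (\<forall>s\<in>J. \<forall>t\<in>J. Add s t \<in> J) \<and>
     (\<forall>s\<in>J. \<forall>c. Scal c s \<in> J) \<and>
     (\<forall>s\<in>J. \<forall>t. Br s t \<in> J \<and> Br t s \<in> J) \<and>
     (\<forall>s\<in>J. \<exists>s0\<in>J. \<exists>s1\<in>J. homog D 0 s0 \<and> homog D 1 s1 \<and> tm_eq D s (Add s0 s1))"

text \<open>The largest ideal meeting \<open>\<hh>\<close> trivially is the union of all such ideals.\<close>

definition max_ideal :: "('i::finite, 'h::finite) km_datum \<Rightarrow> ('i, 'h) tm set" where
  "max_ideal D =
     \<Union> {J. tm_ideal D J \<and> (\<forall>x. Hgen x \<in> J \<longrightarrow> tm_eq D (Hgen x) (Hgen 0))}"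

text \<open>
  The two successive quotients are taken in one step: elements of \<open>\<gg>(A,p)\<close> are the
  classes of terms modulo \<open>max_ideal D\<close>.
\<close>

definition tm_rel :: "('i::finite, 'h::finite) km_datum \<Rightarrow> (('i, 'h) tm \<times> ('i, 'h) tm) set" where
  "tm_rel D = {(s, t). Add s (Scal (-1) t) \<in> max_ideal D}"

definition cls :: "('i::finite, 'h::finite) km_datum \<Rightarrow> ('i, 'h) tm \<Rightarrow> ('i, 'h) tm set" where
  "cls D t = tm_rel D `` {t}"

definition gcar :: "('i::finite, 'h::finite) km_datum \<Rightarrow> ('i, 'h) tm set set" where
  "gcar D = UNIV // tm_rel D"

definition gzero :: "('i::finite, 'h::finite) km_datum \<Rightarrow> ('i, 'h) tm set" where
  "gzero D = cls D (Hgen 0)"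

text \<open>Operations on classes, by representatives.\<close>

definition gadd :: "('i::finite, 'h::finite) km_datum \<Rightarrow> ('i, 'h) tm set \<Rightarrow> ('i, 'h) tm set \<Rightarrow> ('i, 'h) tm set" where
  "gadd D X Y = (\<Union>s\<in>X. \<Union>t\<in>Y. cls D (Add s t))"

definition gscal :: "('i::finite, 'h::finite) km_datum \<Rightarrow> complex \<Rightarrow> ('i, 'h) tm set \<Rightarrow> ('i, 'h) tm set" where
  "gscal D c X = (\<Union>s\<in>X. cls D (Scal c s))"

definition gbr :: "('i::finite, 'h::finite) km_datum \<Rightarrow> ('i, 'h) tm set \<Rightarrow> ('i, 'h) tm set \<Rightarrow> ('i, 'h) tm set" where
  "gbr D X Y = (\<Union>s\<in>X. \<Union>t\<in>Y. cls D (Br s t))"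

definition gpart :: "('i::finite, 'h::finite) km_datum \<Rightarrow> bit \<Rightarrow> ('i, 'h) tm set set" where
  "gpart D a = cls D ` {t. homog D a t}"

definition root_space :: "('i::finite, 'h::finite) km_datum \<Rightarrow> complex^'h \<Rightarrow> ('i, 'h) tm set set" where
  "root_space D \<alpha> = {X \<in> gcar D. \<forall>x. gbr D (cls D (Hgen x)) X = gscal D (ev \<alpha> x) X}"

definition roots :: "('i::finite, 'h::finite) km_datum \<Rightarrow> (complex^'h) set" where
  "roots D = {\<alpha>. root_space D \<alpha> \<noteq> {gzero D}} - {0}"

definition doubles :: "(complex^'h) set \<Rightarrow> (complex^'h) set" where
  "doubles S = (\<lambda>\<alpha>. 2 *s \<alpha>) ` S"


section \<open>Bases, odd reflections, regularity\<close>

text \<open>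
  \<open>presents D D'\<close>: the Lie superalgebra of \<open>D\<close> is also of the form \<open>\<gg>(A',p')\<close>, with the
  same Cartan subalgebra \<open>\<hh>\<close> and with simple roots and coroots those of \<open>D'\<close>.
\<close>

definition presents :: "('i::finite, 'h::finite) km_datum \<Rightarrow> ('i, 'h) km_datum \<Rightarrow> bool" where
  "presents D D' \<longleftrightarrow> realization D' \<and>
     (\<exists>\<phi>. bij_betw \<phi> (gcar D') (gcar D) \<and>
        (\<forall>X\<in>gcar D'. \<forall>Y\<in>gcar D'. \<phi> (gadd D' X Y) = gadd D (\<phi> X) (\<phi> Y)) \<and>
        (\<forall>c. \<forall>X\<in>gcar D'. \<phi> (gscal D' c X) = gscal D c (\<phi> X)) \<and>
        (\<forall>X\<in>gcar D'. \<forall>Y\<in>gcar D'. \<phi> (gbr D' X Y) = gbr D (\<phi> X) (\<phi> Y)) \<and>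
        (\<forall>a. \<phi> ` gpart D' a = gpart D a) \<and>
        (\<forall>x. \<phi> (cls D' (Hgen x)) = cls D (Hgen x)))"

definition base :: "('i::finite, 'h::finite) km_datum \<Rightarrow> (complex^'h) set \<Rightarrow> bool" where
  "base D B \<longleftrightarrow> (\<exists>D'. presents D D' \<and> B = range (rt D'))"

definition isotropic ::
  "('i::finite, 'h::finite) km_datum \<Rightarrow> (complex^'h) set \<Rightarrow> complex^'h \<Rightarrow> bool" where
  "isotropic D B \<alpha> \<longleftrightarrow>
     (\<exists>D' i. presents D D' \<and> B = range (rt D') \<and> \<alpha> = rt D' i \<and>
        par D' i = 1 \<and> cmat D' $ i $ i = 0)"

definition odd_refl ::
  "('i::finite, 'h::finite) km_datum \<Rightarrow> complex^'h \<Rightarrow> complex^'h \<Rightarrow> complex^'h" where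
  "odd_refl D \<alpha> \<beta> =
     (if \<beta> = \<alpha> then - \<alpha> else if \<alpha> + \<beta> \<in> roots D then \<alpha> + \<beta> else \<beta>)"

text \<open>
  An ordered base is a family of simple roots indexed by \<open>I\<close>; the next function is the
  odd reflection in its \<open>i\<close>-th member.
\<close>

definition refl_at ::
  "('i::finite, 'h::finite) km_datum \<Rightarrow> 'i \<Rightarrow> ('i \<Rightarrow> complex^'h) \<Rightarrow> ('i \<Rightarrow> complex^'h)" where
  "refl_at D i x = (\<lambda>j. odd_refl D (x i) (x j))"

inductive odd_reachable ::
  "('i::finite, 'h::finite) km_datum \<Rightarrow> ('i \<Rightarrow> complex^'h) \<Rightarrow> ('i \<Rightarrow> complex^'h) \<Rightarrow> bool"
  for D x0 where
  "odd_reachable D x0 x0"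
| "odd_reachable D x0 x \<Longrightarrow> isotropic D (range x) (x i) \<Longrightarrow> odd_reachable D x0 (refl_at D i x)"

definition symmetrizable :: "complex^'i^'i \<Rightarrow> bool" where
  "symmetrizable A \<longleftrightarrow>
     (\<exists>d B. (\<forall>i. d i \<noteq> 0) \<and> transpose B = B \<and> (\<forall>i j. A $ i $ j = d i * B $ i $ j))"

definition f_locally_nilpotent :: "('i::finite, 'h::finite) km_datum \<Rightarrow> bool" where
  "f_locally_nilpotent D \<longleftrightarrow>
     (\<forall>i. \<forall>X\<in>gcar D. \<exists>n. (gbr D (cls D (Fgen i)) ^^ n) X = gzero D)"

text \<open>
  The matrix at an ordered base is determined up to nonzero row scalars, which the
  conditions below do not see; they are imposed for all choices.
\<close>

definition regular_symmetrizable :: "('i::finite, 'h::finite) km_datum \<Rightarrow> bool" where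
  "regular_symmetrizable D \<longleftrightarrow>
     realization D \<and> symmetrizable (cmat D) \<and>
     (\<forall>D'. presents D D' \<and> odd_reachable D (rt D) (rt D') \<longrightarrow>
        (\<forall>i. par D' i = 0 \<longrightarrow> cmat D' $ i $ i \<noteq> 0) \<and>
        (\<forall>i j. cmat D' $ i $ j = 0 \<longleftrightarrow> cmat D' $ j $ i = 0) \<and>
        f_locally_nilpotent D')"


section \<open>Borel subalgebras and the graph \<open>OR(\<gg>)\<close>\<close>

definition nat_span :: "(complex^'h) set \<Rightarrow> (complex^'h) set" where
  "nat_span B = {\<alpha>. \<exists>c :: complex^'h \<Rightarrow> nat. \<alpha> = (\<Sum>\<beta>\<in>B. of_nat (c \<beta>) *s \<beta>)}"

definition g_subspace :: "('i::finite, 'h::finite) km_datum \<Rightarrow> ('i, 'h) tm set set \<Rightarrow> bool" where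
  "g_subspace D S \<longleftrightarrow>
     S \<subseteq> gcar D \<and> gzero D \<in> S \<and>
     (\<forall>X\<in>S. \<forall>Y\<in>S. gadd D X Y \<in> S) \<and> (\<forall>c. \<forall>X\<in>S. gscal D c X \<in> S)"

text \<open>The subspace \<open>\<hh> \<oplus> \<Oplus> \<gg>\<^sub>\<alpha>\<close>, \<open>\<alpha>\<close> ranging over the roots in \<open>\<nat>B\<close>.\<close>

definition borel_of ::
  "('i::finite, 'h::finite) km_datum \<Rightarrow> (complex^'h) set \<Rightarrow> ('i, 'h) tm set set" where
  "borel_of D B =
     g_subspace D hull
       (range (\<lambda>x. cls D (Hgen x)) \<union> (\<Union>\<alpha> \<in> roots D \<inter> nat_span B. root_space D \<alpha>))"

text \<open>
  The fixed Borel subalgebra of the even part is that of the standard Borel subalgebra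
  of \<open>\<gg>(A,p)\<close>.
\<close>

definition borels :: "('i::finite, 'h::finite) km_datum \<Rightarrow> ('i, 'h) tm set set set" where
  "borels D =
     {b. (\<exists>B. base D B \<and> b = borel_of D B) \<and>
         borel_of D (range (rt D)) \<inter> gpart D 0 \<subseteq> b}"

definition pos_roots ::
  "('i::finite, 'h::finite) km_datum \<Rightarrow> ('i, 'h) tm set set \<Rightarrow> (complex^'h) set" where
  "pos_roots D b = {\<alpha> \<in> roots D. root_space D \<alpha> \<subseteq> b}"

definition simple_roots ::
  "('i::finite, 'h::finite) km_datum \<Rightarrow> ('i, 'h) tm set set \<Rightarrow> (complex^'h) set" where
  "simple_roots D b = (THE B. base D B \<and> b = borel_of D B)"

definition pure_pos_roots :: "('i::finite, 'h::finite) km_datum \<Rightarrow> (complex^'h) set" where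
  "pure_pos_roots D = (\<Inter>b\<in>borels D. pos_roots D b)"

definition odd_adjacent ::
  "('i::finite, 'h::finite) km_datum \<Rightarrow> ('i, 'h) tm set set \<Rightarrow> ('i, 'h) tm set set \<Rightarrow> bool" where
  "odd_adjacent D b b' \<longleftrightarrow>
     (\<exists>\<alpha>\<in>simple_roots D b. isotropic D (simple_roots D b) \<alpha> \<and>
        simple_roots D b' = odd_refl D \<alpha> ` simple_roots D b)"

definition OR_graph ::
  "('i::finite, 'h::finite) km_datum \<Rightarrow> ('i, 'h) tm set set \<Rightarrow>
     (('i, 'h) tm set set, ('i, 'h) tm set set set, complex^'h) ecgraph" where
  "OR_graph D b0 =
     \<lparr> verts = borels D,
       edges = {{b, b'} | b b'. b \<in> borels D \<and> b' \<in> borels D \<and> odd_adjacent D b b'},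
       ends = (\<lambda>e. e),
       col = (\<lambda>e. THE \<alpha>. \<alpha> \<in> pos_roots D b0 - pure_pos_roots D \<and>
                (\<exists>b b'. e = {b, b'} \<and> \<alpha> \<in> pos_roots D b \<and> \<alpha> \<notin> pos_roots D b')),
       colors = pos_roots D b0 - pure_pos_roots D \<rparr>"


section \<open>Cartan graphs\<close>

record ('v, 'e, 'i::finite) cgraph = "('v, 'e, 'i) ecgraph" +
  cartan :: "'v \<Rightarrow> int^'i^'i"

definition generalized_cartan_matrix :: "int^'i^'i \<Rightarrow> bool" where
  "generalized_cartan_matrix A \<longleftrightarrow>
     (\<forall>i. A $ i $ i = 2) \<and> (\<forall>i j. i \<noteq> j \<longrightarrow> A $ i $ j \<le> 0) \<and>
     (\<forall>i j. A $ i $ j = 0 \<longrightarrow> A $ j $ i = 0)"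

definition semi_cartan_graph :: "('v, 'e, 'i::finite) cgraph \<Rightarrow> bool" where
  "semi_cartan_graph G \<longleftrightarrow>
     edge_colored_graph G \<and> colors G = UNIV \<and>
     (\<forall>x\<in>verts G. \<forall>i. \<exists>!e. e \<in> edges G \<and> x \<in> ends G e \<and> col G e = i) \<and>
     (\<forall>x\<in>verts G. generalized_cartan_matrix (cartan G x)) \<and>
     (\<forall>e\<in>edges G. \<forall>x y. ends G e = {x, y} \<longrightarrow>
        cartan G x $ col G e = cartan G y $ col G e)"

definition nbr :: "('v, 'e, 'i::finite) cgraph \<Rightarrow> 'i \<Rightarrow> 'v \<Rightarrow> 'v" where
  "nbr G i x = (THE y. \<exists>e\<in>edges G. col G e = i \<and> ends G e = {x, y})"

abbreviation sroot :: "'i::finite \<Rightarrow> int^'i" where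
  "sroot i \<equiv> axis i 1"

text \<open>
  \<open>(\<int>\<^sup>I)\<^sup>x\<close> is \<^typ>\<open>int^'i\<close> for each vertex \<open>x\<close>, the vertex being tracked separately. The linear
  map below sends \<open>\<alpha>\<^sub>j\<close> to \<open>\<alpha>\<^sub>j - a\<^sub>i\<^sub>j \<alpha>\<^sub>i\<close>, where \<open>a\<^sub>i\<^sub>j\<close> is taken at \<open>x\<close>.
\<close>

definition smap :: "('v, 'e, 'i::finite) cgraph \<Rightarrow> 'i \<Rightarrow> 'v \<Rightarrow> int^'i \<Rightarrow> int^'i" where
  "smap G i x v = (\<Sum>j\<in>UNIV. v $ j *s (sroot j - (cartan G x $ i $ j) *s sroot i))"

text \<open>\<open>W_hom G x y w\<close>: \<open>w\<close> is a morphism from \<open>x\<close> to \<open>y\<close> in \<open>W(G)\<close>.\<close>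

inductive W_hom :: "('v, 'e, 'i::finite) cgraph \<Rightarrow> 'v \<Rightarrow> 'v \<Rightarrow> (int^'i \<Rightarrow> int^'i) \<Rightarrow> bool" for G where
  "x \<in> verts G \<Longrightarrow> W_hom G x x id"
| "W_hom G x y w \<Longrightarrow> W_hom G x (nbr G i y) (smap G i y \<circ> w)"

definition real_roots :: "('v, 'e, 'i::finite) cgraph \<Rightarrow> 'v \<Rightarrow> (int^'i) set" where
  "real_roots G x = {w (sroot i) | w y i. y \<in> verts G \<and> W_hom G y x w}"

definition pos_real_roots :: "('v, 'e, 'i::finite) cgraph \<Rightarrow> 'v \<Rightarrow> (int^'i) set" where
  "pos_real_roots G x = {v \<in> real_roots G x. \<forall>i. 0 \<le> v $ i}"

definition finite_cgraph :: "('v, 'e, 'i::finite) cgraph \<Rightarrow> bool" where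
  "finite_cgraph G \<longleftrightarrow> (\<forall>x\<in>verts G. finite (real_roots G x))"

definition cartan_graph :: "('v, 'e, 'i::finite) cgraph \<Rightarrow> bool" where
  "cartan_graph G \<longleftrightarrow> semi_cartan_graph G \<and>
     (\<forall>x\<in>verts G. real_roots G x = pos_real_roots G x \<union> uminus ` pos_real_roots G x) \<and>
     (\<forall>x\<in>verts G. \<forall>y\<in>verts G. \<forall>w. W_hom G y x w \<and> (\<forall>i. w (sroot i) \<in> pos_real_roots G x) \<longrightarrow>
        x = y \<and> w = id)"

text \<open>Generators of the path subgroupoid: words none of whose steps is a loop.\<close>

inductive path_word :: "('v, 'e, 'i::finite) cgraph \<Rightarrow> 'v \<Rightarrow> 'v \<Rightarrow> (int^'i \<Rightarrow> int^'i) \<Rightarrow> bool" for G where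
  "x \<in> verts G \<Longrightarrow> path_word G x x id"
| "path_word G x y w \<Longrightarrow> nbr G i y \<noteq> y \<Longrightarrow> path_word G x (nbr G i y) (smap G i y \<circ> w)"

inductive P_hom :: "('v, 'e, 'i::finite) cgraph \<Rightarrow> 'v \<Rightarrow> 'v \<Rightarrow> (int^'i \<Rightarrow> int^'i) \<Rightarrow> bool" for G where
  "path_word G x y w \<Longrightarrow> P_hom G x y w"
| "P_hom G x y w \<Longrightarrow> P_hom G y z w' \<Longrightarrow> P_hom G x z (w' \<circ> w)"
| "P_hom G x y w \<Longrightarrow> P_hom G y x (inv w)"

definition path_simply_connected :: "('v, 'e, 'i::finite) cgraph \<Rightarrow> bool" where
  "path_simply_connected G \<longleftrightarrow> semi_cartan_graph G \<and> connected_graph G \<and>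
     (\<forall>x\<in>verts G. \<forall>y\<in>verts G. \<exists>!w. P_hom G x y w)"

text \<open>Elements of an orbit lie in different copies of \<open>\<int>\<^sup>I\<close>, so they are tagged by their vertex.\<close>

definition orb :: "('v, 'e, 'i::finite) cgraph \<Rightarrow> 'v \<Rightarrow> int^'i \<Rightarrow> ('v \<times> (int^'i)) set" where
  "orb G x \<alpha> = {(y, w \<alpha>) | y w. y \<in> verts G \<and> P_hom G x y w}"

definition orbit_set :: "('v, 'e, 'i::finite) cgraph \<Rightarrow> ('v \<times> (int^'i)) set set" where
  "orbit_set G = {orb G x \<alpha> | x \<alpha>. x \<in> verts G \<and> \<alpha> \<in> real_roots G x}"

definition at_vertex :: "('v \<times> (int^'i)) set \<Rightarrow> 'v \<Rightarrow> int^'i" where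
  "at_vertex Ob x = (THE v. (x, v) \<in> Ob)"

definition pos_orbits :: "('v, 'e, 'i::finite) cgraph \<Rightarrow> 'v \<Rightarrow> ('v \<times> (int^'i)) set set" where
  "pos_orbits G x = {Ob \<in> orbit_set G. at_vertex Ob x \<in> pos_real_roots G x}"

definition pure_pos_orbits :: "('v, 'e, 'i::finite) cgraph \<Rightarrow> ('v \<times> (int^'i)) set set" where
  "pure_pos_orbits G = (\<Inter>x\<in>verts G. pos_orbits G x)"

definition RB_graph ::
  "('v, 'e, 'i::finite) cgraph \<Rightarrow> 'v \<Rightarrow> ('v, 'e, ('v \<times> (int^'i)) set) ecgraph" where
  "RB_graph G x0 =
     \<lparr> verts = verts G,
       edges = {e \<in> edges G. \<nexists>x. ends G e = {x}},
       ends = ends G,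
       col = (\<lambda>e. THE Ob. Ob \<in> pos_orbits G x0 - pure_pos_orbits G \<and>
                (\<forall>z\<in>ends G e. at_vertex Ob z \<in> {sroot (col G e), - sroot (col G e)})),
       colors = pos_orbits G x0 - pure_pos_orbits G \<rparr>"


section \<open>The Cartan graph of \<open>\<gg>\<close>\<close>

definition ordered_root_basis ::
  "('i::finite, 'h::finite) km_datum \<Rightarrow> ('i \<Rightarrow> complex^'h) \<Rightarrow> bool" where
  "ordered_root_basis D x \<longleftrightarrow> inj x \<and> (\<exists>b\<in>borels D. range x = simple_roots D b)"

text \<open>
  The graph \<open>E(\<gg>)\<close> on the ordered root bases reachable from \<open>x0\<close>, labeled by the
  matrices \<open>M\<close>. An edge is a pair of its color and its set of ends.
\<close>

definition E_graph ::
  "('i::finite, 'h::finite) km_datum \<Rightarrow> ('i \<Rightarrow> complex^'h) \<Rightarrow> (('i \<Rightarrow> complex^'h) \<Rightarrow> int^'i^'i) \<Rightarrow>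
     ('i \<Rightarrow> complex^'h, 'i \<times> ('i \<Rightarrow> complex^'h) set, 'i) cgraph" where
  "E_graph D x0 M =
     \<lparr> verts = {x. odd_reachable D x0 x},
       edges = {(i, {x, refl_at D i x}) | i x. odd_reachable D x0 x \<and> isotropic D (range x) (x i)}
             \<union> {(i, {x}) | i x. odd_reachable D x0 x \<and> \<not> isotropic D (range x) (x i)},
       ends = snd,
       col = fst,
       colors = UNIV,
       cartan = M \<rparr>"

text \<open>The additive map with \<open>\<alpha>\<^sub>i \<mapsto> x\<^sub>i\<close>.\<close>

definition root_map :: "('i::finite \<Rightarrow> complex^'h) \<Rightarrow> int^'i \<Rightarrow> complex^'h" where
  "root_map x v = (\<Sum>i\<in>UNIV. of_int (v $ i) *s x i)"

definition is_cartan_graph_of ::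
  "('i::finite, 'h::finite) km_datum \<Rightarrow>
     ('i \<Rightarrow> complex^'h, 'i \<times> ('i \<Rightarrow> complex^'h) set, 'i) cgraph \<Rightarrow> bool" where
  "is_cartan_graph_of D G \<longleftrightarrow>
     (\<exists>x0 M. ordered_root_basis D x0 \<and> G = E_graph D x0 M) \<and>
     cartan_graph G \<and> finite_cgraph G \<and> connected_graph G \<and>
     (\<forall>x\<in>verts G.
        let \<Delta>p = pos_roots D (borel_of D (range x))
        in bij_betw (root_map x) (pos_real_roots G x) (\<Delta>p - doubles \<Delta>p))"

end

theory Submission
  imports Defs
begin

text \<open>
  In the superalgebra, the weight decomposition with respect to the Cartan subalgebra shows that the
  roots are sums of simple roots with coefficients of one sign, for every base. Simple roots are
  roots because the Verma module makes the Cartan subalgebra embed, roots come in opposite pairs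
  because of the Chevalley involution, and \<open>[e\<^sub>i, e\<^sub>i]\<close> vanishes for isotropic \<open>\<alpha>\<^sub>i\<close> because it
  is a singular vector.

  An odd reflection therefore changes a positive system in exactly one root, its simple root
  \<open>\<alpha>\<close>, which becomes \<open>- \<alpha>\<close>. On the side of the Cartan graph, the reflection along an edge that is
  not a loop is thus nothing but a change of coordinates in one space of roots. Hence a morphism of
  the path subgroupoid is determined by its ends, and an orbit is a root written in all bases.

  A simple root on which two Borel subalgebras disagree is isotropic, so two Borel subalgebras are
  joined by a walk that removes their disagreements one at a time. Each edge flips one root, so the
  number of disagreements is the distance, and it is attained exactly by the rainbow walks.
\<close>

subsection \<open>Quotients of the presented superalgebra\<close>

text \<open>Bases and isotropic roots are defined through some presenting datum, and one base may
  have many. What makes them tractable is that two properties of a root do not depend on the datum: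
  the parity of its root space, and whether its double is a root. An element of a base is isotropic
  exactly if it is odd and its double is not a root. Doubles shape the proof a second time. The real
  roots of a Cartan graph correspond only to the roots that are not doubles, so the orbits live on
  that set. The roots on which Borel subalgebras disagree lie in it as well: a double is even,
  because parity is additive in the degree, and the even positive roots are common to all the Borel
  subalgebras considered. This set is finite because the Cartan graph is, so disagreements can be
  counted.\<close>

declare eq_trans [trans]
text \<open>Parities are computed with the laws of a ring, which the default rewriting of sums and
  products to bit operations would hide.\<close>

declare add_bit_eq_xor [simp del] mult_bit_eq_and [simp del]

section \<open>Consequences of the axioms for terms\<close>

lemma tm_eq_Scal_0: "tm_eq D (Scal 0 s) (Hgen 0)"
proof -
  let ?w = "Scal 0 s" let ?n = "Scal (-1) ?w"
  have 1: "tm_eq D ?w (Add ?w ?w)" using vs_distr2[of D 0 0 s] by simp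
  have "tm_eq D (Hgen 0) (Add ?w ?n)" by (rule eq_sym[OF vs_neg])
  also have "tm_eq D (Add ?w ?n) (Add (Add ?w ?w) ?n)"
    by (intro cong_Add 1 eq_refl)
  also have "tm_eq D (Add (Add ?w ?w) ?n) (Add ?w (Add ?w ?n))" by (rule vs_assoc)
  also have "tm_eq D (Add ?w (Add ?w ?n)) (Add ?w (Hgen 0))"
    by (intro cong_Add eq_refl vs_neg)
  also have "tm_eq D (Add ?w (Hgen 0)) ?w" by (rule vs_zero)
  finally show ?thesis by (rule eq_sym)
qed

lemma tm_eq_Hgen_0: "tm_eq D (Hgen 0) (Scal 0 (Hgen 0))"
  using H_scal[of D 0 0] by simp

lemma tm_eq_Br_0_left: "tm_eq D (Br (Hgen 0) t) (Hgen 0)"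
  by (rule eq_trans[OF cong_Br[OF tm_eq_Hgen_0 eq_refl] eq_trans[OF Br_Scal1 tm_eq_Scal_0]])

lemma tm_eq_Br_0_right: "tm_eq D (Br t (Hgen 0)) (Hgen 0)"
  by (rule eq_trans[OF cong_Br[OF eq_refl tm_eq_Hgen_0] eq_trans[OF Br_Scal2 tm_eq_Scal_0]])

lemma tm_eq_Scal_Hgen_0: "tm_eq D (Scal c (Hgen 0)) (Hgen 0)"
  using eq_sym[OF H_scal[of D c 0]] by simp

lemma tm_eq_zero_left: "tm_eq D (Add (Hgen 0) s) s"
  by (rule eq_trans[OF vs_comm vs_zero])

lemma tm_eq_swap_middle:
  "tm_eq D (Add (Add a b) (Add c d)) (Add (Add a c) (Add b d))"
proof -
  have "tm_eq D (Add (Add a b) (Add c d)) (Add a (Add b (Add c d)))" by (rule vs_assoc)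
  also have "tm_eq D (Add a (Add b (Add c d))) (Add a (Add (Add b c) d))"
    by (intro cong_Add eq_refl eq_sym[OF vs_assoc])
  also have "tm_eq D (Add a (Add (Add b c) d)) (Add a (Add (Add c b) d))"
    by (intro cong_Add eq_refl vs_comm)
  also have "tm_eq D (Add a (Add (Add c b) d)) (Add a (Add c (Add b d)))"
    by (intro cong_Add eq_refl vs_assoc)
  also have "tm_eq D (Add a (Add c (Add b d))) (Add (Add a c) (Add b d))"
    by (rule eq_sym[OF vs_assoc])
  finally show ?thesis .
qed

text \<open>With this ideal the presented superalgebra is itself one of the quotients, and is
  treated on the same footing as \<gg>(A,p).\<close>

definition zero_ideal :: "('i::finite, 'h::finite) km_datum \<Rightarrow> ('i, 'h) tm set" where
  "zero_ideal D = {t. tm_eq D t (Hgen 0)}"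

lemma tm_idealI:
  assumes "\<And>s t. s \<in> J \<Longrightarrow> tm_eq D s t \<Longrightarrow> t \<in> J" "Hgen 0 \<in> J"
    "\<And>s t. s \<in> J \<Longrightarrow> t \<in> J \<Longrightarrow> Add s t \<in> J" "\<And>s c. s \<in> J \<Longrightarrow> Scal c s \<in> J"
    "\<And>s t. s \<in> J \<Longrightarrow> Br s t \<in> J" "\<And>s t. s \<in> J \<Longrightarrow> Br t s \<in> J"
    "\<And>s. s \<in> J \<Longrightarrow> \<exists>s0\<in>J. \<exists>s1\<in>J. homog D 0 s0 \<and> homog D 1 s1 \<and> tm_eq D s (Add s0 s1)"
  shows "tm_ideal D J"
  unfolding tm_ideal_def by (intro conjI ballI allI impI) (rule assms; assumption)+

lemma tm_ideal_zero: "tm_ideal D (zero_ideal D)"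
proof (rule tm_idealI; unfold zero_ideal_def mem_Collect_eq)
  show "\<exists>s0\<in>{t. tm_eq D t (Hgen 0)}. \<exists>s1\<in>{t. tm_eq D t (Hgen 0)}.
      homog D 0 s0 \<and> homog D 1 s1 \<and> tm_eq D s (Add s0 s1)" if "tm_eq D s (Hgen 0)" for s
    using that by (intro bexI[of _ "Hgen 0"] conjI homog_zero)
      (auto intro: eq_refl eq_trans eq_sym[OF vs_zero])
  show "tm_eq D (Add s t) (Hgen 0)" if "tm_eq D s (Hgen 0)" "tm_eq D t (Hgen 0)" for s t
    by (rule eq_trans[OF cong_Add[OF that] vs_zero])
  show "tm_eq D (Scal c s) (Hgen 0)" if "tm_eq D s (Hgen 0)" for s c
    by (rule eq_trans[OF cong_Scal[OF that] tm_eq_Scal_Hgen_0])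
  show "tm_eq D (Br s t) (Hgen 0)" if "tm_eq D s (Hgen 0)" for s t
    by (rule eq_trans[OF cong_Br[OF that eq_refl] tm_eq_Br_0_left])
  show "tm_eq D (Br t s) (Hgen 0)" if "tm_eq D s (Hgen 0)" for s t
    by (rule eq_trans[OF cong_Br[OF eq_refl that] tm_eq_Br_0_right])
  show "tm_eq D t (Hgen 0)" if "tm_eq D s (Hgen 0)" "tm_eq D s t" for s t
    by (rule eq_trans[OF eq_sym[OF that(2)] that(1)])
qed (rule eq_refl)

lemma tm_idealD:
  assumes "tm_ideal D J"
  shows "s \<in> J \<Longrightarrow> tm_eq D s t \<Longrightarrow> t \<in> J" "Hgen 0 \<in> J"
    "s \<in> J \<Longrightarrow> t \<in> J \<Longrightarrow> Add s t \<in> J" "s \<in> J \<Longrightarrow> Scal c s \<in> J"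
    "s \<in> J \<Longrightarrow> Br s t \<in> J" "s \<in> J \<Longrightarrow> Br t s \<in> J"
    "s \<in> J \<Longrightarrow> \<exists>s0\<in>J. \<exists>s1\<in>J. homog D 0 s0 \<and> homog D 1 s1 \<and> tm_eq D s (Add s0 s1)"
  using assms unfolding tm_ideal_def by (elim conjE; simp)+

text \<open>Congruence modulo \<open>J\<close>. If \<open>J\<close> is not an ideal, all terms are
  identified; this makes the relation a congruence for every set \<open>J\<close>, as a quotient
  type over all \<open>J\<close> requires.\<close>

definition qeq :: "('i::finite, 'h::finite) km_datum \<Rightarrow> ('i, 'h) tm set \<Rightarrow>
    ('i, 'h) tm \<Rightarrow> ('i, 'h) tm \<Rightarrow> bool" where
  "qeq D J s t \<longleftrightarrow> (tm_ideal D J \<longrightarrow> (\<exists>j\<in>J. tm_eq D s (Add t j)))"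

lemma qeqI: "j \<in> J \<Longrightarrow> tm_eq D s (Add t j) \<Longrightarrow> qeq D J s t"
  unfolding qeq_def by blast

lemma qeq_tm_eq: "tm_eq D s t \<Longrightarrow> qeq D J s t"
  unfolding qeq_def tm_ideal_def using eq_trans[OF _ eq_sym[OF vs_zero]] by blast

lemma qeq_refl: "qeq D J s s"
  by (intro qeq_tm_eq eq_refl)

lemma qeq_sym: assumes "qeq D J s t" shows "qeq D J t s"
  unfolding qeq_def
proof
  assume J: "tm_ideal D J"
  then obtain j where j: "j \<in> J" "tm_eq D s (Add t j)" using assms unfolding qeq_def by blast
  let ?n = "Scal (-1) j"
  have "tm_eq D (Add s ?n) (Add (Add t j) ?n)" by (intro cong_Add j eq_refl)
  also have "tm_eq D (Add (Add t j) ?n) (Add t (Add j ?n))" by (rule vs_assoc)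
  also have "tm_eq D (Add t (Add j ?n)) (Add t (Hgen 0))"
    by (intro cong_Add eq_refl vs_neg)
  also have "tm_eq D (Add t (Hgen 0)) t" by (rule vs_zero)
  finally have "tm_eq D t (Add s ?n)" by (rule eq_sym)
  moreover have "?n \<in> J" using J j unfolding tm_ideal_def by blast
  ultimately show "\<exists>j\<in>J. tm_eq D t (Add s j)" by blast
qed

lemma qeq_trans: assumes "qeq D J s t" "qeq D J t u" shows "qeq D J s u"
  unfolding qeq_def
proof
  assume J: "tm_ideal D J"
  then obtain j k where j: "j \<in> J" "tm_eq D s (Add t j)" and k: "k \<in> J" "tm_eq D t (Add u k)"
    using assms unfolding qeq_def by blast
  have "tm_eq D s (Add (Add u k) j)"
    by (rule eq_trans[OF j(2) cong_Add[OF k(2) eq_refl]])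
  then have "tm_eq D s (Add u (Add k j))" by (rule eq_trans[OF _ vs_assoc])
  moreover have "Add k j \<in> J" using J j k unfolding tm_ideal_def by blast
  ultimately show "\<exists>j\<in>J. tm_eq D s (Add u j)" by blast
qed

lemma qeq_Add: assumes "qeq D J s s'" "qeq D J t t'" shows "qeq D J (Add s t) (Add s' t')"
  unfolding qeq_def
proof
  assume J: "tm_ideal D J"
  then obtain j k where j: "j \<in> J" "tm_eq D s (Add s' j)" and k: "k \<in> J" "tm_eq D t (Add t' k)"
    using assms unfolding qeq_def by blast
  have "tm_eq D (Add s t) (Add (Add s' t') (Add j k))"
    by (rule eq_trans[OF cong_Add[OF j(2) k(2)] tm_eq_swap_middle])
  moreover have "Add j k \<in> J" using J j k unfolding tm_ideal_def by blast
  ultimately show "\<exists>j\<in>J. tm_eq D (Add s t) (Add (Add s' t') j)" by blast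
qed

lemma qeq_Scal: assumes "qeq D J s s'" shows "qeq D J (Scal c s) (Scal c s')"
  unfolding qeq_def
proof
  assume J: "tm_ideal D J"
  then obtain j where j: "j \<in> J" "tm_eq D s (Add s' j)" using assms unfolding qeq_def by blast
  have "tm_eq D (Scal c s) (Add (Scal c s') (Scal c j))"
    by (rule eq_trans[OF cong_Scal[OF j(2)] vs_distr1])
  moreover have "Scal c j \<in> J" using J j unfolding tm_ideal_def by blast
  ultimately show "\<exists>j\<in>J. tm_eq D (Scal c s) (Add (Scal c s') j)" by blast
qed

lemma qeq_Br: assumes "qeq D J s s'" "qeq D J t t'" shows "qeq D J (Br s t) (Br s' t')"
  unfolding qeq_def
proof
  assume J: "tm_ideal D J"
  then obtain j k where j: "j \<in> J" "tm_eq D s (Add s' j)" and k: "k \<in> J" "tm_eq D t (Add t' k)"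
    using assms unfolding qeq_def by blast
  have "tm_eq D (Br s t) (Br (Add s' j) (Add t' k))" by (rule cong_Br[OF j(2) k(2)])
  also have "tm_eq D (Br (Add s' j) (Add t' k)) (Add (Br s' (Add t' k)) (Br j (Add t' k)))"
    by (rule Br_Add1)
  also have "tm_eq D (Add (Br s' (Add t' k)) (Br j (Add t' k)))
      (Add (Add (Br s' t') (Br s' k)) (Br j (Add t' k)))"
    by (intro cong_Add Br_Add2 eq_refl)
  also have "tm_eq D (Add (Add (Br s' t') (Br s' k)) (Br j (Add t' k)))
      (Add (Br s' t') (Add (Br s' k) (Br j (Add t' k))))" by (rule vs_assoc)
  finally have "tm_eq D (Br s t) (Add (Br s' t') (Add (Br s' k) (Br j (Add t' k))))" .
  moreover have "Add (Br s' k) (Br j (Add t' k)) \<in> J" using J j k unfolding tm_ideal_def by blast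
  ultimately show "\<exists>j\<in>J. tm_eq D (Br s t) (Add (Br s' t') j)" by blast
qed

lemma qeq_Hgen_0_iff: "tm_ideal D J \<Longrightarrow> qeq D J t (Hgen 0) \<longleftrightarrow> t \<in> J"
proof
  assume J: "tm_ideal D J"
  { assume "qeq D J t (Hgen 0)"
    then obtain j where "j \<in> J" "tm_eq D t (Add (Hgen 0) j)" using J unfolding qeq_def by blast
    then have "tm_eq D j t" by (meson eq_sym eq_trans tm_eq_zero_left)
    then show "t \<in> J" using \<open>j \<in> J\<close> J unfolding tm_ideal_def by blast }
  { assume "t \<in> J"
    then show "qeq D J t (Hgen 0)" by (rule qeqI) (rule eq_sym[OF tm_eq_zero_left]) }
qed

lemma qeq_zero_ideal_iff: "qeq D (zero_ideal D) s t \<longleftrightarrow> tm_eq D s t"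
proof
  assume "qeq D (zero_ideal D) s t"
  then obtain j where "tm_eq D j (Hgen 0)" "tm_eq D s (Add t j)"
    using tm_ideal_zero[of D] unfolding qeq_def zero_ideal_def by blast
  then show "tm_eq D s t" by (meson eq_trans cong_Add eq_refl vs_zero)
qed (rule qeq_tm_eq)

text \<open>
  The quotients depend on the datum and the ideal, so no single one of them is a type. The type
  below is the product of all of them; \<open>emb D J\<close> includes the factor at \<open>(D, J)\<close>.
\<close>

quotient_type ('i, 'h) qalg =
  "('i::finite, 'h::finite) km_datum \<Rightarrow> ('i, 'h) tm set \<Rightarrow> ('i, 'h) tm" /
  "\<lambda>f g. \<forall>D J. qeq D J (f D J) (g D J)"
  by (intro equivpI reflpI sympI transpI) (blast intro: qeq_refl qeq_sym qeq_trans)+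

instantiation qalg :: (finite, finite) ab_group_add
begin

lift_definition zero_qalg :: "('a, 'b) qalg" is "\<lambda>D J. Hgen 0" .

lift_definition plus_qalg :: "('a, 'b) qalg \<Rightarrow> ('a, 'b) qalg \<Rightarrow> ('a, 'b) qalg" is
  "\<lambda>f g D J. Add (f D J) (g D J)" by (blast intro: qeq_Add)

lift_definition uminus_qalg :: "('a, 'b) qalg \<Rightarrow> ('a, 'b) qalg" is
  "\<lambda>f D J. Scal (-1) (f D J)" by (blast intro: qeq_Scal)

definition minus_qalg :: "('a, 'b) qalg \<Rightarrow> ('a, 'b) qalg \<Rightarrow> ('a, 'b) qalg" where
  "minus_qalg X Y = X + - Y"

instance
proof
  fix a b c :: "('a, 'b) qalg"
  show "a + b + c = a + (b + c)" by transfer (blast intro: qeq_tm_eq vs_assoc)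
  show "a + b = b + a" by transfer (blast intro: qeq_tm_eq vs_comm)
  show "0 + a = a" by transfer (blast intro: qeq_tm_eq tm_eq_zero_left)
  show "- a + a = 0" by transfer (blast intro: qeq_tm_eq eq_trans[OF vs_comm vs_neg])
  show "a - b = a + - b" by (rule minus_qalg_def)
qed

end

lift_definition sc :: "complex \<Rightarrow> ('i::finite, 'h::finite) qalg \<Rightarrow> ('i, 'h) qalg" (infixr "*q" 75) is
  "\<lambda>c f D J. Scal c (f D J)" by (blast intro: qeq_Scal)

lift_definition br :: "('i::finite, 'h::finite) qalg \<Rightarrow> ('i, 'h) qalg \<Rightarrow> ('i, 'h) qalg" is
  "\<lambda>f g D J. Br (f D J) (g D J)" by (blast intro: qeq_Br)

lift_definition emb :: "('i::finite, 'h::finite) km_datum \<Rightarrow> ('i, 'h) tm set \<Rightarrow> ('i, 'h) tm \<Rightarrow> ('i, 'h) qalg" is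
  "\<lambda>D J t D' J'. if D' = D \<and> J' = J then t else Hgen 0" .

text \<open>The projection of the presented superalgebra to its quotient by \<open>J\<close>, as a
  map of the whole product: it reads the factor at the zero ideal and writes the factor at
  \<open>J\<close>.\<close>

lift_definition push :: "('i::finite, 'h::finite) km_datum \<Rightarrow> ('i, 'h) tm set \<Rightarrow> ('i, 'h) qalg \<Rightarrow> ('i, 'h) qalg" is
  "\<lambda>D J f D' J'. if D' = D \<and> J' = J then f D (zero_ideal D) else Hgen 0"
  by (auto simp: qeq_refl) (metis qeq_zero_ideal_iff qeq_tm_eq)

interpretation qv: vector_space sc
proof
  fix a b :: complex and x y :: "('i::finite, 'h::finite) qalg"
  show "a *q (x + y) = a *q x + a *q y" by transfer (blast intro: qeq_tm_eq vs_distr1)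
  show "(a + b) *q x = a *q x + b *q x" by transfer (blast intro: qeq_tm_eq vs_distr2)
  show "a *q b *q x = (a * b) *q x" by transfer (blast intro: qeq_tm_eq eq_sym[OF vs_mult])
  show "1 *q x = x" by transfer (blast intro: qeq_tm_eq vs_one)
qed

lemma br_add_left: "br (x + y) z = br x z + br y z"
  by transfer (blast intro: qeq_tm_eq Br_Add1)

lemma br_add_right: "br z (x + y) = br z x + br z y"
  by transfer (blast intro: qeq_tm_eq Br_Add2)

lemma br_sc_left: "br (c *q x) z = c *q br x z"
  by transfer (blast intro: qeq_tm_eq Br_Scal1)

lemma br_sc_right: "br z (c *q x) = c *q br z x"
  by transfer (blast intro: qeq_tm_eq Br_Scal2)

lemma br_0_left [simp]: "br 0 z = 0"
  by transfer (blast intro: qeq_tm_eq tm_eq_Br_0_left)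

lemma br_0_right [simp]: "br z 0 = 0"
  by transfer (blast intro: qeq_tm_eq tm_eq_Br_0_right)

lemma br_minus_left [simp]: "br (- x) z = - br x z"
  using br_add_left[of x "- x" z] by (simp add: eq_neg_iff_add_eq_0 add.commute)

lemma br_minus_right [simp]: "br z (- x) = - br z x"
  using br_add_right[of z x "- x"] by (simp add: eq_neg_iff_add_eq_0 add.commute)

lemma br_sum_right: "br z (sum g A) = (\<Sum>a\<in>A. br z (g a))"
  by (induction A rule: infinite_finite_induct) (simp_all add: br_add_right)

text \<open>Parity has to be a property of classes, so it asks for some representative that is
  homogeneous of the same parity in every factor.\<close>

lift_definition hom :: "bit \<Rightarrow> ('i::finite, 'h::finite) qalg \<Rightarrow> bool" is
  "\<lambda>a f. \<exists>g. (\<forall>D J. qeq D J (f D J) (g D J)) \<and> (\<forall>D J. homog D a (g D J))"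
  by (blast intro: qeq_sym qeq_trans)

lemma abs_qalg_ex: obtains f where "X = abs_qalg f"
  using Quotient_abs_rep[OF Quotient_qalg, of X] by metis

lemma homE:
  assumes "hom a X"
  obtains g where "X = abs_qalg g" "\<And>D J. homog D a (g D J)"
proof -
  obtain f where f: "X = abs_qalg f" by (rule abs_qalg_ex)
  from assms obtain g where "\<forall>D J. qeq D J (f D J) (g D J)" "\<forall>D J. homog D a (g D J)"
    unfolding f by (auto simp: hom.abs_eq)
  then have "X = abs_qalg g" unfolding f qalg.abs_eq_iff by blast
  then show ?thesis using that \<open>\<forall>D J. homog D a (g D J)\<close> by blast
qed

lemma hom_abs: "(\<And>D J. homog D a (g D J)) \<Longrightarrow> hom a (abs_qalg g)"
  unfolding hom.abs_eq by (blast intro: qeq_refl)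

lemma br_skew:
  assumes "hom a X" "hom b Y"
  shows "br X Y = (- sgn_bit (a * b)) *q br Y X"
  using assms
  by (elim homE) (simp only: br.abs_eq sc.abs_eq qalg.abs_eq_iff, blast intro: qeq_tm_eq skew)

lemma br_jacobi:
  assumes "hom a X" "hom b Y"
  shows "br X (br Y Z) = br (br X Y) Z + sgn_bit (a * b) *q br Y (br X Z)"
proof -
  obtain f where f: "Z = abs_qalg f" by (rule abs_qalg_ex)
  from assms show ?thesis unfolding f
    by (elim homE) (simp only: br.abs_eq sc.abs_eq plus_qalg.abs_eq qalg.abs_eq_iff,
        blast intro: qeq_tm_eq jacobi)
qed

lemma hom_0 [simp]: "hom a 0"
  unfolding zero_qalg.abs_eq by (intro hom_abs homog_zero)

lemma hom_add: "hom a X \<Longrightarrow> hom a Y \<Longrightarrow> hom a (X + Y)"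
  by (elim homE) (simp only: plus_qalg.abs_eq, rule hom_abs, rule homog_Add)

lemma hom_sc: "hom a X \<Longrightarrow> hom a (c *q X)"
  by (elim homE) (simp only: sc.abs_eq, rule hom_abs, rule homog_Scal)

lemma hom_br: "hom a X \<Longrightarrow> hom b Y \<Longrightarrow> hom (a + b) (br X Y)"
  by (elim homE) (simp only: br.abs_eq, rule hom_abs, rule homog_Br)

lemma hom_emb: "homog D a t \<Longrightarrow> hom a (emb D J t)"
  unfolding emb.abs_eq by (intro hom_abs) (simp add: homog_zero)

lemma emb_Add: "emb D J (Add s t) = emb D J s + emb D J t"
  by transfer (auto intro: qeq_tm_eq eq_refl eq_sym[OF vs_zero])

lemma emb_Scal: "emb D J (Scal c s) = c *q emb D J s"
  by transfer (auto intro: qeq_tm_eq eq_refl eq_sym[OF tm_eq_Scal_Hgen_0])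

lemma emb_Br: "emb D J (Br s t) = br (emb D J s) (emb D J t)"
  by transfer (auto intro: qeq_tm_eq eq_refl eq_sym[OF tm_eq_Br_0_left])

lemma emb_Hgen_0 [simp]: "emb D J (Hgen 0) = 0"
  by transfer (auto intro: qeq_refl)

lemma emb_eq_iff: "emb D J s = emb D J t \<longleftrightarrow> qeq D J s t"
  by transfer (auto simp: qeq_refl dest: spec)

lemma emb_eqI: "tm_eq D s t \<Longrightarrow> emb D J s = emb D J t"
  by (simp add: emb_eq_iff qeq_tm_eq)

lemma emb_eq_0_iff: "tm_ideal D J \<Longrightarrow> emb D J s = 0 \<longleftrightarrow> s \<in> J"
  using emb_eq_iff[of D J s "Hgen 0"] by (simp add: qeq_Hgen_0_iff)

lemma emb_zero_ideal_eq_iff: "emb D (zero_ideal D) s = emb D (zero_ideal D) t \<longleftrightarrow> tm_eq D s t"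
  by (simp add: emb_eq_iff qeq_zero_ideal_iff)

lemma push_emb: "push D J (emb D (zero_ideal D) t) = emb D J t"
  by transfer (auto intro: qeq_refl)

lemma push_add: "push D J (X + Y) = push D J X + push D J Y"
  by transfer (auto intro: qeq_tm_eq eq_refl eq_sym[OF vs_zero])

lemma push_sc: "push D J (c *q X) = c *q push D J X"
  by transfer (auto intro: qeq_tm_eq eq_refl eq_sym[OF tm_eq_Scal_Hgen_0])

lemma push_br: "push D J (br X Y) = br (push D J X) (push D J Y)"
  by transfer (auto intro: qeq_tm_eq eq_refl eq_sym[OF tm_eq_Br_0_left])

lemma push_0 [simp]: "push D J 0 = 0"
  by transfer (auto intro: qeq_refl)

lemma push_sum: "push D J (sum g A) = (\<Sum>a\<in>A. push D J (g a))"
  by (induction A rule: infinite_finite_induct) (simp_all add: push_add)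

subsection \<open>Weights and the triangular decomposition\<close>

lemma ev_add [simp]: "ev (a + b) x = ev a x + ev b x"
  by (simp add: ev_def sum.distrib algebra_simps)

lemma ev_uminus [simp]: "ev (- a) x = - ev a x"
  by (simp add: ev_def sum_negf)

lemma ev_scale [simp]: "ev (c *s a) x = c * ev a x"
  by (simp add: ev_def sum_distrib_left algebra_simps)

lemma ev_0 [simp]: "ev 0 x = 0"
  by (simp add: ev_def)

lemma ev_axis: "ev a (axis k 1) = a $ k"
proof -
  have "ev a (axis k 1) = (\<Sum>j\<in>UNIV. if j = k then a $ j else 0)"
    unfolding ev_def by (intro sum.cong) (auto simp: axis_def)
  then show ?thesis by simp
qed

lemma ev_separates: "a \<noteq> b \<Longrightarrow> \<exists>x. ev a x \<noteq> ev b x"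
  by (metis ev_axis vec_eq_iff)

lemma bit_add_self [simp]: "(a::bit) + a = 0"
  by (cases a) (simp_all add: add_bit_eq_xor)

lemma bit_mult_self [simp]: "(a::bit) * a = a"
  by (cases a) simp_all

lemma sgn_bit_square [simp]: "sgn_bit a * sgn_bit a = 1"
  by (simp add: sgn_bit_def)

lemma sgn_bit_0 [simp]: "sgn_bit 0 = 1"
  by (simp add: sgn_bit_def)

lemma root_map_add: "root_map x (u + v) = root_map x u + root_map x v"
  by (simp add: root_map_def sum.distrib vec.scale_left_distrib)

lemma root_map_0 [simp]: "root_map x 0 = 0"
  by (simp add: root_map_def)

lemma root_map_uminus: "root_map x (- v) = - root_map x v"
  by (simp add: root_map_def sum_negf)

lemma root_map_diff: "root_map x (u - v) = root_map x u - root_map x v"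
  using root_map_add[of x u "- v"] by (simp add: root_map_uminus)

lemma root_map_axis: "root_map x (axis i c) = of_int c *s x i"
proof -
  have "root_map x (axis i c) = (\<Sum>j\<in>UNIV. if j = i then of_int c *s x j else 0)"
    unfolding root_map_def by (intro sum.cong) (auto simp: axis_def)
  then show ?thesis by simp
qed

lemma root_map_uminus_fun: "root_map (\<lambda>i. - x i) v = - root_map x v"
  by (simp add: root_map_def sum_negf)

section \<open>Sums of weight vectors\<close>

lemma br_span:
  assumes "X \<in> qv.span B" "\<And>Y. Y \<in> B \<Longrightarrow> br g Y \<in> qv.span B'"
  shows "br g X \<in> qv.span B'"
  using assms(1)
proof (induction rule: qv.span_induct_alt)
  case base
  show ?case by (simp add: qv.span_zero)
next
  case (step c X Y)
  then show ?case using assms(2) by (simp add: br_add_right br_sc_right qv.span_add qv.span_scale)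
qed

text \<open>Terms with the same index are collected into one vector \<open>x d\<close>. So the
  indices in \<open>F\<close> are distinct, which the independence of weight vectors needs.\<close>

lemma qv_span_UN:
  assumes "X \<in> qv.span (\<Union>d\<in>G. B d)"
  shows "\<exists>F x. finite F \<and> F \<subseteq> G \<and> (\<forall>d\<in>F. x d \<in> qv.span (B d)) \<and> X = (\<Sum>d\<in>F. x d)"
  using assms
proof (induction rule: qv.span_induct_alt)
  case base
  show ?case by (intro exI[of _ "{}"]) simp
next
  case (step c b y)
  then obtain F x d where F: "finite F" "F \<subseteq> G" "\<forall>d\<in>F. x d \<in> qv.span (B d)" "y = (\<Sum>d\<in>F. x d)"
    and d: "d \<in> G" "b \<in> B d" by blast
  \<comment> \<open>Outside \<open>F\<close> the old value of \<open>x\<close> is arbitrary, hence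
    the start from 0 there.\<close>
  define x' where "x' = x(d := (if d \<in> F then x d else 0) + c *q b)"
  have "\<forall>d\<in>insert d F. x' d \<in> qv.span (B d)"
    using F(3) d by (auto simp: x'_def intro: qv.span_add qv.span_scale qv.span_zero qv.span_base)
  moreover have "c *q b + y = (\<Sum>d\<in>insert d F. x' d)"
  proof -
    have "(\<Sum>d\<in>insert d F. x' d) = x' d + (\<Sum>k\<in>F - {d}. x' k)"
      using F(1) by (rule sum.insert_remove)
    also have "(\<Sum>k\<in>F - {d}. x' k) = (\<Sum>k\<in>F - {d}. x k)"
      by (intro sum.cong) (auto simp: x'_def)
    also have "x' d + (\<Sum>k\<in>F - {d}. x k) = c *q b + y"
      using F(1,4) by (auto simp: x'_def sum.remove)
    finally show ?thesis by simp
  qed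
  ultimately show ?case using F(1,2) d(1) by (intro exI[of _ "insert d F"] exI[of _ x']) auto
qed

text \<open>The image \<open>h\<close> of the Cartan subalgebra is a parameter because weights are
  compared between the presented superalgebra and its quotients.\<close>

definition wt :: "(complex^'h \<Rightarrow> ('i::finite, 'h::finite) qalg) \<Rightarrow> complex^'h \<Rightarrow> ('i, 'h) qalg \<Rightarrow> bool" where
  "wt h \<alpha> X \<longleftrightarrow> (\<forall>x. br (h x) X = ev \<alpha> x *q X)"

lemma wt_0 [simp]: "wt h \<alpha> 0"
  by (simp add: wt_def)

lemma wt_add: "wt h \<alpha> X \<Longrightarrow> wt h \<alpha> Y \<Longrightarrow> wt h \<alpha> (X + Y)"
  by (simp add: wt_def br_add_right qv.scale_right_distrib)

lemma wt_sc: "wt h \<alpha> X \<Longrightarrow> wt h \<alpha> (c *q X)"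
  by (simp add: wt_def br_sc_right mult.commute)

lemma wt_uminus: "wt h \<alpha> X \<Longrightarrow> wt h \<alpha> (- X)"
  using wt_sc[of h \<alpha> X "-1"] by simp

lemma wt_span: "X \<in> qv.span B \<Longrightarrow> (\<And>Y. Y \<in> B \<Longrightarrow> wt h \<alpha> Y) \<Longrightarrow> wt h \<alpha> X"
  by (induction rule: qv.span_induct_alt) (auto intro: wt_add wt_sc)

lemma hom_span: "X \<in> qv.span B \<Longrightarrow> (\<And>Y. Y \<in> B \<Longrightarrow> hom a Y) \<Longrightarrow> hom a X"
  by (induction rule: qv.span_induct_alt) (auto intro: hom_add hom_sc)

lemma wt_independent:
  assumes "finite F" "inj_on \<omega> F" "\<And>k. k \<in> F \<Longrightarrow> wt h (\<omega> k) (x k)" "(\<Sum>k\<in>F. x k) = 0"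
  shows "\<forall>k\<in>F. x k = 0"
  using assms
proof (induction F arbitrary: x rule: finite_induct)
  case (insert k F)
  have zero: "x j = 0" if j: "j \<in> F" for j
  proof -
    obtain y where y: "ev (\<omega> j) y \<noteq> ev (\<omega> k) y"
      using ev_separates insert.prems(1) insert.hyps(2) j by (metis inj_on_contraD insert_iff)
    \<comment> \<open>Applying \<open>h y\<close> to the relation and subtracting the eigenvalue at
      \<open>k\<close> removes the term at \<open>k\<close> and multiplies the term at
      \<open>j\<close> by a nonzero number. The element \<open>y\<close> is chosen for
      \<open>j\<close> alone.\<close>
    let ?x = "\<lambda>j. (ev (\<omega> j) y - ev (\<omega> k) y) *q x j"
    have "(\<Sum>j\<in>insert k F. ?x j) = br (h y) (\<Sum>j\<in>insert k F. x j) - ev (\<omega> k) y *q (\<Sum>j\<in>insert k F. x j)"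
      unfolding br_sum_right qv.scale_sum_right sum_subtractf [symmetric]
      using insert.prems(2) by (intro sum.cong) (auto simp: wt_def qv.scale_left_diff_distrib)
    also have "\<dots> = 0" using insert.prems(3) by simp
    finally have "(\<Sum>j\<in>F. ?x j) = 0" using insert.hyps by simp
    moreover have "wt h (\<omega> i) (?x i)" if "i \<in> F" for i
      using insert.prems(2) that by (intro wt_sc) auto
    ultimately have "\<forall>i\<in>F. ?x i = 0"
      using insert.IH[of ?x] insert.prems(1) by simp
    then have "?x j = 0" using j by blast
    then show ?thesis using y by (simp del: qv.scale_left_diff_distrib)
  qed
  then show ?case using insert.prems(3) insert.hyps by simp
qed simp

text \<open>The difference of the sum and a vector of weight \<alpha> is again a sum of weight
  vectors, to which independence applies. If \<alpha> is one of the given weights, the sum is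
  subtracted from that summand; otherwise it becomes a further summand.\<close>

lemma wt_component:
  assumes "finite F" "inj_on \<omega> F" "\<And>k. k \<in> F \<Longrightarrow> wt h (\<omega> k) (x k)"
    "wt h \<alpha> (\<Sum>k\<in>F. x k)" "(\<Sum>k\<in>F. x k) \<noteq> 0"
  shows "\<exists>k\<in>F. \<omega> k = \<alpha> \<and> (\<Sum>k\<in>F. x k) = x k"
proof (cases "\<alpha> \<in> \<omega> ` F")
  case True
  then obtain k where k: "k \<in> F" "\<omega> k = \<alpha>" by auto
  let ?X = "\<Sum>k\<in>F. x k"
  let ?x = "x(k := x k + (- 1) *q ?X)"
  have "(\<Sum>k\<in>F. ?x k) = ?x k + (\<Sum>k\<in>F - {k}. ?x k)"
    using assms(1) k by (simp add: sum.remove)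
  also have "(\<Sum>k\<in>F - {k}. ?x k) = (\<Sum>k\<in>F - {k}. x k)"
    by (intro sum.cong) auto
  also have "?x k + \<dots> = 0"
    using assms(1) k by (simp add: sum.remove qv.scale_minus_left algebra_simps)
  finally have "(\<Sum>k\<in>F. ?x k) = 0" .
  moreover have "wt h (\<omega> j) (?x j)" if "j \<in> F" for j
    using that assms(3,4) k(2) by (simp only: fun_upd_def) (auto intro: wt_add wt_sc simp del: qv.scale_minus_left)
  ultimately have "\<forall>k\<in>F. ?x k = 0"
    using assms(1,2) by (intro wt_independent[of F \<omega> h])
  then have "x k + (- 1) *q ?X = 0" using k by (auto dest: bspec[of _ _ k])
  then have "?X = x k" by (simp add: qv.scale_minus_left)
  then show ?thesis using k by blast
next
  case False
  let ?X = "\<Sum>k\<in>F. x k"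
  \<comment> \<open>The index \<open>None\<close> stands for the further summand, minus the whole
    sum, of weight \<alpha>.\<close>
  let ?F = "insert None (Some ` F)"
  let ?x = "case_option ((- 1) *q ?X) x" and ?\<omega> = "case_option \<alpha> \<omega>"
  have "(\<Sum>k\<in>?F. ?x k) = 0"
    using assms(1) by (simp add: sum.reindex)
  then have "\<forall>k\<in>?F. ?x k = 0"
    using assms(1-4) False
    by (intro wt_independent[of ?F ?\<omega> h]) (auto intro: wt_uminus simp: inj_on_def)
  then show ?thesis using assms(5) by auto
qed

text \<open>Right-normed words in one family of generators, with their degree. The words in the
  \<open>f i\<close> use the same predicate, so their degrees are nonnegative too; \<open>V\<close>
  supplies the sign.\<close>

inductive pw :: "('i \<Rightarrow> ('i::finite, 'h::finite) qalg) \<Rightarrow> int^'i \<Rightarrow> ('i, 'h) qalg \<Rightarrow> bool" for e where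
  base: "pw e (axis i 1) (e i)"
| step: "pw e d X \<Longrightarrow> pw e (d + axis i 1) (br (e i) X)"

lemma pw_nonneg: "pw e d X \<Longrightarrow> 0 \<le> d $ i"
  by (induction rule: pw.induct) (auto simp: axis_def)

lemma pw_nonzero: "pw e d X \<Longrightarrow> d \<noteq> 0"
proof (induction rule: pw.induct)
  case (step d X i)
  then have "0 < (d + axis i 1) $ i" using pw_nonneg[of e d X i] by (simp add: axis_def)
  then show ?case by (metis less_irrefl zero_index)
qed (simp add: axis_eq_0_iff)

definition pdeg :: "('i::finite \<Rightarrow> bit) \<Rightarrow> int^'i \<Rightarrow> bit" where
  "pdeg p d = (\<Sum>i\<in>UNIV. of_int (d $ i) * p i)"

lemma pdeg_add [simp]: "pdeg p (c + d) = pdeg p c + pdeg p d"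
  by (simp add: pdeg_def sum.distrib distrib_right)

lemma pdeg_0 [simp]: "pdeg p 0 = 0"
  by (simp add: pdeg_def)

lemma pdeg_uminus [simp]: "pdeg p (- d) = pdeg p d"
  using pdeg_add[of p d "- d"] by (simp del: pdeg_add) (metis bit_add_self add_left_cancel)

lemma pdeg_axis [simp]: "pdeg p (axis i 1) = p i"
proof -
  have "pdeg p (axis i 1) = (\<Sum>j\<in>UNIV. if j = i then p j else 0)"
    unfolding pdeg_def by (intro sum.cong) (auto simp: axis_def)
  then show ?thesis by simp
qed

text \<open>These relations hold in every quotient of the presented superalgebra and survive an
  exchange of \<open>e\<close> and \<open>f\<close>, so each fact about one half of the algebra
  serves for the other. By \<open>al_indep\<close>, distinct degrees have distinct weights.\<close>

locale contra =
  fixes e f :: "'i::finite \<Rightarrow> ('i, 'h::finite) qalg"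
    and h :: "complex^'h \<Rightarrow> ('i, 'h) qalg"
    and p :: "'i \<Rightarrow> bit"
    and al ch :: "'i \<Rightarrow> complex^'h"
  assumes hom_e: "hom (p i) (e i)" and hom_f: "hom (p i) (f i)" and hom_h: "hom 0 (h x)"
    and h_add: "h (x + y) = h x + h y" and h_sc: "h (c *s x) = c *q h x"
    and hh: "br (h x) (h y) = 0"
    and he: "br (h x) (e i) = ev (al i) x *q e i"
    and hf: "br (h x) (f i) = (- ev (al i) x) *q f i"
    and ef: "br (e i) (f j) = (if i = j then h (ch i) else 0)"
    and al_indep: "root_map al d = 0 \<Longrightarrow> d = 0"
begin

lemma inj_root_map: "inj (root_map al)"
  by (rule injI) (metis al_indep root_map_diff right_minus_eq)

lemma h_0 [simp]: "h 0 = 0"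
  using h_sc[of 0 0] by simp

lemma fe: "br (f i) (e j) = (if i = j then (- sgn_bit (p i)) *q h (ch i) else 0)"
  using br_skew[OF hom_f[of i] hom_e[of j]] ef by auto

lemma eh: "br (e i) (h x) = (- ev (al i) x) *q e i"
  using br_skew[OF hom_e[of i] hom_h[of x]] he by simp

lemma pw_wt: "pw e d X \<Longrightarrow> wt h (root_map al d) X"
proof (induction rule: pw.induct)
  case (base i)
  then show ?case by (simp add: wt_def he root_map_axis)
next
  case (step d X i)
  then show ?case
    using br_jacobi[OF hom_h hom_e, of _ i X]
    by (auto simp: wt_def he root_map_add root_map_axis br_sc_left br_sc_right qv.scale_left_distrib)
qed

lemma pw_hom: "pw e d X \<Longrightarrow> hom (pdeg p d) X"
  by (induction rule: pw.induct) (auto simp: add.commute intro: hom_e hom_br)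

definition pos :: "bit \<Rightarrow> ('i, 'h) qalg set" where
  "pos a = {X. \<exists>d. pw e d X \<and> pdeg p d = a}"

definition cart :: "bit \<Rightarrow> ('i, 'h) qalg set" where
  "cart a = {X. a = 0 \<and> X \<in> range h}"

lemma e_pos: assumes "X \<in> qv.span (pos a \<union> cart a)" shows "br (e i) X \<in> qv.span (pos (a + p i))"
proof (rule br_span[OF assms])
  fix X assume X: "X \<in> pos a \<union> cart a"
  show "br (e i) X \<in> qv.span (pos (a + p i))"
  proof (cases "X \<in> pos a")
    case True
    then obtain d where "pw e d X" "pdeg p d = a" by (auto simp: pos_def)
    then have "br (e i) X \<in> pos (a + p i)"
      unfolding pos_def using pw.step[of e d X i] by (intro CollectI exI[of _ "d + axis i 1"]) simp
    then show ?thesis by (rule qv.span_base)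
  next
    case False
    then obtain x where x: "a = 0" "X = h x" using X by (auto simp: cart_def)
    have "e i \<in> pos (p i)" unfolding pos_def using pw.base[of e i]
      by (intro CollectI exI[of _ "axis i 1"]) simp
    then show ?thesis unfolding x eh by (simp del: qv.scale_minus_left add: qv.span_scale qv.span_base)
  qed
qed

text \<open>Moving \<open>f j\<close> past \<open>e i\<close> costs \<open>[f_j, e_i]\<close>, which
  lies in the Cartan subalgebra and acts on the shorter word by a scalar. Hence no words in the
  \<open>f i\<close> arise; the Cartan subalgebra is reached only from words of length 1.\<close>

lemma f_pw: "pw e d X \<Longrightarrow> br (f j) X \<in> qv.span (pos (pdeg p d + p j) \<union> cart (pdeg p d + p j))"
proof (induction rule: pw.induct)
  case (base i)
  have "h (ch i) \<in> cart (p i + p i)" by (simp add: cart_def)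
  then have "h (ch i) \<in> qv.span (pos (p i + p i) \<union> cart (p i + p i))"
    by (intro qv.span_base) simp
  then show ?case by (auto simp: fe simp del: bit_add_self intro: qv.span_neg qv.span_scale qv.span_zero)
next
  case (step d X i)
  let ?S = "pos (pdeg p d + p i + p j) \<union> cart (pdeg p d + p i + p j)"
  have "br (br (f j) (e i)) X \<in> qv.span ?S"
  proof (cases "i = j")
    case True
    have "X \<in> pos (pdeg p d + p i + p j)"
      using step True by (auto simp: pos_def add.assoc)
    then show ?thesis using pw_wt[OF step.hyps] True
      by (simp add: fe wt_def br_sc_left qv.span_scale qv.span_base qv.span_neg)
  qed (auto simp: fe qv.span_zero)
  moreover have "br (e i) (br (f j) X) \<in> qv.span ?S"
    using e_pos[OF step.IH, of i] qv.span_mono[of "pos (pdeg p d + p i + p j)" ?S]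
    by (auto simp: ac_simps)
  ultimately show ?case
    unfolding br_jacobi[OF hom_f hom_e] by (auto simp: qv.span_add qv.span_scale)
qed

text \<open>By skew-symmetry \<open>[f_i, e_i]\<close> is \<open>h (ch i)\<close> up to the factor
  \<open>- sgn_bit (p i)\<close>, and the factor in the new generators cancels it. All roots change
  sign.\<close>

lemma swap: "contra f (\<lambda>j. (- sgn_bit (p j)) *q e j) h p (\<lambda>i. - al i) ch"
proof
  show "br (f i) ((- sgn_bit (p j)) *q e j) = (if i = j then h (ch i) else 0)" for i j
    by (auto simp: br_sc_right fe)
qed (auto simp: hom_f hom_h h_add h_sc hh hf he br_sc_right root_map_uminus_fun al_indep mult.commute
    intro: hom_sc hom_e simp del: qv.scale_minus_left)

end

section \<open>The two halves of the triangular decomposition together\<close>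

context contra
begin

interpretation sw: contra f "\<lambda>j. (- sgn_bit (p j)) *q e j" h p "\<lambda>i. - al i" ch
  by (rule swap)

definition neg :: "bit \<Rightarrow> ('i, 'h) qalg set" where
  "neg a = {X. \<exists>d. pw f d X \<and> pdeg p d = a}"

text \<open>The candidate for the part of parity \<open>a\<close>. Unlike \<open>hom\<close>, it is
  a span of vectors of known degree, which allows even and odd parts to be proved disjoint.\<close>

definition S :: "bit \<Rightarrow> ('i, 'h) qalg set" where
  "S a = qv.span (pos a \<union> cart a \<union> neg a)"

text \<open>The part of degree \<open>d\<close> of the root lattice grading. Words never have degree
  0, so in degree 0 only the Cartan subalgebra is left.\<close>

definition V :: "int^'i \<Rightarrow> ('i, 'h) qalg set" where
  "V d = qv.span ({X. pw e d X} \<union> {X. d = 0 \<and> X \<in> range h} \<union> {X. pw f (- d) X})"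

lemma S_add: "X \<in> S a \<Longrightarrow> Y \<in> S a \<Longrightarrow> X + Y \<in> S a"
  unfolding S_def by (rule qv.span_add)

lemma S_sc: "X \<in> S a \<Longrightarrow> c *q X \<in> S a"
  unfolding S_def by (rule qv.span_scale)

lemma S_0: "0 \<in> S a"
  unfolding S_def by (rule qv.span_zero)

lemma e_S: assumes "X \<in> S a" shows "br (e i) X \<in> S (a + p i)"
  using assms unfolding S_def
proof (rule br_span)
  fix X assume step: "X \<in> pos a \<union> cart a \<union> neg a"
  show "br (e i) X \<in> qv.span (pos (a + p i) \<union> cart (a + p i) \<union> neg (a + p i))"
  proof (cases "X \<in> neg a")
    case True
    then obtain d where d: "pw f d X" "pdeg p d = a" by (auto simp: neg_def)
    have "br ((- sgn_bit (p i)) *q e i) X \<in> qv.span (sw.pos (a + p i) \<union> sw.cart (a + p i))"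
      using sw.f_pw[OF d(1), of i] d(2) by simp
    also have "\<dots> \<subseteq> qv.span (pos (a + p i) \<union> cart (a + p i) \<union> neg (a + p i))"
      by (intro qv.span_mono) (auto simp: sw.pos_def neg_def sw.cart_def cart_def)
    \<comment> \<open>The scalar is its own inverse, so this removes the factor that the exchange
      put on \<open>e i\<close>.\<close>
    finally have "(- sgn_bit (p i)) *q br ((- sgn_bit (p i)) *q e i) X \<in>
        qv.span (pos (a + p i) \<union> cart (a + p i) \<union> neg (a + p i))"
      by (rule qv.span_scale)
    then show ?thesis by (simp add: br_sc_left del: bit_add_self)
  next
    case False
    then have "X \<in> qv.span (pos a \<union> cart a)" using step by (auto intro: qv.span_base)
    from e_pos[OF this, of i] show ?thesis
      by (rule set_mp[OF qv.span_mono, rotated]) blast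
  qed
qed

lemma f_S: assumes "X \<in> S a" shows "br (f i) X \<in> S (a + p i)"
  using assms unfolding S_def
proof (rule br_span)
  fix X assume step: "X \<in> pos a \<union> cart a \<union> neg a"
  show "br (f i) X \<in> qv.span (pos (a + p i) \<union> cart (a + p i) \<union> neg (a + p i))"
  proof (cases "X \<in> pos a")
    case True
    then obtain d where d: "pw e d X" "pdeg p d = a" by (auto simp: pos_def)
    from f_pw[OF d(1), of i] show ?thesis unfolding d(2)
      by (rule set_mp[OF qv.span_mono, rotated]) blast
  next
    case False
    then have "X \<in> qv.span (sw.pos a \<union> sw.cart a)"
      using step by (auto simp: sw.pos_def neg_def sw.cart_def cart_def intro!: qv.span_base)
    from sw.e_pos[OF this, of i] show ?thesis
      by (rule set_mp[OF qv.span_mono, rotated]) (auto simp: sw.pos_def neg_def)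
  qed
qed

lemma neg_pw_wt: "pw f d X \<Longrightarrow> wt h (- root_map al d) X"
  using sw.pw_wt by (simp add: root_map_uminus_fun)

lemma h_wt: "wt h 0 (h x)"
  by (simp add: wt_def hh)

lemma h_S: assumes "X \<in> S a" shows "br (h x) X \<in> S a"
  using assms unfolding S_def
proof (rule br_span)
  fix X assume step: "X \<in> pos a \<union> cart a \<union> neg a"
  from step have "\<exists>\<alpha>. wt h \<alpha> X"
    unfolding pos_def neg_def cart_def using pw_wt neg_pw_wt h_wt by blast
  then obtain c where "br (h x) X = c *q X" by (auto simp: wt_def)
  then show "br (h x) X \<in> qv.span (pos a \<union> cart a \<union> neg a)"
    using qv.span_scale[OF qv.span_base[OF step]] by simp
qed

text \<open>By the Jacobi identity \<open>[[g_i, X], Y]\<close> is a combination of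
  \<open>[g_i, [X, Y]]\<close> and \<open>[X, [g_i, Y]]\<close>, so stability under the generators
  passes to all words. The family \<open>T\<close> is left open: it is \<open>S\<close> here and the
  ideal of a singular vector later.\<close>

lemma pw_stable:
  assumes "pw g d X" and g: "\<And>i. hom (p i) (g i)"
    and T: "\<And>i b Z. Z \<in> T b \<Longrightarrow> br (g i) Z \<in> T (b + p i)"
      "\<And>b Y Z. Y \<in> T b \<Longrightarrow> Z \<in> T b \<Longrightarrow> Y + Z \<in> T b" "\<And>b c Z. Z \<in> T b \<Longrightarrow> c *q Z \<in> T b"
  shows "Y \<in> T b \<Longrightarrow> br X Y \<in> T (b + pdeg p d)"
  using assms(1)
proof (induction arbitrary: Y b rule: pw.induct)
  case (base i)
  then show ?case by (simp add: T)
next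
  case (step d X i)
  have X: "hom (pdeg p d) X"
    using step.hyps by (induction rule: pw.induct) (auto simp: add.commute intro: g hom_br)
  let ?s = "sgn_bit (p i * pdeg p d)"
  have "br (g i) (br X Y) = br (br (g i) X) Y + ?s *q br X (br (g i) Y)"
    by (rule br_jacobi[OF g X])
  then have "br (br (g i) X) Y = br (g i) (br X Y) + (- ?s) *q br X (br (g i) Y)"
    by (simp add: qv.scale_minus_left)
  moreover have "br (g i) (br X Y) \<in> T (b + pdeg p d + p i)"
    by (intro T step)
  moreover have "br X (br (g i) Y) \<in> T (b + p i + pdeg p d)"
    by (intro step.IH T step)
  ultimately show ?case by (simp add: T ac_simps del: qv.scale_minus_left)
qed

lemma S_br: assumes "X \<in> S a" "Y \<in> S b" shows "br X Y \<in> S (a + b)"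
  using assms(1) unfolding S_def[of a]
proof (induction rule: qv.span_induct_alt)
  case base
  show ?case by (simp add: S_0)
next
  case (step c X Z)
  have "br X Y \<in> S (b + pdeg p d)" if "pw e d X" for d
    by (rule pw_stable[of e, where T = S]) (auto intro: that hom_e e_S S_add S_sc assms)
  moreover have "br X Y \<in> S (b + pdeg p d)" if "pw f d X" for d
    by (rule pw_stable[of f, where T = S]) (auto intro: that hom_f f_S S_add S_sc assms)
  ultimately have "br X Y \<in> S (b + a)"
    using step(1) h_S assms(2) unfolding pos_def neg_def cart_def by auto
  then show ?case using step(2) by (simp add: br_add_left br_sc_left S_add S_sc add.commute)
qed

lemma e_in_S: "e i \<in> S (p i)"
  unfolding S_def pos_def by (rule qv.span_base) (use pw.base[of e i] in force)

lemma f_in_S: "f i \<in> S (p i)"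
  unfolding S_def neg_def by (rule qv.span_base) (use pw.base[of f i] in force)

lemma h_in_S: "h x \<in> S 0"
  unfolding S_def cart_def by (rule qv.span_base) blast

lemma S_hom: "X \<in> S a \<Longrightarrow> hom a X"
  unfolding S_def pos_def neg_def cart_def
  by (erule hom_span) (auto intro: pw_hom sw.pw_hom hom_h)

lemma V_wt: "X \<in> V d \<Longrightarrow> wt h (root_map al d) X"
  unfolding V_def
  by (erule wt_span) (auto dest: pw_wt neg_pw_wt simp: root_map_uminus wt_def hh)

lemma V_sub_S: "V d \<subseteq> S (pdeg p d)"
proof -
  have "pdeg p (- d) = pdeg p d" by simp
  then show ?thesis
    unfolding V_def S_def pos_def neg_def cart_def by (intro qv.span_mono) (auto simp del: pdeg_uminus)
qed

lemma V_zero_degree: "X \<in> V 0 \<Longrightarrow> \<exists>x. X = h x"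
  unfolding V_def
proof (induction rule: qv.span_induct_alt)
  case base
  show ?case by (intro exI[of _ 0]) simp
next
  case (step c X Y)
  then obtain x y where "X = h x" "Y = h y" by (auto dest: pw_nonzero)
  then show ?case by (intro exI[of _ "c *s x + y"]) (simp add: h_add h_sc)
qed

lemma V_nonzero: "X \<in> V d \<Longrightarrow> X \<noteq> 0 \<Longrightarrow> (\<forall>i. 0 \<le> d $ i) \<or> (\<forall>i. d $ i \<le> 0)"
  unfolding V_def
proof (induction rule: qv.span_induct_alt)
  case (step c Y Z)
  then show ?case using pw_nonneg[of e d] pw_nonneg[of f "- d"] by force
qed simp

text \<open>A word whose degree is a multiple of one simple degree has no other letter. If it has at
  least two letters, its innermost bracket is \<open>[e_i, e_i]\<close>.\<close>

lemma V_simple_multiple: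
  assumes "X \<in> V (axis i (int k))" "X \<noteq> 0" "k \<ge> 2"
  shows "br (e i) (e i) \<noteq> 0"
proof
  assume 0: "br (e i) (e i) = 0"
  have d: "d = axis i (int l - 1) \<and> j = i" if "pw e d Y" "d + axis j 1 = axis i (int l)" for d j Y l
  proof -
    have "0 < (d + axis j 1) $ j" using pw_nonneg[OF that(1), of j] by simp
    then have "j = i" unfolding that(2) by (auto simp: axis_def split: if_splits)
    have "d $ m = axis i (int l - 1) $ m" for m
    proof -
      have "(d + axis j 1) $ m = axis i (int l) $ m" by (simp only: that)
      then show ?thesis using \<open>j = i\<close> by (auto simp: axis_def split: if_splits)
    qed
    then show ?thesis using \<open>j = i\<close> by (simp add: vec_eq_iff)
  qed
  \<comment> \<open>All lengths \<open>l\<close> at once, because the induction on words shortens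
    them down to a single letter.\<close>
  have pw_pow: "(l = 1 \<and> Y = e i) \<or> Y = 0" if "pw e c Y" "c = axis i (int l)" "l \<ge> 1" for c Y l
    using that
  proof (induction arbitrary: l rule: pw.induct)
    case (base j)
    then have "j = i \<and> l = 1" by (auto simp: axis_eq_axis)
    then show ?case by simp
  next
    case (step c Y j)
    note c = d[OF step.hyps step.prems(1)]
    have "l \<noteq> 1" using c pw_nonzero[OF step.hyps] by auto
    then have "(l - 1 = 1 \<and> Y = e i) \<or> Y = 0"
      using c step.prems by (intro step.IH) auto
    then show ?case using c 0 by auto
  qed
  have no_f: "\<not> pw f (- axis i (int k)) Y" for Y
    using pw_nonneg[of f "- axis i (int k)" Y i] assms(3) by (auto simp: axis_def)
  have "axis i (int k) \<noteq> 0" using assms(3) by (simp add: axis_eq_0_iff)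
  have "X = 0"
    using assms(1) unfolding V_def
  proof (induction rule: qv.span_induct_alt)
    case (step c Y Z)
    then show ?case using pw_pow[of _ _ k] assms(3)
      no_f \<open>axis i (int k) \<noteq> 0\<close> by auto
  qed simp
  then show False using assms(2) by simp
qed

lemma S_decompose:
  assumes "X \<in> S a"
  obtains F x where "finite F" "\<And>d. d \<in> F \<Longrightarrow> pdeg p d = a" "\<And>d. d \<in> F \<Longrightarrow> x d \<in> V d"
    "X = (\<Sum>d\<in>F. x d)"
proof -
  let ?B = "\<lambda>d. {X. pw e d X} \<union> {X. d = 0 \<and> X \<in> range h} \<union> {X. pw f (- d) X}"
  have "pos a \<union> cart a \<union> neg a \<subseteq> (\<Union>d\<in>{d. pdeg p d = a}. ?B d)"
  proof
    fix X assume "X \<in> pos a \<union> cart a \<union> neg a"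
    then consider d where "pw e d X" "pdeg p d = a" | "a = 0" "X \<in> range h" | d where "pw f d X" "pdeg p d = a"
      unfolding pos_def neg_def cart_def by blast
    then show "X \<in> (\<Union>d\<in>{d. pdeg p d = a}. ?B d)"
    proof cases
      case 2
      then show ?thesis by (intro UN_I[of 0]) auto
    next
      case (3 d)
      then show ?thesis by (intro UN_I[of "- d"]) auto
    qed blast
  qed
  then have "X \<in> qv.span (\<Union>d\<in>{d. pdeg p d = a}. ?B d)"
    using assms qv.span_mono unfolding S_def by blast
  from qv_span_UN[OF this] show ?thesis using that unfolding V_def by blast
qed

text \<open>Parity is a function of the degree, so an even and an odd combination share no degree.
  Their difference is then a sum of weight vectors with distinct weights.\<close>

lemma S_disjoint: assumes "X \<in> S 0" "X \<in> S 1" shows "X = 0"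
proof -
  obtain F x where F: "finite F" "\<And>d. d \<in> F \<Longrightarrow> pdeg p d = 0" "\<And>d. d \<in> F \<Longrightarrow> x d \<in> V d"
    "X = (\<Sum>d\<in>F. x d)" using S_decompose[OF assms(1)] by blast
  obtain G y where G: "finite G" "\<And>d. d \<in> G \<Longrightarrow> pdeg p d = 1" "\<And>d. d \<in> G \<Longrightarrow> y d \<in> V d"
    "X = (\<Sum>d\<in>G. y d)" using S_decompose[OF assms(2)] by blast
  let ?z = "\<lambda>d. if d \<in> F then x d else (- 1) *q y d"
  have FG: "F \<inter> G = {}" using F(2) G(2) by fastforce
  have "(\<Sum>d\<in>F \<union> G. ?z d) = (\<Sum>d\<in>F. ?z d) + (\<Sum>d\<in>G. ?z d)"
    by (rule sum.union_disjoint[OF F(1) G(1) FG])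
  also have "(\<Sum>d\<in>F. ?z d) = X" using F(4) by simp
  also have "(\<Sum>d\<in>G. ?z d) = (\<Sum>d\<in>G. (- 1) *q y d)"
    using FG by (intro sum.cong) auto
  also have "\<dots> = (- 1) *q X" unfolding G(4) by (rule qv.scale_sum_right[symmetric])
  finally have "(\<Sum>d\<in>F \<union> G. ?z d) = 0" by (simp add: qv.scale_minus_left)
  moreover have "wt h (root_map al d) (?z d)" if "d \<in> F \<union> G" for d
    using that F(3) G(3) by (auto intro: V_wt wt_sc simp del: qv.scale_minus_left)
  ultimately have "\<forall>d\<in>F \<union> G. ?z d = 0"
    using F(1) G(1) inj_root_map by (intro wt_independent[of "F \<union> G" "root_map al" h]) (auto simp: inj_on_def)
  then have "(\<Sum>d\<in>F. x d) = 0" by (intro sum.neutral) (metis UnI1)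
  then show ?thesis using F(4) by simp
qed

lemma sum_S_decompose:
  assumes "X0 \<in> S 0" "X1 \<in> S 1"
  obtains F x where "finite F" "\<And>d. d \<in> F \<Longrightarrow> x d \<in> V d" "X0 + X1 = (\<Sum>d\<in>F. x d)"
proof -
  obtain F x where F: "finite F" "\<And>d. d \<in> F \<Longrightarrow> pdeg p d = 0" "\<And>d. d \<in> F \<Longrightarrow> x d \<in> V d"
    "X0 = (\<Sum>d\<in>F. x d)" using S_decompose[OF assms(1)] by blast
  obtain G y where G: "finite G" "\<And>d. d \<in> G \<Longrightarrow> pdeg p d = 1" "\<And>d. d \<in> G \<Longrightarrow> y d \<in> V d"
    "X1 = (\<Sum>d\<in>G. y d)" using S_decompose[OF assms(2)] by blast
  let ?z = "\<lambda>d. if d \<in> F then x d else y d"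
  have FG: "F \<inter> G = {}" using F(2) G(2) by fastforce
  have "(\<Sum>d\<in>F \<union> G. ?z d) = (\<Sum>d\<in>F. ?z d) + (\<Sum>d\<in>G. ?z d)"
    by (rule sum.union_disjoint[OF F(1) G(1) FG])
  also have "(\<Sum>d\<in>F. ?z d) = X0" using F(4) by simp
  also have "(\<Sum>d\<in>G. ?z d) = X1" unfolding G(4) using FG by (intro sum.cong) auto
  finally show ?thesis using F G by (intro that[of "F \<union> G" ?z]) auto
qed

lemma sum_S_weight:
  assumes "X0 \<in> S 0" "X1 \<in> S 1" "wt h \<alpha> (X0 + X1)" "X0 + X1 \<noteq> 0"
  shows "\<exists>d. root_map al d = \<alpha> \<and> X0 + X1 \<in> V d"
proof -
  obtain F x where F: "finite F" "\<And>d. d \<in> F \<Longrightarrow> x d \<in> V d"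
    "X0 + X1 = (\<Sum>d\<in>F. x d)" using sum_S_decompose[OF assms(1,2)] by blast
  have "\<exists>d\<in>F. root_map al d = \<alpha> \<and> (\<Sum>d\<in>F. x d) = x d"
    using F assms inj_root_map by (intro wt_component[where h = h]) (auto simp: inj_on_def intro: V_wt)
  then show ?thesis using F by metis
qed

lemma h_in_nonzero_weights:
  assumes "h x \<in> qv.span (\<Union>d\<in>-{0}. V d)"
  shows "h x = 0"
proof (rule ccontr)
  assume "h x \<noteq> 0"
  from qv_span_UN[OF assms] obtain F y where F: "finite F" "F \<subseteq> -{0}" "\<forall>d\<in>F. y d \<in> qv.span (V d)"
    "h x = (\<Sum>d\<in>F. y d)" by metis
  have "\<forall>d\<in>F. y d \<in> V d" using F(3) unfolding V_def by (simp add: qv.span_span)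
  then have "\<exists>d\<in>F. root_map al d = 0 \<and> (\<Sum>d\<in>F. y d) = y d"
    using F(4) inj_root_map \<open>h x \<noteq> 0\<close> h_wt[of x]
    by (intro wt_component[OF F(1), of _ h]) (auto intro: V_wt simp: inj_on_def)
  then show False using F(2) al_indep by auto
qed

end

subsection \<open>The maximal ideal\<close>

lemma independent_family:
  assumes "inj x" "vec.independent (range x)" "(\<Sum>i\<in>UNIV. c i *s x i) = (0 :: complex^'h)"
  shows "c (i :: 'i::finite) = 0"
proof (rule ccontr)
  assume "c i \<noteq> 0"
  have "(\<Sum>v\<in>range x. c (inv x v) *s v) = 0"
    using assms(1,3) by (simp add: sum.reindex)
  moreover have "c (inv x (x i)) \<noteq> 0" using \<open>c i \<noteq> 0\<close> assms(1) by simp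
  ultimately have "vec.dependent (range x)"
    by (subst vec.dependent_finite) (auto intro!: exI[of _ "\<lambda>v. c (inv x v)"])
  then show False using assms(2) by simp
qed

lemma root_map_eq_0:
  assumes "inj x" "vec.independent (range x)" "root_map x d = 0"
  shows "d = 0"
  using independent_family[OF assms(1,2), of "\<lambda>i. of_int (d $ i)"] assms(3)
  by (simp add: root_map_def vec_eq_iff)

lemma contra_emb:
  assumes "realization D"
  shows "contra (\<lambda>i. emb D J (Egen i)) (\<lambda>i. emb D J (Fgen i)) (\<lambda>x. emb D J (Hgen x))
    (par D) (rt D) (crt D)"
proof
  show "emb D J (Hgen (x + y)) = emb D J (Hgen x) + emb D J (Hgen y)" for x y
    by (simp only: emb_eqI[OF H_add] emb_Add)
  show "emb D J (Hgen (c *s x)) = c *q emb D J (Hgen x)" for c x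
    by (simp only: emb_eqI[OF H_scal] emb_Scal)
  show "br (emb D J (Hgen x)) (emb D J (Hgen y)) = 0" for x y
    using emb_eqI[OF rel_HH] by (simp add: emb_Br)
  show "br (emb D J (Hgen x)) (emb D J (Egen i)) = ev (rt D i) x *q emb D J (Egen i)" for x i
    using emb_eqI[OF rel_HE] by (simp add: emb_Br emb_Scal)
  show "br (emb D J (Hgen x)) (emb D J (Fgen i)) = (- ev (rt D i) x) *q emb D J (Fgen i)" for x i
    using emb_eqI[OF rel_HF] by (simp only: emb_Br emb_Scal)
  show "br (emb D J (Egen i)) (emb D J (Fgen j)) = (if i = j then emb D J (Hgen (crt D i)) else 0)" for i j
    using emb_eqI[OF rel_EF[of D i j], of J] by (auto simp: emb_Br)
qed (use assms root_map_eq_0 in \<open>auto simp: realization_def intro!: hom_emb homog.intros\<close>)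

lemma homog_decomposition:
  "\<exists>s0 s1. homog D 0 s0 \<and> homog D 1 s1 \<and> tm_eq D t (Add s0 s1)"
proof -
  have gen: "\<exists>s0 s1. homog D 0 s0 \<and> homog D 1 s1 \<and> tm_eq D t (Add s0 s1)" if t: "homog D a t" for a t
  proof (cases a)
    case zero
    then show ?thesis using t
      by (intro exI[of _ t] exI[of _ "Hgen 0"] conjI homog_zero eq_sym[OF vs_zero]) simp
  next
    case one
    then show ?thesis using t
      by (intro exI[of _ "Hgen 0"] exI[of _ t] conjI homog_zero eq_sym[OF tm_eq_zero_left]) simp
  qed
  show ?thesis
  proof (induction t)
    case (Hgen x)
    show ?case by (rule gen[OF homog_H])
  next
    case (Egen i)
    show ?case by (rule gen[OF homog_E])
  next
    case (Fgen i)
    show ?case by (rule gen[OF homog_F])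
  next
    case (Add s t)
    then obtain s0 s1 t0 t1 where "homog D 0 s0" "homog D 1 s1" "tm_eq D s (Add s0 s1)"
      "homog D 0 t0" "homog D 1 t1" "tm_eq D t (Add t0 t1)" by blast
    then show ?case
      by (intro exI[of _ "Add s0 t0"] exI[of _ "Add s1 t1"] conjI homog_Add
          eq_trans[OF cong_Add tm_eq_swap_middle])
  next
    case (Scal c s)
    then obtain s0 s1 where "homog D 0 s0" "homog D 1 s1" "tm_eq D s (Add s0 s1)" by blast
    then show ?case
      by (intro exI[of _ "Scal c s0"] exI[of _ "Scal c s1"] conjI homog_Scal
          eq_trans[OF cong_Scal vs_distr1])
  next
    case (Br s t)
    then obtain s0 s1 t0 t1 where *: "homog D 0 s0" "homog D 1 s1" "tm_eq D s (Add s0 s1)"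
      "homog D 0 t0" "homog D 1 t1" "tm_eq D t (Add t0 t1)" by blast
    have "homog D 0 (Add (Br s0 t0) (Br s1 t1))"
      using homog_Br[OF *(1,4)] homog_Br[OF *(2,5)] by (auto intro: homog_Add)
    moreover have "homog D 1 (Add (Br s0 t1) (Br s1 t0))"
      using homog_Br[OF *(1,5)] homog_Br[OF *(2,4)] by (auto intro: homog_Add)
    moreover have "tm_eq D (Br s t) (Add (Add (Br s0 t0) (Br s1 t1)) (Add (Br s0 t1) (Br s1 t0)))"
      using *(3,6) unfolding emb_zero_ideal_eq_iff[symmetric]
      by (simp add: emb_Add emb_Br br_add_left br_add_right)
    ultimately show ?case by blast
  qed
qed

text \<open>Used with \<open>zero_ideal D\<close> for the presented superalgebra and with
  \<open>max_ideal D\<close> for \<gg>(A,p).\<close>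

locale km_quot =
  fixes D :: "('i::finite, 'h::finite) km_datum" and J :: "('i, 'h) tm set"
  assumes real: "realization D"
begin

sublocale contra "\<lambda>i. emb D J (Egen i)" "\<lambda>i. emb D J (Fgen i)" "\<lambda>x. emb D J (Hgen x)"
  "par D" "rt D" "crt D"
  by (rule contra_emb[OF real])

lemma homog_S: "homog D a t \<Longrightarrow> emb D J t \<in> S a"
  by (induction rule: homog.induct)
    (auto simp: emb_Add emb_Scal emb_Br S_0 intro: S_add S_sc S_br e_in_S f_in_S h_in_S)

lemma emb_parts:
  obtains s0 s1 where "homog D 0 s0" "homog D 1 s1" "tm_eq D t (Add s0 s1)"
    "emb D J s0 \<in> S 0" "emb D J s1 \<in> S 1" "emb D J t = emb D J s0 + emb D J s1"
proof -
  obtain s0 s1 where *: "homog D 0 s0" "homog D 1 s1" "tm_eq D t (Add s0 s1)"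
    using homog_decomposition by blast
  then show ?thesis using that[OF *] homog_S emb_eqI[OF *(3), of J] by (simp add: emb_Add)
qed

lemma emb_decompose:
  obtains F x where "finite F" "\<And>d. d \<in> F \<Longrightarrow> x d \<in> V d" "emb D J t = (\<Sum>d\<in>F. x d)"
  using emb_parts[of t] sum_S_decompose by metis

lemma emb_weight:
  assumes "wt (\<lambda>x. emb D J (Hgen x)) \<alpha> (emb D J t)" "emb D J t \<noteq> 0"
  shows "\<exists>d. root_map (rt D) d = \<alpha> \<and> emb D J t \<in> V d"
  using emb_parts[of t] assms sum_S_weight by metis

lemma subspace_range_emb: "qv.subspace (range (emb D J))"
  unfolding qv.subspace_def
proof (intro conjI ballI allI)
  show "0 \<in> range (emb D J)" using emb_Hgen_0[of D J] by (metis rangeI)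
qed (auto simp flip: emb_Add emb_Scal)

text \<open>The type \<open>qalg\<close> mixes all factors, whereas roots and ideals are defined by
  terms. This returns from homogeneous components to terms.\<close>

lemma V_range: "V d \<subseteq> range (emb D J)"
proof -
  have "X \<in> range (emb D J)" if "pw (\<lambda>i. emb D J (g i)) c X" for g c X
    using that by (induction rule: pw.induct) (auto simp flip: emb_Br)
  then show ?thesis unfolding V_def by (intro qv.span_minimal subspace_range_emb) auto
qed

end

section \<open>Sums of ideals that meet the Cartan subalgebra trivially\<close>

definition trivial_on_h :: "('i::finite, 'h::finite) km_datum \<Rightarrow> ('i, 'h) tm set \<Rightarrow> bool" where
  "trivial_on_h D J \<longleftrightarrow> (\<forall>x. Hgen x \<in> J \<longrightarrow> tm_eq D (Hgen x) (Hgen 0))"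

text \<open>The maximal ideal is defined as a union, so it is closed under addition only if the sum
  of two admissible ideals is admissible.\<close>

definition ideal_sum ::
  "('i::finite, 'h::finite) km_datum \<Rightarrow> ('i, 'h) tm set \<Rightarrow> ('i, 'h) tm set \<Rightarrow> ('i, 'h) tm set" where
  "ideal_sum D J K = {t. \<exists>a\<in>J. \<exists>b\<in>K. tm_eq D t (Add a b)}"

lemma tm_ideal_sum:
  assumes J: "tm_ideal D J" and K: "tm_ideal D K"
  shows "tm_ideal D (ideal_sum D J K)"
proof (rule tm_idealI)
  note JK = tm_idealD[OF J] tm_idealD[OF K]
  note flat = emb_zero_ideal_eq_iff[symmetric]
  fix s assume "s \<in> ideal_sum D J K"
  then obtain a b where ab: "a \<in> J" "b \<in> K" "tm_eq D s (Add a b)" by (auto simp: ideal_sum_def)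
  show "t \<in> ideal_sum D J K" if "tm_eq D s t" for t
    using ab eq_trans[OF eq_sym[OF that]] by (auto simp: ideal_sum_def)
  show "Add s t \<in> ideal_sum D J K" if t: "t \<in> ideal_sum D J K" for t
  proof -
    obtain a' b' where "a' \<in> J" "b' \<in> K" "tm_eq D t (Add a' b')" using t by (auto simp: ideal_sum_def)
    then have "Add a a' \<in> J" "Add b b' \<in> K" "tm_eq D (Add s t) (Add (Add a a') (Add b b'))"
      using ab by (auto simp: flat emb_Add intro: JK)
    then show ?thesis by (auto simp: ideal_sum_def)
  qed
  show "Scal c s \<in> ideal_sum D J K" for c
  proof -
    have "Scal c a \<in> J" "Scal c b \<in> K" "tm_eq D (Scal c s) (Add (Scal c a) (Scal c b))"
      using ab by (auto simp: flat emb_Add emb_Scal qv.scale_right_distrib intro: JK)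
    then show ?thesis by (auto simp: ideal_sum_def)
  qed
  show "Br s t \<in> ideal_sum D J K" for t
  proof -
    have "Br a t \<in> J" "Br b t \<in> K" "tm_eq D (Br s t) (Add (Br a t) (Br b t))"
      using ab by (auto simp: flat emb_Add emb_Br br_add_left intro: JK)
    then show ?thesis by (auto simp: ideal_sum_def)
  qed
  show "Br t s \<in> ideal_sum D J K" for t
  proof -
    have "Br t a \<in> J" "Br t b \<in> K" "tm_eq D (Br t s) (Add (Br t a) (Br t b))"
      using ab by (auto simp: flat emb_Add emb_Br br_add_right intro: JK)
    then show ?thesis by (auto simp: ideal_sum_def)
  qed
  obtain a0 a1 where a: "a0 \<in> J" "a1 \<in> J" "homog D 0 a0" "homog D 1 a1" "tm_eq D a (Add a0 a1)"
    using JK(7)[OF ab(1)] by blast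
  obtain b0 b1 where b: "b0 \<in> K" "b1 \<in> K" "homog D 0 b0" "homog D 1 b1" "tm_eq D b (Add b0 b1)"
    using JK(14)[OF ab(2)] by blast
  have "tm_eq D s (Add (Add a0 b0) (Add a1 b1))"
    using a(5) b(5) ab(3) by (simp add: flat emb_Add)
  moreover have "Add a0 b0 \<in> ideal_sum D J K" "Add a1 b1 \<in> ideal_sum D J K"
    using a b by (auto simp: ideal_sum_def intro: eq_refl)
  ultimately show "\<exists>s0\<in>ideal_sum D J K. \<exists>s1\<in>ideal_sum D J K.
      homog D 0 s0 \<and> homog D 1 s1 \<and> tm_eq D s (Add s0 s1)"
    using a(3,4) b(3,4) by (blast intro: homog_Add)
next
  show "Hgen 0 \<in> ideal_sum D J K"
    using tm_idealD(2)[OF J] tm_idealD(2)[OF K] eq_sym[OF vs_zero] by (auto simp: ideal_sum_def)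
qed

lemma ideal_sum_left: "tm_ideal D K \<Longrightarrow> J \<subseteq> ideal_sum D J K"
  using tm_idealD(2) eq_sym[OF vs_zero] by (fastforce simp: ideal_sum_def)

lemma ideal_sum_right: "tm_ideal D J \<Longrightarrow> K \<subseteq> ideal_sum D J K"
  using tm_idealD(2) eq_sym[OF tm_eq_zero_left] by (fastforce simp: ideal_sum_def)

lemma wt_push:
  "wt (\<lambda>x. emb D (zero_ideal D) (Hgen x)) \<alpha> X \<Longrightarrow> wt (\<lambda>x. emb D J (Hgen x)) \<alpha> (push D J X)"
  unfolding wt_def by (metis push_br push_emb push_sc)

text \<open>
  An ideal contains the weight components of its elements, so an ideal meeting the Cartan
  subalgebra trivially lies in the sum of the nonzero weight spaces.
\<close>

lemma trivial_on_h_span: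
  assumes "realization D" "tm_ideal D J" "trivial_on_h D J" "a \<in> J"
  defines "V \<equiv> contra.V (\<lambda>i. emb D (zero_ideal D) (Egen i)) (\<lambda>i. emb D (zero_ideal D) (Fgen i))
    (\<lambda>x. emb D (zero_ideal D) (Hgen x))"
  shows "emb D (zero_ideal D) a \<in> qv.span (\<Union>d\<in>-{0}. V d)"
proof -
  interpret Z: km_quot D "zero_ideal D" by standard fact
  have V: "V = Z.V" unfolding V_def by simp
  obtain F x where F: "finite F" "\<And>d. d \<in> F \<Longrightarrow> x d \<in> V d"
    "emb D (zero_ideal D) a = (\<Sum>d\<in>F. x d)" using Z.emb_decompose[of a] unfolding V by metis
  \<comment> \<open>That \<open>J\<close> contains the components of \<open>a\<close> is expressed
    in the quotient by \<open>J\<close>: their images have distinct weights and sum to the image of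
    \<open>a\<close>, which is 0.\<close>
  have "(\<Sum>d\<in>F. push D J (x d)) = emb D J a"
    by (simp flip: push_sum F(3) add: push_emb)
  also have "\<dots> = 0" using assms by (simp add: emb_eq_0_iff)
  finally have "\<forall>d\<in>F. push D J (x d) = 0"
    using F Z.inj_root_map by (intro wt_independent[OF F(1), of "root_map (rt D)" "\<lambda>x. emb D J (Hgen x)"])
      (auto intro!: wt_push Z.V_wt simp: V inj_on_def)
  \<comment> \<open>The component of degree 0 is the only one in the Cartan subalgebra, and it lies
    in \<open>J\<close>.\<close>
  have "x 0 = 0" if zero: "0 \<in> F"
  proof -
    obtain y where y: "x 0 = emb D (zero_ideal D) (Hgen y)"
      using Z.V_zero_degree[of "x 0"] F(2)[OF zero] unfolding V by blast
    have "push D J (x 0) = 0" using \<open>\<forall>d\<in>F. push D J (x d) = 0\<close> zero by blast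
    then have "emb D J (Hgen y) = 0" unfolding y push_emb .
    then have "tm_eq D (Hgen y) (Hgen 0)"
      using assms(2,3) by (simp add: emb_eq_0_iff trivial_on_h_def)
    then show ?thesis unfolding y using emb_eqI emb_Hgen_0 by metis
  qed
  then have "x d \<in> qv.span (\<Union>d\<in>-{0}. V d)" if "d \<in> F" for d
    using F(2)[OF that] that by (cases "d = 0") (auto intro: qv.span_zero qv.span_base)
  then show ?thesis unfolding F(3) by (rule qv.span_sum)
qed

text \<open>Both summands lie in the sum of the nonzero weight spaces, while an element of the
  Cartan subalgebra has weight 0.\<close>

lemma trivial_on_h_sum:
  assumes D: "realization D" and J: "tm_ideal D J" "trivial_on_h D J"
    and K: "tm_ideal D K" "trivial_on_h D K"
  shows "trivial_on_h D (ideal_sum D J K)"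
  unfolding trivial_on_h_def
proof (intro allI impI)
  interpret Z: km_quot D "zero_ideal D" by standard fact
  let ?e = "emb D (zero_ideal D)"
  fix x assume "Hgen x \<in> ideal_sum D J K"
  then obtain a b where ab: "a \<in> J" "b \<in> K" "tm_eq D (Hgen x) (Add a b)" by (auto simp: ideal_sum_def)
  have "?e (Hgen x) = ?e a + ?e b" using ab(3) by (metis emb_eqI emb_Add)
  also have "\<dots> \<in> qv.span (\<Union>d\<in>-{0}. Z.V d)"
    by (intro qv.span_add trivial_on_h_span[OF D J ab(1)] trivial_on_h_span[OF D K ab(2)])
  finally have span: "?e (Hgen x) \<in> qv.span (\<Union>d\<in>-{0}. Z.V d)" .
  then have "?e (Hgen x) = 0" by (rule Z.h_in_nonzero_weights)
  then show "tm_eq D (Hgen x) (Hgen 0)"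
    by (simp add: emb_zero_ideal_eq_iff[symmetric])
qed

lemma max_ideal_eq: "max_ideal D = \<Union> {J. tm_ideal D J \<and> trivial_on_h D J}"
  by (simp add: max_ideal_def trivial_on_h_def)

lemma subset_max_ideal: "tm_ideal D J \<Longrightarrow> trivial_on_h D J \<Longrightarrow> J \<subseteq> max_ideal D"
  unfolding max_ideal_eq by blast

lemma trivial_on_h_max: "trivial_on_h D (max_ideal D)"
  unfolding max_ideal_eq trivial_on_h_def by blast

lemma tm_ideal_max:
  assumes D: "realization D"
  shows "tm_ideal D (max_ideal D)"
proof (rule tm_idealI)
  show "Hgen 0 \<in> max_ideal D"
    using subset_max_ideal[OF tm_ideal_zero] by (auto simp: zero_ideal_def trivial_on_h_def intro: eq_refl)
  fix s assume "s \<in> max_ideal D"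
  then obtain J where J: "tm_ideal D J" "trivial_on_h D J" "s \<in> J" unfolding max_ideal_eq by blast
  note J' = tm_idealD[OF J(1)] subsetD[OF subset_max_ideal[OF J(1,2)]]
  show "t \<in> max_ideal D" if "tm_eq D s t" for t by (rule J'(8)[OF J'(1)[OF J(3) that]])
  show "Scal c s \<in> max_ideal D" for c by (rule J'(8)[OF J'(4)[OF J(3)]])
  show "Br s t \<in> max_ideal D" for t by (rule J'(8)[OF J'(5)[OF J(3)]])
  show "Br t s \<in> max_ideal D" for t by (rule J'(8)[OF J'(6)[OF J(3)]])
  show "Add s t \<in> max_ideal D" if t: "t \<in> max_ideal D" for t
  proof -
    obtain K where K: "tm_ideal D K" "trivial_on_h D K" "t \<in> K" using t unfolding max_ideal_eq by blast
    have "s \<in> ideal_sum D J K" "t \<in> ideal_sum D J K"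
      using J K ideal_sum_left ideal_sum_right by blast+
    then show ?thesis
      using tm_idealD(3)[OF tm_ideal_sum[OF J(1) K(1)]]
        subset_max_ideal[OF tm_ideal_sum[OF J(1) K(1)] trivial_on_h_sum[OF D J(1,2) K(1,2)]] by blast
  qed
  show "\<exists>s0\<in>max_ideal D. \<exists>s1\<in>max_ideal D. homog D 0 s0 \<and> homog D 1 s1 \<and> tm_eq D s (Add s0 s1)"
    using J'(7)[OF J(3)] J'(8) by blast
qed

subsection \<open>Singular vectors vanish\<close>

text \<open>The words in the generators applied to a start vector \<open>x0\<close> of degree
  \<open>d0\<close>; they span the module that \<open>x0\<close> generates over the positive
  half.\<close>

inductive sing :: "('i \<Rightarrow> ('i::finite, 'h::finite) qalg) \<Rightarrow> int^'i \<Rightarrow> ('i, 'h) qalg \<Rightarrow>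
    int^'i \<Rightarrow> ('i, 'h) qalg \<Rightarrow> bool" for e d0 x0 where
  base: "sing e d0 x0 d0 x0"
| step: "sing e d0 x0 d X \<Longrightarrow> sing e d0 x0 (d + axis i 1) (br (e i) X)"

lemma sing_pw: "sing e d0 x0 d X \<Longrightarrow> pw e d0 x0 \<Longrightarrow> pw e d X"
  by (induction rule: sing.induct) (auto intro: pw.step)

locale km_alg = km_quot D "max_ideal D" for D :: "('i::finite, 'h::finite) km_datum"
begin

abbreviation "em \<equiv> emb D (max_ideal D)"
abbreviation "eg i \<equiv> em (Egen i)"
abbreviation "fg i \<equiv> em (Fgen i)"
abbreviation "hg x \<equiv> em (Hgen x)"

text \<open>If all \<open>fg j\<close> annihilate \<open>x0\<close>, then the words of
  \<open>sing\<close> already span the ideal that \<open>x0\<close> generates. Their degrees are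
  positive, so this ideal meets the Cartan subalgebra trivially and is 0 modulo the maximal
  ideal.\<close>

lemma singular_vector:
  assumes x0: "pw eg d0 x0" and f0: "\<And>j. br (fg j) x0 = 0"
  shows "x0 = 0"
proof -
  let ?B = "\<lambda>b. {X. \<exists>d. sing eg d0 x0 d X \<and> pdeg (par D) d = b}"
  define T where "T b = qv.span (?B b)" for b
  have T_add: "Y \<in> T b \<Longrightarrow> Z \<in> T b \<Longrightarrow> Y + Z \<in> T b" for Y Z b unfolding T_def by (rule qv.span_add)
  have T_sc: "Z \<in> T b \<Longrightarrow> c *q Z \<in> T b" for c Z b unfolding T_def by (rule qv.span_scale)
  have T_0: "0 \<in> T b" for b unfolding T_def by (rule qv.span_zero)
  have B_T: "X \<in> T (pdeg (par D) d)" if "sing eg d0 x0 d X" for d X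
    unfolding T_def using that by (intro qv.span_base) blast
  have T_lift: "br g X \<in> T b'" if "X \<in> T b" "\<And>d X. sing eg d0 x0 d X \<Longrightarrow> pdeg (par D) d = b \<Longrightarrow> br g X \<in> T b'"
    for g X b b'
    using br_span[of X "?B b" g "?B b'"] that unfolding T_def by blast
  have e_T: "br (eg i) X \<in> T (b + par D i)" if "X \<in> T b" for X b i
  proof (rule T_lift[OF that])
    fix d X assume "sing eg d0 x0 d X" "pdeg (par D) d = b"
    then show "br (eg i) X \<in> T (b + par D i)" using B_T[OF sing.step[of eg d0 x0 d X i]] by simp
  qed
  have h_T: "br (hg x) X \<in> T b" if "X \<in> T b" for X b x
  proof (rule T_lift[OF that])
    fix d X assume *: "sing eg d0 x0 d X" "pdeg (par D) d = b"
    from pw_wt[OF sing_pw[OF *(1) x0]] show "br (hg x) X \<in> T b"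
      using B_T[OF *(1)] *(2) by (auto simp: wt_def intro: T_sc)
  qed
  have f_sing: "br (fg j) X \<in> T (pdeg (par D) d + par D j)" if "sing eg d0 x0 d X" for d X j
    using that
  proof (induction rule: sing.induct)
    case base
    then show ?case by (simp add: f0 T_0)
  next
    case (step d X i)
    have "br (eg i) (br (fg j) X) \<in> T (pdeg (par D) d + par D j + par D i)"
      by (rule e_T[OF step.IH])
    moreover have "br (br (fg j) (eg i)) X \<in> T (pdeg (par D) d + par D j + par D i)"
    proof (cases "i = j")
      case True
      then show ?thesis using h_T[OF B_T[OF step.hyps]]
        by (simp add: fe br_sc_left T_sc add.assoc del: qv.scale_minus_left)
    qed (simp add: fe T_0)
    ultimately show ?case unfolding br_jacobi[OF hom_f hom_e] by (auto simp: ac_simps intro: T_add T_sc)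
  qed
  have f_T: "br (fg j) X \<in> T (b + par D j)" if "X \<in> T b" for X b j
    by (rule T_lift[OF that]) (use f_sing in blast)
  have T_S: "T b \<subseteq> S b" for b
    unfolding T_def S_def pos_def using sing_pw[OF _ x0] by (intro qv.span_mono) blast
  \<comment> \<open>Stability under \<open>e\<close>, \<open>f\<close> and \<open>h\<close> gives
    stability under all elements, by \<open>pw_stable\<close> applied to \<open>T\<close>.\<close>
  have S_T: "br X Y \<in> T (b + a)" if "X \<in> S a" "Y \<in> T b" for X Y a b
    using that(1) unfolding S_def
  proof (induction rule: qv.span_induct_alt)
    case base
    show ?case by (simp add: T_0)
  next
    case (step c X Z)
    have "br X Y \<in> T (b + pdeg (par D) d)" if "pw eg d X" for d
      by (rule pw_stable[of eg, where T = T]) (auto intro: that hom_e e_T T_add T_sc \<open>Y \<in> T b\<close>)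
    moreover have "br X Y \<in> T (b + pdeg (par D) d)" if "pw fg d X" for d
      by (rule pw_stable[of fg, where T = T]) (auto intro: that hom_f f_T T_add T_sc \<open>Y \<in> T b\<close>)
    ultimately have "br X Y \<in> T (b + a)"
      using step(1) h_T[OF \<open>Y \<in> T b\<close>] unfolding pos_def neg_def cart_def by auto
    then show ?case using step(2) by (simp add: br_add_left br_sc_left T_add T_sc)
  qed
  \<comment> \<open>Back to terms. Ideals are graded, so the even and the odd part of the span enter
    separately.\<close>
  define K where "K = {t. \<exists>X\<in>T 0. \<exists>Y\<in>T 1. em t = X + Y}"
  have T_flip: "c *q Z \<in> T b \<Longrightarrow> c \<noteq> 0 \<Longrightarrow> Z \<in> T b" for c Z b
    using T_sc[of "c *q Z" b "inverse c"] by simp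
  have K_lr: "Br t s \<in> K \<and> Br s t \<in> K" if s: "s \<in> K" for s t
  proof -
    obtain X Y where XY: "X \<in> T 0" "Y \<in> T 1" "em s = X + Y" using s unfolding K_def by blast
    obtain t0 t1 where t: "em t0 \<in> S 0" "em t1 \<in> S 1"
      "em t = em t0 + em t1"
      by (rule emb_parts[of t])
    let ?t0 = "em t0" and ?t1 = "em t1"
    have l: "br ?t0 X \<in> T 0" "br ?t0 Y \<in> T 1" "br ?t1 X \<in> T 1" "br ?t1 Y \<in> T 0"
      using S_T[OF t(1) XY(1)] S_T[OF t(1) XY(2)] S_T[OF t(2) XY(1)] S_T[OF t(2) XY(2)] by simp_all
    \<comment> \<open>Brackets from the other side follow by skew-symmetry, which needs homogeneous
      factors.\<close>
    have sk: "br Q P \<in> T c" if "br P Q \<in> T c" "P \<in> S a" "Q \<in> T b" for P Q a b c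
    proof -
      have "br Q P = (- sgn_bit (b * a)) *q br P Q"
        by (rule br_skew) (use that T_S S_hom in blast)+
      then show ?thesis using T_sc[OF that(1), of "- sgn_bit (b * a)"] by simp
    qed
    have r: "br X ?t0 \<in> T 0" "br Y ?t0 \<in> T 1" "br X ?t1 \<in> T 1" "br Y ?t1 \<in> T 0"
      using l t XY by (blast intro: sk)+
    have "em (Br t s) = (br ?t0 X + br ?t1 Y) + (br ?t0 Y + br ?t1 X)"
      by (simp add: emb_Br XY(3) t(3) br_add_left br_add_right)
    moreover have "em (Br s t) = (br X ?t0 + br Y ?t1) + (br Y ?t0 + br X ?t1)"
      by (simp add: emb_Br XY(3) t(3) br_add_left br_add_right)
    ultimately show ?thesis unfolding K_def using l r by (blast intro: T_add)
  qed
  have "tm_ideal D K"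
  proof (rule tm_idealI)
    show "Hgen 0 \<in> K" unfolding K_def using T_0[of 0] T_0[of 1] by force
    fix s assume s: "s \<in> K"
    then obtain X Y where XY: "X \<in> T 0" "Y \<in> T 1" "em s = X + Y" unfolding K_def by blast
    show "t \<in> K" if "tm_eq D s t" for t using s emb_eqI[OF that, of "max_ideal D"] unfolding K_def by simp
    show "Br s t \<in> K" "Br t s \<in> K" for t using K_lr[OF s] by auto
    show "Scal c s \<in> K" for c
      using XY by (auto simp: K_def emb_Scal qv.scale_right_distrib intro: T_sc)
    show "Add s t \<in> K" if t: "t \<in> K" for t
    proof -
      obtain X' Y' where XY': "X' \<in> T 0" "Y' \<in> T 1" "em t = X' + Y'" using t unfolding K_def by blast
      then have "em (Add s t) = (X + X') + (Y + Y')" using XY by (simp add: emb_Add)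
      then show ?thesis unfolding K_def using XY XY' by (blast intro: T_add)
    qed
    obtain s0 s1 where p: "homog D 0 s0" "homog D 1 s1" "tm_eq D s (Add s0 s1)"
      "em s0 \<in> S 0" "em s1 \<in> S 1"
      "em s = em s0 + em s1"
      by (rule emb_parts[of s])
    \<comment> \<open>Both sides of this equation are 0, since the left one is even and the right
      one odd. So the parts of \<open>s\<close> are \<open>X\<close> and \<open>Y\<close>, and lie
      in the ideal.\<close>
    have eq: "em s0 + (- 1) *q X = Y + (- 1) *q em s1"
      using p(6) XY(3) by (simp add: algebra_simps)
    have "em s0 + (- 1) *q X = 0"
    proof (rule S_disjoint)
      show "em s0 + (- 1) *q X \<in> S 0" using p(4) XY(1) T_S by (blast intro: S_add S_sc)
      show "em s0 + (- 1) *q X \<in> S 1"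
        unfolding eq using p(5) XY(2) T_S by (blast intro: S_add S_sc)
    qed
    then have "em s0 = X" "em s1 = Y" using eq by simp_all
    then have "s0 \<in> K" "s1 \<in> K" unfolding K_def using XY T_0[of 0] T_0[of 1] by force+
    then show "\<exists>s0\<in>K. \<exists>s1\<in>K. homog D 0 s0 \<and> homog D 1 s1 \<and> tm_eq D s (Add s0 s1)"
      using p by blast
  qed
  moreover have "trivial_on_h D K"
    unfolding trivial_on_h_def
  proof (intro allI impI)
    fix x assume "Hgen x \<in> K"
    have span: "hg x \<in> qv.span (\<Union>d\<in>-{0}. V d)"
    proof -
      have "T b \<subseteq> qv.span (\<Union>d\<in>-{0}. V d)" for b
        unfolding T_def
      proof (rule qv.span_minimal[OF _ qv.subspace_span], rule subsetI)
        fix X assume "X \<in> ?B b"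
        then obtain d where "pw eg d X" using sing_pw[OF _ x0] by blast
        then have "X \<in> V d" "d \<noteq> 0" unfolding V_def by (auto intro: qv.span_base dest: pw_nonzero)
        then show "X \<in> qv.span (\<Union>d\<in>-{0}. V d)" by (intro qv.span_base) blast
      qed
      note T_sub = subsetD[OF this]
      obtain X Y where "X \<in> T 0" "Y \<in> T 1" "hg x = X + Y"
        using \<open>Hgen x \<in> K\<close> unfolding K_def by blast
      then show ?thesis using qv.span_add[OF T_sub T_sub] by simp
    qed
    then have "hg x = 0" by (rule h_in_nonzero_weights)
    then show "tm_eq D (Hgen x) (Hgen 0)"
      using trivial_on_h_max[of D] by (simp add: emb_eq_0_iff tm_ideal_max[OF real] trivial_on_h_def)
  qed
  ultimately have "K \<subseteq> max_ideal D" by (rule subset_max_ideal)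
  obtain t where t: "x0 = em t"
    using V_range[of d0] x0 unfolding V_def by (blast intro: qv.span_base)
  have "t \<in> K"
  proof (cases "pdeg (par D) d0")
    case zero
    then show ?thesis unfolding K_def using B_T[OF sing.base[of eg d0 x0]] T_0[of 1] t by force
  next
    case one
    then show ?thesis unfolding K_def using B_T[OF sing.base[of eg d0 x0]] T_0[of 0] t by force
  qed
  then show ?thesis using \<open>K \<subseteq> max_ideal D\<close> t tm_ideal_max[OF real] by (auto simp: emb_eq_0_iff)
qed

end

subsection \<open>The Cartan subalgebra embeds\<close>

text \<open>
  The Verma module of highest weight \<open>\<mu>\<close> of the presented superalgebra is free over the \<open>f\<^sub>i\<close>, so
  the words in the \<open>f\<^sub>i\<close> are a basis. Infinite combinations of words are allowed, which saves a
  finiteness condition.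
\<close>

type_synonym 'i vmod = "'i list \<Rightarrow> complex"

definition lin_op :: "('i vmod \<Rightarrow> 'i vmod) \<Rightarrow> bool" where
  "lin_op A \<longleftrightarrow> (\<forall>u v. A (\<lambda>w. u w + v w) = (\<lambda>w. A u w + A v w)) \<and>
     (\<forall>c u. A (\<lambda>w. c * u w) = (\<lambda>w. c * A u w))"

text \<open>As elements of a ring type, operators can be handled by \<open>algebra_simps\<close>,
  which settles the supercommutator identities below.\<close>

typedef 'i vop = "{A :: 'i vmod \<Rightarrow> 'i vmod. lin_op A}"
  by (rule exI[of _ "\<lambda>u. u"]) (simp add: lin_op_def)

setup_lifting type_definition_vop

instantiation vop :: (type) ring
begin

lift_definition zero_vop :: "'a vop" is "\<lambda>u w. 0" by (simp add: lin_op_def)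

lift_definition plus_vop :: "'a vop \<Rightarrow> 'a vop \<Rightarrow> 'a vop" is "\<lambda>A B u w. A u w + B u w"
  by (auto simp: lin_op_def algebra_simps)

lift_definition uminus_vop :: "'a vop \<Rightarrow> 'a vop" is "\<lambda>A u w. - A u w"
  by (auto simp: lin_op_def algebra_simps)

lift_definition minus_vop :: "'a vop \<Rightarrow> 'a vop \<Rightarrow> 'a vop" is "\<lambda>A B u w. A u w - B u w"
  by (auto simp: lin_op_def algebra_simps)

lift_definition times_vop :: "'a vop \<Rightarrow> 'a vop \<Rightarrow> 'a vop" is "\<lambda>A B u. A (B u)"
  by (auto simp: lin_op_def)

instance
proof
  fix a b c :: "'a vop"
  show "a * (b + c) = a * b + a * c" by transfer (auto simp: lin_op_def)
qed (transfer; auto simp: algebra_simps)+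

end

lift_definition osc :: "complex \<Rightarrow> 'i vop \<Rightarrow> 'i vop" is "\<lambda>c A u w. c * A u w"
  by (auto simp: lin_op_def algebra_simps)

lemma osc_add: "osc c (A + B) = osc c A + osc c B" by transfer (simp add: algebra_simps)
lemma osc_diff: "osc c (A - B) = osc c A - osc c B" by transfer (simp add: algebra_simps)
lemma osc_add_left: "osc (c + d) A = osc c A + osc d A" by transfer (simp add: algebra_simps)
lemma osc_mult: "osc (c * d) A = osc c (osc d A)" by transfer (simp add: algebra_simps)
lemma osc_one: "osc 1 A = A" by transfer simp
lemma osc_minus: "osc (- c) A = - osc c A" by transfer simp
lemma osc_0_right: "osc c 0 = 0" by transfer simp
lemma osc_times_left: "osc c A * B = osc c (A * B)" by transfer simp
lemma osc_times_right: "A * osc c B = osc c (A * B)" by transfer (simp add: lin_op_def)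

lemmas osc_simps = osc_add osc_diff osc_one osc_minus osc_0_right osc_times_left osc_times_right

primrec wtw :: "('i \<Rightarrow> complex^'h) \<Rightarrow> 'i list \<Rightarrow> complex^'h" where
  "wtw r [] = 0"
| "wtw r (j # w) = r j + wtw r w"

text \<open>The coefficient at a word \<open>w\<close> of \<open>e_i u\<close>. On a word,
  \<open>e_i\<close> deletes a letter \<open>i\<close>, with the sign for crossing the letters
  before it and the value at \<open>h_i\<close> of the weight of what follows it. Read backwards,
  the coefficient at \<open>w\<close> sums over all insertions of \<open>i\<close> into
  \<open>w\<close>.\<close>

primrec Efun :: "('i::finite, 'h::finite) km_datum \<Rightarrow> complex^'h \<Rightarrow> 'i \<Rightarrow> 'i list \<Rightarrow> 'i vmod \<Rightarrow> complex" where
  "Efun D \<mu> i [] u = ev \<mu> (crt D i) * u [i]"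
| "Efun D \<mu> i (j # w) u = sgn_bit (par D i * par D j) * Efun D \<mu> i w (\<lambda>v. u (j # v))
     + ev (\<mu> - wtw (rt D) (j # w)) (crt D i) * u (i # j # w)"

lemma Efun_add: "Efun D \<mu> i w (\<lambda>v. a v + b v) = Efun D \<mu> i w a + Efun D \<mu> i w b"
  by (induction w arbitrary: a b) (simp_all add: algebra_simps)

lemma Efun_scale: "Efun D \<mu> i w (\<lambda>v. c * a v) = c * Efun D \<mu> i w a"
  by (induction w arbitrary: a) (simp_all add: algebra_simps)

lift_definition Eop :: "('i::finite, 'h::finite) km_datum \<Rightarrow> complex^'h \<Rightarrow> 'i \<Rightarrow> 'i vop" is
  "\<lambda>D \<mu> i u w. Efun D \<mu> i w u"
  by (auto simp: lin_op_def Efun_add Efun_scale)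

text \<open>On words, \<open>f_i\<close> prepends the letter \<open>i\<close>; on coefficients this
  strips the first letter.\<close>

lift_definition Fop :: "'i \<Rightarrow> 'i vop" is
  "\<lambda>i u w. case w of [] \<Rightarrow> 0 | j # v \<Rightarrow> if j = i then u v else 0"
  by (auto simp: lin_op_def fun_eq_iff split: list.split)

lift_definition Hop :: "('i::finite, 'h::finite) km_datum \<Rightarrow> complex^'h \<Rightarrow> complex^'h \<Rightarrow> 'i vop" is
  "\<lambda>D \<mu> x u w. ev (\<mu> - wtw (rt D) w) x * u w"
  by (auto simp: lin_op_def fun_eq_iff algebra_simps)

lemma ev_diff: "ev (a - b) x = ev a x - ev b x"
  using ev_add[of a "- b" x] by simp

lemma ev_add_right: "ev a (x + y) = ev a x + ev a y"
  by (simp add: ev_def sum.distrib algebra_simps)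

lemma ev_scale_right: "ev a (c *s x) = c * ev a x"
  by (simp add: ev_def sum_distrib_left algebra_simps)

lemma Hop_add: "Hop D \<mu> (x + y) = Hop D \<mu> x + Hop D \<mu> y"
  by transfer (simp add: ev_add_right algebra_simps)

lemma Hop_scale: "Hop D \<mu> (c *s x) = osc c (Hop D \<mu> x)"
  by transfer (simp add: ev_scale_right algebra_simps)

lemma Hop_0: "Hop D \<mu> 0 = 0"
  using Hop_scale[of D \<mu> 0 0] by (simp, transfer) simp

lemma Hop_Hop: "Hop D \<mu> x * Hop D \<mu> y - Hop D \<mu> y * Hop D \<mu> x = 0"
  by transfer (simp add: algebra_simps)

lemma Hop_Fop: "Hop D \<mu> x * Fop i - Fop i * Hop D \<mu> x = osc (- ev (rt D i) x) (Fop i)"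
  by transfer (auto simp: fun_eq_iff ev_diff algebra_simps split: list.split)

text \<open>Says that \<open>e_i\<close> raises weights by \<open>rt D i\<close>. The number
  \<open>c\<close> stands for \<open>ev \<mu> x\<close>; it is general because in the induction it
  absorbs the weight of the letter split off.\<close>

lemma Efun_weight:
  "Efun D \<mu> i w (\<lambda>v. (c - ev (wtw (rt D) v) x) * u v) =
    (c - ev (wtw (rt D) w) x - ev (rt D i) x) * Efun D \<mu> i w u"
proof (induction w arbitrary: c u)
  case (Cons j w)
  have *: "(\<lambda>v. (c - ev (wtw (rt D) (j # v)) x) * u (j # v)) =
      (\<lambda>v. ((c - ev (rt D j) x) - ev (wtw (rt D) v) x) * u (j # v))"
    by (simp add: diff_diff_eq)
  show ?case unfolding Efun.simps * Cons.IH by (simp add: algebra_simps)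
qed (simp add: algebra_simps)

lemma Hop_Eop: "Hop D \<mu> x * Eop D \<mu> i - Eop D \<mu> i * Hop D \<mu> x = osc (ev (rt D i) x) (Eop D \<mu> i)"
proof transfer
  fix D and x \<mu> :: "complex^'h" and i :: "'i::finite"
  have "ev (\<mu> - wtw (rt D) w) x * Efun D \<mu> i w u - Efun D \<mu> i w (\<lambda>v. ev (\<mu> - wtw (rt D) v) x * u v) =
      ev (rt D i) x * Efun D \<mu> i w u" for u :: "'i vmod" and w
    unfolding ev_diff Efun_weight by (simp add: left_diff_distrib)
  then show "(\<lambda>u w. ev (\<mu> - wtw (rt D) w) x * Efun D \<mu> i w u -
      Efun D \<mu> i w (\<lambda>w. ev (\<mu> - wtw (rt D) w) x * u w)) =
      (\<lambda>u w. ev (rt D i) x * Efun D \<mu> i w u)"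
    by (intro ext)
qed

lemma Eop_Fop:
  "Eop D \<mu> i * Fop j - osc (sgn_bit (par D i * par D j)) (Fop j * Eop D \<mu> i) =
    (if i = j then Hop D \<mu> (crt D i) else 0)"
proof -
  have E0: "Efun D \<mu> i w (\<lambda>v. 0) = 0" for i w
    using Efun_scale[of D \<mu> i w 0 "\<lambda>v. 0"] by simp
  have "Efun D \<mu> i w (\<lambda>w. case w of [] \<Rightarrow> 0 | k # v \<Rightarrow> if k = j then u v else 0) -
      sgn_bit (par D i * par D j) * (case w of [] \<Rightarrow> 0 | k # v \<Rightarrow> if k = j then Efun D \<mu> i v u else 0) =
      (if i = j then ev (\<mu> - wtw (rt D) w) (crt D i) * u w else 0)" for u w
    by (cases w) (auto simp: E0)
  then show ?thesis by (cases "i = j"; simp; transfer) (auto simp: fun_eq_iff)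
qed

text \<open>
  Even and odd parts of an operator are kept apart as a pair, so that the supercommutator makes sense
  without a grading of the module.
\<close>

definition at_par :: "bit \<Rightarrow> 'i vop \<Rightarrow> 'i vop \<times> 'i vop" where
  "at_par a A = (if a = 0 then (A, 0) else (0, A))"

primrec interp :: "('i::finite, 'h::finite) km_datum \<Rightarrow> complex^'h \<Rightarrow> ('i, 'h) tm \<Rightarrow> 'i vop \<times> 'i vop" where
  "interp D \<mu> (Hgen x) = (Hop D \<mu> x, 0)"
| "interp D \<mu> (Egen i) = at_par (par D i) (Eop D \<mu> i)"
| "interp D \<mu> (Fgen i) = at_par (par D i) (Fop i)"
| "interp D \<mu> (Add s t) = (fst (interp D \<mu> s) + fst (interp D \<mu> t), snd (interp D \<mu> s) + snd (interp D \<mu> t))"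
| "interp D \<mu> (Scal c s) = (osc c (fst (interp D \<mu> s)), osc c (snd (interp D \<mu> s)))"
| "interp D \<mu> (Br s t) = (let (a0, a1) = interp D \<mu> s; (b0, b1) = interp D \<mu> t in
     (a0 * b0 - b0 * a0 + (a1 * b1 + b1 * a1), a0 * b1 - b1 * a0 + (a1 * b0 - b0 * a1)))"

lemma interp_homog: "homog D a t \<Longrightarrow> (if a = 0 then snd else fst) (interp D \<mu> t) = 0"
proof (induction rule: homog.induct)
  case (homog_Br a s b t)
  then show ?case
    by (cases a; cases b) (auto simp: split_beta Let_def)
qed (auto simp: at_par_def Hop_0 osc_0_right split: if_splits)

lemma interp_sound: "tm_eq D s t \<Longrightarrow> interp D \<mu> s = interp D \<mu> t"
proof (induction rule: tm_eq.induct)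
  case (skew a s b t)
  from interp_homog[OF skew(1), of \<mu>] interp_homog[OF skew(2), of \<mu>] show ?case
    by (cases a; cases b) (auto simp: split_beta Let_def sgn_bit_def osc_simps)
next
  case (jacobi a s b t u)
  from interp_homog[OF jacobi(1), of \<mu>] interp_homog[OF jacobi(2), of \<mu>] show ?case
    by (cases a; cases b) (auto simp: split_beta Let_def sgn_bit_def osc_simps algebra_simps)
next
  case (rel_EF i j)
  then show ?case using Eop_Fop[of D \<mu> i j]
    by (auto simp: at_par_def Let_def sgn_bit_def osc_simps Hop_0 split: if_splits)
next
  case (rel_HE x i)
  then show ?case using Hop_Eop[of D \<mu> x i] by (auto simp: at_par_def osc_simps)
next
  case (rel_HF x i)
  then show ?case using Hop_Fop[of D \<mu> x i] by (auto simp: at_par_def osc_simps)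
qed (auto simp: split_beta Let_def osc_simps osc_add_left osc_mult Hop_add Hop_scale Hop_0 Hop_Hop
  algebra_simps prod_eq_iff)

text \<open>On the highest weight vector \<open>x\<close> acts by \<mu>(x), and \<mu> is
  arbitrary.\<close>

lemma Hgen_injective: assumes "tm_eq D (Hgen x) (Hgen 0)" shows "x = 0"
proof -
  have "ev \<mu> x = 0" for \<mu>
  proof -
    have "Hop D \<mu> x = 0"
      using interp_sound[OF assms, of \<mu>] by (simp add: Hop_0)
    \<comment> \<open>Only the coefficient at the empty word matters, so any vector with a nonzero
      one would do.\<close>
    from arg_cong[OF this, of "\<lambda>A. Rep_vop A (\<lambda>w. 1) []"]
    show ?thesis by (simp add: Hop.rep_eq zero_vop.rep_eq)
  qed
  moreover have "ev (axis k 1) x = x $ k" for k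
  proof -
    have "ev (axis k 1) x = (\<Sum>j\<in>UNIV. if j = k then x $ j else 0)"
      unfolding ev_def by (intro sum.cong) (auto simp: axis_def)
    then show ?thesis by simp
  qed
  ultimately show ?thesis by (metis vec_eq_iff zero_index)
qed

subsection \<open>The Chevalley involution\<close>

text \<open>The signs are such that the images of \<open>e_i\<close> and \<open>f_i\<close> bracket
  to minus \<open>h_i\<close> for either parity. The price is that the square is not the identity
  but the parity automorphism.\<close>

primrec chev :: "('i::finite, 'h::finite) km_datum \<Rightarrow> ('i, 'h) tm \<Rightarrow> ('i, 'h) tm" where
  "chev D (Hgen x) = Hgen (- x)"
| "chev D (Egen i) = Scal (-1) (Fgen i)"
| "chev D (Fgen i) = Scal (- sgn_bit (par D i)) (Egen i)"
| "chev D (Add s t) = Add (chev D s) (chev D t)"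
| "chev D (Scal c s) = Scal c (chev D s)"
| "chev D (Br s t) = Br (chev D s) (chev D t)"

lemma homog_chev: "homog D a t \<Longrightarrow> homog D a (chev D t)"
  by (induction rule: homog.induct) (auto intro: homog.intros)

lemma chev_sound:
  assumes D: "realization D" and "tm_eq D s t"
  shows "tm_eq D (chev D s) (chev D t)"
proof -
  interpret Z: km_quot D "zero_ideal D" by standard fact
  note flat = emb_zero_ideal_eq_iff[symmetric]
  note Z = Z.he Z.hf Z.hh Z.ef Z.fe Z.h_add Z.h_sc
  have h_minus: "emb D (zero_ideal D) (Hgen (- x)) = - emb D (zero_ideal D) (Hgen x)" for x
    using Z.h_sc[of "-1" x] by simp
  note S = emb_Add emb_Scal emb_Br br_add_left br_add_right br_sc_left br_sc_right
    qv.scale_right_distrib qv.scale_left_distrib h_minus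
  from assms(2) show ?thesis
  proof (induction rule: tm_eq.induct)
    case (skew a s b t)
    then show ?case using br_skew[OF hom_emb[OF homog_chev] hom_emb[OF homog_chev]]
      unfolding flat by (simp add: S)
  next
    case (jacobi a s b t u)
    then show ?case using br_jacobi[OF hom_emb[OF homog_chev] hom_emb[OF homog_chev]]
      unfolding flat by (simp add: S)
  next
    case (H_add x y)
    then show ?case unfolding flat using Z.h_add[of "- x" "- y"] by (simp add: S)
  next
    case (H_scal c x)
    then show ?case unfolding flat using Z.h_sc by (simp add: S)
  next
    case (rel_HH x y)
    then show ?case unfolding flat by (simp add: S Z)
  next
    case (rel_HE x i)
    then show ?case unfolding flat by (simp add: S Z)
  next
    case (rel_HF x i)
    then show ?case unfolding flat by (simp add: S Z mult.commute)
  next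
    case (rel_EF i j)
    then show ?case unfolding flat by (auto simp: S Z)
  qed (auto simp: flat S algebra_simps)
qed

lemma chev_chev:
  assumes D: "realization D" and "homog D a t"
  shows "tm_eq D (chev D (chev D t)) (Scal (sgn_bit a) t)"
proof -
  note flat = emb_zero_ideal_eq_iff[symmetric]
  have sgn_add: "sgn_bit (a + b) = sgn_bit a * sgn_bit b" for a b
    by (cases a; cases b) (simp_all add: sgn_bit_def)
  from assms(2) show ?thesis
    by (induction rule: homog.induct)
      (auto simp: flat emb_Add emb_Scal emb_Br br_sc_left br_sc_right qv.scale_right_distrib sgn_add
        mult.commute)
qed

text \<open>The preimage \<open>?K\<close> of the maximal ideal is a graded ideal, and it meets the
  Cartan subalgebra trivially because that subalgebra embeds. So it is contained in the maximal
  ideal. It contains \<open>chev D t\<close>, since applying \<open>chev\<close> twice only changes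
  the sign of the odd part.\<close>

lemma chev_max:
  assumes D: "realization D" and t: "t \<in> max_ideal D"
  shows "chev D t \<in> max_ideal D"
proof -
  let ?M = "max_ideal D"
  note M = tm_idealD[OF tm_ideal_max[OF D]]
  interpret Z: km_quot D "zero_ideal D" by standard fact
  note flat = emb_zero_ideal_eq_iff[symmetric]
  let ?K = "{s. chev D s \<in> ?M}"
  have "tm_ideal D ?K"
  proof (rule tm_idealI)
    fix s assume "s \<in> ?K"
    then have s: "chev D s \<in> ?M" by simp
    obtain u0 u1 where u: "u0 \<in> ?M" "u1 \<in> ?M" "homog D 0 u0" "homog D 1 u1"
      "tm_eq D (chev D s) (Add u0 u1)" using M(7)[OF s] by blast
    obtain s0 s1 where s': "homog D 0 s0" "homog D 1 s1" "tm_eq D s (Add s0 s1)"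
      using homog_decomposition by blast
    let ?e = "emb D (zero_ideal D)"
    have "?e (chev D s0) + ?e (chev D s1) = ?e u0 + ?e u1"
      using chev_sound[OF D s'(3)] u(5) by (simp add: flat emb_Add)
    then have eq: "?e (chev D s0) + (- 1) *q ?e u0 = ?e u1 + (- 1) *q ?e (chev D s1)"
      by (simp add: algebra_simps)
    have "?e (chev D s0) + (- 1) *q ?e u0 \<in> Z.S 0"
      by (intro Z.S_add Z.S_sc Z.homog_S homog_chev s' u)
    moreover have "?e (chev D s0) + (- 1) *q ?e u0 \<in> Z.S 1"
      unfolding eq by (intro Z.S_add Z.S_sc Z.homog_S homog_chev s' u)
    ultimately have "?e (chev D s0) + (- 1) *q ?e u0 = 0" by (rule Z.S_disjoint)
    then have "?e u0 = ?e (chev D s0)" "?e u1 = ?e (chev D s1)" using eq by simp_all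
    then have "chev D s0 \<in> ?M" "chev D s1 \<in> ?M" using M(1) u(1,2) unfolding emb_zero_ideal_eq_iff by blast+
    then show "\<exists>s0\<in>?K. \<exists>s1\<in>?K. homog D 0 s0 \<and> homog D 1 s1 \<and> tm_eq D s (Add s0 s1)"
      using s' by blast
    show "t \<in> ?K" if "tm_eq D s t" for t
      using M(1)[OF s chev_sound[OF D that]] by simp
  qed (use M in auto)
  moreover have "trivial_on_h D ?K"
    unfolding trivial_on_h_def
  proof (intro allI impI)
    fix x assume "Hgen x \<in> ?K"
    then have "tm_eq D (Hgen (- x)) (Hgen 0)" using trivial_on_h_max[of D] by (simp add: trivial_on_h_def)
    then have "x = 0" using Hgen_injective by fastforce
    then show "tm_eq D (Hgen x) (Hgen 0)" by (simp add: eq_refl)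
  qed
  ultimately have "?K \<subseteq> ?M" by (rule subset_max_ideal)
  moreover have "chev D t \<in> ?K"
  proof -
    obtain t0 t1 where t': "t0 \<in> ?M" "t1 \<in> ?M" "homog D 0 t0" "homog D 1 t1" "tm_eq D t (Add t0 t1)"
      using M(7)[OF t] by blast
    have "tm_eq D (chev D (chev D t)) (Add (chev D (chev D t0)) (chev D (chev D t1)))"
      using chev_sound[OF D chev_sound[OF D t'(5)]] by simp
    moreover have "chev D (chev D t0) \<in> ?M"
      by (rule M(1)[OF M(4)[OF t'(1)] eq_sym[OF chev_chev[OF D t'(3)]]])
    moreover have "chev D (chev D t1) \<in> ?M"
      by (rule M(1)[OF M(4)[OF t'(2)] eq_sym[OF chev_chev[OF D t'(4)]]])
    ultimately have "chev D (chev D t) \<in> ?M" by (blast intro: M(1)[OF M(3)] eq_sym)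
    then show ?thesis by simp
  qed
  ultimately show ?thesis by blast
qed

text \<open>Applying \<open>chev\<close> twice turns \<open>t0 + t1\<close> into
  \<open>t0 - t1\<close>. If that vanishes, then \<open>t0 = t1\<close> is both even and odd, so
  both parts are 0.\<close>

lemma chev_max_iff:
  assumes D: "realization D"
  shows "chev D t \<in> max_ideal D \<longleftrightarrow> t \<in> max_ideal D"
proof
  let ?M = "max_ideal D"
  note M = tm_idealD[OF tm_ideal_max[OF D]]
  interpret Q: km_alg D by standard fact
  let ?e = "emb D ?M"
  assume "chev D t \<in> ?M"
  then have c: "chev D (chev D t) \<in> ?M" by (rule chev_max[OF D])
  obtain t0 t1 where t: "homog D 0 t0" "homog D 1 t1" "?e t0 \<in> Q.S 0" "?e t1 \<in> Q.S 1"
    "?e t = ?e t0 + ?e t1" "tm_eq D t (Add t0 t1)"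
    using Q.emb_parts by metis
  have "tm_eq D (chev D (chev D t)) (Add (chev D (chev D t0)) (chev D (chev D t1)))"
    using chev_sound[OF D chev_sound[OF D t(6)]] by simp
  from emb_eqI[OF this, of ?M] have "0 = ?e t0 + (-1) *q ?e t1"
    using c emb_eqI[OF chev_chev[OF D t(1)], of ?M] emb_eqI[OF chev_chev[OF D t(2)], of ?M]
    by (simp add: emb_Add emb_Scal emb_eq_0_iff[OF tm_ideal_max[OF D], symmetric] sgn_bit_def)
  then have "?e t0 = ?e t1" by simp
  then have "?e t0 = 0" using Q.S_disjoint t(3,4) by simp
  then have "?e t = 0" using t(5) \<open>?e t0 = ?e t1\<close> by simp
  then show "t \<in> ?M" by (simp add: emb_eq_0_iff[OF tm_ideal_max[OF D]])
qed (rule chev_max[OF D])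

subsection \<open>Roots and Borel subalgebras\<close>

lemma nat_span_range:
  fixes x :: "'i::finite \<Rightarrow> complex^'h"
  assumes "inj x"
  shows "nat_span (range x) = {root_map x d | d. \<forall>i. 0 \<le> d $ i}"
proof (intro equalityI subsetI)
  fix \<alpha> assume "\<alpha> \<in> nat_span (range x)"
  then obtain c :: "complex^'h \<Rightarrow> nat" where c: "\<alpha> = (\<Sum>\<beta>\<in>range x. of_nat (c \<beta>) *s \<beta>)"
    unfolding nat_span_def by blast
  have "\<alpha> = root_map x (\<chi> i. int (c (x i)))"
    unfolding c root_map_def using assms by (simp add: sum.reindex)
  then show "\<alpha> \<in> {root_map x d | d. \<forall>i. 0 \<le> d $ i}" by fastforce
next
  fix \<alpha> assume "\<alpha> \<in> {root_map x d | d. \<forall>i. 0 \<le> d $ i}"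
  then obtain d where d: "\<alpha> = root_map x d" "\<forall>i. 0 \<le> d $ i" by blast
  have "\<alpha> = (\<Sum>\<beta>\<in>range x. of_nat (nat (d $ inv x \<beta>)) *s \<beta>)"
    unfolding d root_map_def using assms d(2) by (simp add: sum.reindex)
  then show "\<alpha> \<in> nat_span (range x)"
    unfolding nat_span_def by (auto intro: exI[of _ "\<lambda>\<beta>. nat (d $ inv x \<beta>)"])
qed

text \<open>Phrased by the root space and not by a degree, so that it does not refer to a base and
  can be carried along isomorphisms.\<close>

definition even_root :: "('i::finite, 'h::finite) km_datum \<Rightarrow> complex^'h \<Rightarrow> bool" where
  "even_root D \<alpha> \<longleftrightarrow> root_space D \<alpha> \<subseteq> gpart D 0"

section \<open>Classes of terms, root spaces and roots\<close>

context km_alg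
begin

lemma em_eq_0_iff: "em t = 0 \<longleftrightarrow> t \<in> max_ideal D"
  by (rule emb_eq_0_iff[OF tm_ideal_max[OF real]])

lemma tm_rel_iff: "(s, t) \<in> tm_rel D \<longleftrightarrow> em s = em t"
  by (simp add: tm_rel_def emb_Add emb_Scal flip: em_eq_0_iff)

lemma cls_eq: "cls D s = {t. em s = em t}"
  by (auto simp: cls_def tm_rel_iff)

lemma cls_eq_iff: "cls D s = cls D t \<longleftrightarrow> em s = em t"
  by (auto simp: cls_eq)

lemma gcar_eq: "gcar D = range (cls D)"
  by (auto simp: gcar_def quotient_def cls_def)

lemma gadd_cls: "gadd D (cls D s) (cls D t) = cls D (Add s t)"
  unfolding gadd_def by (auto simp: cls_eq emb_Add)

lemma gscal_cls: "gscal D c (cls D s) = cls D (Scal c s)"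
  unfolding gscal_def by (auto simp: cls_eq emb_Scal)

lemma gbr_cls: "gbr D (cls D s) (cls D t) = cls D (Br s t)"
  unfolding gbr_def by (auto simp: cls_eq emb_Br)

lemma cls_gzero_iff: "cls D t = gzero D \<longleftrightarrow> em t = 0"
  by (simp add: gzero_def cls_eq_iff)

lemma cls_root_space_iff: "cls D t \<in> root_space D \<alpha> \<longleftrightarrow> wt hg \<alpha> (em t)"
  by (simp add: root_space_def gcar_eq gbr_cls gscal_cls cls_eq_iff wt_def emb_Br emb_Scal)

lemma root_space_eq: "root_space D \<alpha> = cls D ` {t. wt hg \<alpha> (em t)}"
  using cls_root_space_iff by (auto simp: root_space_def gcar_eq)

lemma roots_iff: "\<alpha> \<in> roots D \<longleftrightarrow> \<alpha> \<noteq> 0 \<and> (\<exists>t. wt hg \<alpha> (em t) \<and> em t \<noteq> 0)"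
proof -
  have "gzero D \<in> root_space D \<alpha>"
    unfolding gzero_def cls_root_space_iff by simp
  then have "root_space D \<alpha> \<noteq> {gzero D} \<longleftrightarrow> (\<exists>t. cls D t \<in> root_space D \<alpha> \<and> cls D t \<noteq> gzero D)"
    using root_space_eq by auto
  then show ?thesis unfolding roots_def by (auto simp: cls_root_space_iff cls_gzero_iff)
qed

lemma V_root: "X \<in> V d \<Longrightarrow> X \<noteq> 0 \<Longrightarrow> d \<noteq> 0 \<Longrightarrow> root_map (rt D) d \<in> roots D"
  using V_range[of d] V_wt[of X d] al_indep[of d] unfolding roots_iff by blast

lemma root_degree:
  assumes "\<alpha> \<in> roots D"
  obtains d X where "\<alpha> = root_map (rt D) d" "X \<in> V d" "X \<noteq> 0"
  using assms emb_weight unfolding roots_iff by metis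

lemma hg_eq_0_iff: "hg x = 0 \<longleftrightarrow> x = 0"
  using trivial_on_h_max[of D] Hgen_injective by (auto simp: em_eq_0_iff[symmetric] trivial_on_h_def)

text \<open>The bracket with \<open>fg i\<close> is the coroot, which is nonzero because the Cartan
  subalgebra embeds.\<close>

lemma eg_nonzero: "eg i \<noteq> 0"
proof
  assume "eg i = 0"
  then have "crt D i = 0" using ef[of i i] by (simp add: hg_eq_0_iff)
  then show False using real vec.dependent_zero[of "range (crt D)"]
    unfolding realization_def by (metis rangeI)
qed

lemma e_in_V: "eg i \<in> V (axis i 1)"
  unfolding V_def by (rule qv.span_base) (use pw.base[of eg i] in auto)

lemma ee_pw: "pw eg (axis i 2) (br (eg i) (eg i))"
proof -
  have "axis i 1 + axis i 1 = (axis i 2 :: int^'i)" by (simp add: axis_def vec_eq_iff)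
  then show ?thesis using pw.step[OF pw.base[of eg i], of i] by simp
qed

lemma simple_root: "rt D i \<in> roots D"
proof -
  have "(axis i 1 :: int^'i) \<noteq> 0" by (simp add: axis_eq_0_iff)
  from V_root[OF e_in_V eg_nonzero this] show ?thesis by (simp add: root_map_axis)
qed

lemma root_sign:
  assumes "\<alpha> \<in> roots D"
  shows "\<alpha> \<in> nat_span (range (rt D)) \<or> - \<alpha> \<in> nat_span (range (rt D))"
proof -
  obtain d X where d: "\<alpha> = root_map (rt D) d" "X \<in> V d" "X \<noteq> 0" using root_degree[OF assms] .
  have "inj (rt D)" using real by (simp add: realization_def)
  from V_nonzero[OF d(2,3)] show ?thesis
  proof
    assume "\<forall>i. 0 \<le> d $ i"
    then show ?thesis unfolding nat_span_range[OF \<open>inj (rt D)\<close>] d(1) by blast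
  next
    assume "\<forall>i. d $ i \<le> 0"
    then have "\<forall>i. 0 \<le> (- d) $ i" by simp
    then show ?thesis unfolding nat_span_range[OF \<open>inj (rt D)\<close>] d(1) root_map_uminus[symmetric] by blast
  qed
qed

lemma uminus_root:
  assumes "\<alpha> \<in> roots D"
  shows "- \<alpha> \<in> roots D"
proof -
  obtain t where t: "\<alpha> \<noteq> 0" "wt hg \<alpha> (em t)" "em t \<noteq> 0" using assms unfolding roots_iff by blast
  have "br (hg x) (em (chev D t)) = ev (- \<alpha>) x *q em (chev D t)" for x
  proof -
    \<comment> \<open>This term states the weight equation of \<open>t\<close> at
      \<open>- x\<close>. It lies in the maximal ideal, and so does its image, which is the equation
      for the image of \<open>t\<close> at \<open>x\<close> and weight
      \<open>- \<alpha>\<close>.\<close>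
    let ?u = "Add (Br (Hgen (- x)) t) (Scal (-1) (Scal (ev \<alpha> (- x)) t))"
    have "em ?u = 0" using t(2) by (simp add: wt_def emb_Add emb_Scal emb_Br)
    then have "em (chev D ?u) = 0" unfolding em_eq_0_iff by (rule chev_max[OF real])
    then show ?thesis by (simp add: emb_Add emb_Scal emb_Br ev_def sum_negf eq_neg_iff_add_eq_0)
  qed
  moreover have "em (chev D t) \<noteq> 0" using t(3) chev_max_iff[OF real] by (simp add: em_eq_0_iff)
  ultimately show ?thesis using t(1) unfolding roots_iff wt_def by auto
qed

section \<open>Parity of root spaces, and doubles of roots\<close>

lemma cls_gpart_iff: "cls D t \<in> gpart D a \<longleftrightarrow> em t \<in> S a"
proof
  assume "cls D t \<in> gpart D a"
  then obtain s where "cls D t = cls D s" "homog D a s" unfolding gpart_def by blast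
  then show "em t \<in> S a" using homog_S by (simp add: cls_eq_iff)
next
  assume t: "em t \<in> S a"
  obtain s0 s1 where s: "homog D 0 s0" "homog D 1 s1" "em s0 \<in> S 0" "em s1 \<in> S 1"
    "em t = em s0 + em s1" using emb_parts by metis
  show "cls D t \<in> gpart D a"
  proof (cases a)
    case zero
    have "em s1 = em t + (- 1) *q em s0" using s(5) by simp
    also have "\<dots> \<in> S 0" using t s(3) zero by (blast intro: S_add S_sc)
    finally have "em s1 = 0" using S_disjoint s(4) by blast
    then show ?thesis using s(1,5) zero unfolding gpart_def by (auto simp: cls_eq_iff)
  next
    case one
    have "em s0 = em t + (- 1) *q em s1" using s(5) by simp
    also have "\<dots> \<in> S 1" using t s(4) one by (blast intro: S_add S_sc)
    finally have "em s0 = 0" using S_disjoint s(3) by blast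
    then show ?thesis using s(2,5) one unfolding gpart_def by (auto simp: cls_eq_iff)
  qed
qed

lemma root_space_parity:
  assumes "wt hg (root_map (rt D) d) (em t)"
  shows "em t \<in> S (pdeg (par D) d)"
proof (cases "em t = 0")
  case False
  from emb_weight[OF assms this] obtain d' where "root_map (rt D) d' = root_map (rt D) d" "em t \<in> V d'"
    by blast
  then show ?thesis using inj_root_map V_sub_S[of d'] by (auto simp: inj_def)
qed (simp add: S_0)

lemma weight_0:
  assumes "wt hg 0 (em t)" shows "\<exists>y. em t = hg y"
proof (cases "em t = 0")
  case False
  from emb_weight[OF assms this] show ?thesis using al_indep V_zero_degree by blast
qed (metis h_0)

lemma even_root_iff:
  assumes "root_map (rt D) d \<in> roots D"
  shows "even_root D (root_map (rt D) d) \<longleftrightarrow> pdeg (par D) d = 0"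
proof
  assume even: "even_root D (root_map (rt D) d)"
  obtain t where t: "wt hg (root_map (rt D) d) (em t)" "em t \<noteq> 0" using assms unfolding roots_iff by blast
  then have "em t \<in> S 0"
    using even unfolding even_root_def root_space_eq by (auto simp: cls_gpart_iff)
  then show "pdeg (par D) d = 0"
    using root_space_parity[OF t(1)] S_disjoint[of "em t"] t(2) by (cases "pdeg (par D) d") auto
next
  assume "pdeg (par D) d = 0"
  then show "even_root D (root_map (rt D) d)"
    using root_space_parity[of d] unfolding even_root_def root_space_eq by (auto simp: cls_gpart_iff)
qed

lemma even_root_simple: "even_root D (rt D i) \<longleftrightarrow> par D i = 0"
  using even_root_iff[of "axis i 1"] simple_root[of i] by (simp add: root_map_axis)

text \<open>A double has degree \<open>d + d\<close>, whose parity is 0.\<close>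

lemma even_root_double: "\<gamma> \<in> roots D \<Longrightarrow> 2 *s \<gamma> \<in> roots D \<Longrightarrow> even_root D (2 *s \<gamma>)"
proof -
  assume *: "\<gamma> \<in> roots D" "2 *s \<gamma> \<in> roots D"
  obtain d where d: "\<gamma> = root_map (rt D) d" using root_degree[OF *(1)] .
  have "2 *s \<gamma> = root_map (rt D) (d + d)"
    unfolding d root_map_add by (simp add: vec_eq_iff)
  then show ?thesis using even_root_iff[of "d + d"] pdeg_add[of "par D" d d] * by (simp del: pdeg_add)
qed

lemma even_root_uminus: "\<alpha> \<in> roots D \<Longrightarrow> even_root D \<alpha> \<Longrightarrow> even_root D (- \<alpha>)"
proof -
  assume *: "\<alpha> \<in> roots D" "even_root D \<alpha>"
  obtain d where d: "\<alpha> = root_map (rt D) d" using root_degree[OF *(1)] .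
  then show ?thesis using even_root_iff[of d] even_root_iff[of "- d"] * uminus_root[OF *(1)]
    by (simp add: root_map_uminus)
qed

text \<open>The bracket of \<open>[e_i, e_i]\<close> with \<open>f_j\<close> is 0 for j different
  from i, and for j = i a multiple of the diagonal entry, here 0. So \<open>[e_i, e_i]\<close> is a
  singular vector.\<close>

lemma isotropic_ee: assumes "par D i = 1" "cmat D $ i $ i = 0" shows "br (eg i) (eg i) = 0"
proof (rule singular_vector[OF ee_pw])
  fix j
  have "ev (rt D i) (crt D i) = 0" using real assms(2) by (simp add: realization_def)
  then show "br (fg j) (br (eg i) (eg i)) = 0"
    unfolding br_jacobi[OF hom_f hom_e] by (simp add: fe he eh br_sc_left br_sc_right)
qed

lemma isotropic_multiple:
  assumes "par D i = 1" "cmat D $ i $ i = 0" "2 \<le> k"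
  shows "of_nat k *s rt D i \<notin> roots D"
proof
  assume "of_nat k *s rt D i \<in> roots D"
  then obtain d X where d: "of_nat k *s rt D i = root_map (rt D) d" "X \<in> V d" "X \<noteq> 0"
    using root_degree by blast
  then have "root_map (rt D) (axis i (int k)) = root_map (rt D) d" by (simp add: root_map_axis)
  then have "axis i (int k) = d" using inj_root_map by (simp add: inj_def)
  then show False using V_simple_multiple[of X i k] d(2,3) assms isotropic_ee by blast
qed

text \<open>Now the bracket of \<open>[e_i, e_i]\<close> with \<open>f_i\<close> is
  \<open>2 a_ii e_i\<close>, which is nonzero.\<close>

lemma nonisotropic_double:
  assumes "par D i = 1" "cmat D $ i $ i \<noteq> 0"
  shows "2 *s rt D i \<in> roots D"
proof -
  have c: "ev (rt D i) (crt D i) \<noteq> 0" using real assms(2) by (simp add: realization_def)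
  have "br (fg i) (br (eg i) (eg i)) = (2 * ev (rt D i) (crt D i)) *q eg i"
    unfolding br_jacobi[OF hom_f hom_e]
    by (simp add: fe he eh assms(1) br_sc_left br_sc_right sgn_bit_def flip: qv.scale_left_distrib)
  then have "br (eg i) (eg i) \<noteq> 0" using eg_nonzero[of i] c by auto
  moreover have "br (eg i) (eg i) \<in> V (axis i 2)"
    unfolding V_def by (rule qv.span_base) (use ee_pw in auto)
  moreover have "(axis i 2 :: int^'i) \<noteq> 0" by (simp add: axis_eq_0_iff)
  ultimately have "root_map (rt D) (axis i 2) \<in> roots D" using V_root by blast
  then show ?thesis by (simp add: root_map_axis)
qed

section \<open>Borel subalgebras and their roots\<close>

lemma g_subspace_gcar: "g_subspace D (gcar D)"
  unfolding g_subspace_def gzero_def gcar_eq by (auto simp: gadd_cls gscal_cls)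

lemma g_subspace_borel: "g_subspace D (borel_of D B)"
proof -
  let ?G = "range (\<lambda>x. cls D (Hgen x)) \<union> (\<Union>\<alpha> \<in> roots D \<inter> nat_span B. root_space D \<alpha>)"
  have "?G \<subseteq> gcar D" by (auto simp: gcar_eq root_space_eq)
  then have "borel_of D B \<subseteq> gcar D"
    unfolding borel_of_def by (intro hull_minimal g_subspace_gcar)
  then show ?thesis unfolding g_subspace_def borel_of_def hull_def by auto
qed

lemma borel_generators:
  "cls D (Hgen x) \<in> borel_of D B"
  "\<alpha> \<in> roots D \<Longrightarrow> \<alpha> \<in> nat_span B \<Longrightarrow> root_space D \<alpha> \<subseteq> borel_of D B"
  unfolding borel_of_def by (rule set_mp[OF hull_subset], blast, rule subset_trans[OF _ hull_subset], blast)

lemma g_subspace_sum: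
  assumes P: "g_subspace D P" and "finite F" "\<And>k. k \<in> F \<Longrightarrow> \<exists>t. x k = em t \<and> cls D t \<in> P"
  shows "\<exists>t. (\<Sum>k\<in>F. x k) = em t \<and> cls D t \<in> P"
  using assms(2,3)
proof (induction rule: finite_induct)
  case empty
  then show ?case using P unfolding g_subspace_def gzero_def by (intro exI[of _ "Hgen 0"]) simp
next
  case (insert k F)
  then obtain s t where "x k = em s" "cls D s \<in> P" "(\<Sum>k\<in>F. x k) = em t" "cls D t \<in> P" by blast
  then show ?case using P insert.hyps unfolding g_subspace_def
    by (intro exI[of _ "Add s t"]) (auto simp: emb_Add simp flip: gadd_cls)
qed

text \<open>A hull is accessible only through minimality: the classes of sums of weight vectors with
  these weights form a subspace \<open>?P\<close> that contains the generators. The weight 0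
  accounts for the Cartan subalgebra.\<close>

lemma borel_elements:
  assumes "cls D t \<in> borel_of D B"
  obtains F x where "finite F" "F \<subseteq> insert 0 (roots D \<inter> nat_span B)"
    "\<And>\<beta>. \<beta> \<in> F \<Longrightarrow> \<exists>s. x \<beta> = em s \<and> wt hg \<beta> (em s)" "em t = (\<Sum>\<beta>\<in>F. x \<beta>)"
proof -
  define W where "W \<beta> = em ` {s. wt hg \<beta> (em s)}" for \<beta>
  define I where "I = insert 0 (roots D \<inter> nat_span B)"
  have W_sub: "qv.subspace (W \<beta>)" for \<beta>
    unfolding qv.subspace_def
  proof (intro conjI ballI allI)
    show "0 \<in> W \<beta>" unfolding W_def by (rule image_eqI[of _ _ "Hgen 0"]) auto
    fix X assume "X \<in> W \<beta>"
    then obtain s where s: "X = em s" "wt hg \<beta> (em s)" by (auto simp: W_def)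
    show "c *q X \<in> W \<beta>" for c
      unfolding W_def using s by (intro image_eqI[of _ _ "Scal c s"]) (auto simp: emb_Scal intro: wt_sc)
    fix Y assume "Y \<in> W \<beta>"
    then obtain r where "Y = em r" "wt hg \<beta> (em r)" by (auto simp: W_def)
    then show "X + Y \<in> W \<beta>"
      unfolding W_def using s by (intro image_eqI[of _ _ "Add s r"]) (auto simp: emb_Add intro: wt_add)
  qed
  let ?P = "cls D ` {s. em s \<in> qv.span (\<Union>\<beta>\<in>I. W \<beta>)}"
  have "g_subspace D ?P"
    unfolding g_subspace_def gzero_def gcar_eq
  proof (intro conjI ballI allI)
    show "cls D (Hgen 0) \<in> ?P" by (rule image_eqI[of _ _ "Hgen 0"]) (auto simp: qv.span_zero)
    fix X assume "X \<in> ?P"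
    then obtain s where s: "X = cls D s" "em s \<in> qv.span (\<Union>\<beta>\<in>I. W \<beta>)" by auto
    show "gscal D c X \<in> ?P" for c
      unfolding s(1) gscal_cls using s(2) by (intro imageI) (simp add: emb_Scal qv.span_scale)
    fix Y assume "Y \<in> ?P"
    then obtain r where r: "Y = cls D r" "em r \<in> qv.span (\<Union>\<beta>\<in>I. W \<beta>)" by auto
    show "gadd D X Y \<in> ?P"
      unfolding s(1) r(1) gadd_cls using s(2) r(2) by (intro imageI) (simp add: emb_Add qv.span_add)
  qed auto
  moreover have "cls D (Hgen y) \<in> ?P" for y
    by (intro imageI CollectI qv.span_base UN_I[of 0]) (auto simp: I_def W_def h_wt)
  moreover have "root_space D \<alpha> \<subseteq> ?P" if "\<alpha> \<in> roots D" "\<alpha> \<in> nat_span B" for \<alpha>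
    unfolding root_space_eq
    using that by (intro image_mono subsetI CollectI qv.span_base UN_I[of \<alpha>]) (auto simp: I_def W_def)
  ultimately have "borel_of D B \<subseteq> ?P"
    unfolding borel_of_def by (intro hull_minimal Un_least UN_least) (blast intro: image_subsetI)+
  then have "em t \<in> qv.span (\<Union>\<beta>\<in>I. W \<beta>)" using assms by (auto simp: cls_eq_iff)
  from qv_span_UN[OF this] obtain F x where F: "finite F" "F \<subseteq> I" "\<forall>\<beta>\<in>F. x \<beta> \<in> qv.span (W \<beta>)"
    "em t = (\<Sum>\<beta>\<in>F. x \<beta>)" by metis
  have "qv.span (W \<beta>) = W \<beta>" for \<beta> using W_sub by (simp add: qv.span_eq_iff)
  then have "\<forall>\<beta>\<in>F. x \<beta> \<in> W \<beta>" using F(3) by metis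
  then have "\<exists>s. x \<beta> = em s \<and> wt hg \<beta> (em s)" if "\<beta> \<in> F" for \<beta>
    using that unfolding W_def by blast
  then show ?thesis using F(1,2,4) that[of F x] unfolding I_def by blast
qed

text \<open>A nonzero weight vector in the Borel subalgebra is a sum of weight vectors with the
  listed weights, hence equal to one of them.\<close>

lemma pos_roots_borel: "pos_roots D (borel_of D B) = roots D \<inter> nat_span B"
proof (intro equalityI subsetI)
  fix \<alpha> assume "\<alpha> \<in> pos_roots D (borel_of D B)"
  then have \<alpha>: "\<alpha> \<in> roots D" "root_space D \<alpha> \<subseteq> borel_of D B" by (auto simp: pos_roots_def)
  then obtain t where t: "\<alpha> \<noteq> 0" "wt hg \<alpha> (em t)" "em t \<noteq> 0" unfolding roots_iff by blast
  then have "cls D t \<in> borel_of D B" using \<alpha>(2) cls_root_space_iff by blast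
  then obtain F x where F: "finite F" "F \<subseteq> insert 0 (roots D \<inter> nat_span B)"
    "\<And>\<beta>. \<beta> \<in> F \<Longrightarrow> \<exists>s. x \<beta> = em s \<and> wt hg \<beta> (em s)"
    "em t = (\<Sum>\<beta>\<in>F. x \<beta>)" using borel_elements by metis
  have "\<exists>\<beta>\<in>F. \<beta> = \<alpha> \<and> (\<Sum>\<beta>\<in>F. x \<beta>) = x \<beta>"
    using F(3) t(2,3) unfolding F(4) by (intro wt_component[OF F(1), where h = hg]) (auto, metis)
  then show "\<alpha> \<in> roots D \<inter> nat_span B" using F(2) t(1) by auto
qed (auto simp: pos_roots_def dest: borel_generators(2))

text \<open>The weight components of odd roots in an even element sum to a vector that is both even
  and odd. They cancel, and only even roots have to be compared.\<close>

lemma borel_even_subset: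
  assumes "\<And>\<alpha>. \<alpha> \<in> roots D \<Longrightarrow> \<alpha> \<in> nat_span B \<Longrightarrow> even_root D \<alpha> \<Longrightarrow> \<alpha> \<in> nat_span B'"
  shows "borel_of D B \<inter> gpart D 0 \<subseteq> borel_of D B'"
proof
  fix X assume X: "X \<in> borel_of D B \<inter> gpart D 0"
  then obtain t where t: "X = cls D t" unfolding gpart_def by blast
  then have t0: "em t \<in> S 0" using X by (simp add: cls_gpart_iff)
  obtain F x where F: "finite F" "F \<subseteq> insert 0 (roots D \<inter> nat_span B)"
    "\<And>\<beta>. \<beta> \<in> F \<Longrightarrow> \<exists>s. x \<beta> = em s \<and> wt hg \<beta> (em s)"
    "em t = (\<Sum>\<beta>\<in>F. x \<beta>)" using borel_elements X t by (metis IntD1)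
  define E where "E = {\<beta> \<in> F. \<beta> = 0 \<or> even_root D \<beta>}"
  have E_obtain: "\<exists>s. x \<beta> = em s \<and> wt hg \<beta> (em s)" if "\<beta> \<in> E" for \<beta>
    using F(3) that unfolding E_def by blast
  have S0: "x \<beta> \<in> S 0" if "\<beta> \<in> E" for \<beta>
  proof -
    obtain s where s: "x \<beta> = em s" "wt hg \<beta> (em s)"
      using E_obtain[OF \<open>\<beta> \<in> E\<close>] by blast
    show ?thesis
    proof (cases "\<beta> = 0")
      case True
      then show ?thesis using s root_space_parity[of 0 s] by simp
    next
      case False
      then have "even_root D \<beta>" using that by (simp add: E_def)
      moreover have "cls D s \<in> root_space D \<beta>" using s(2) by (simp add: cls_root_space_iff)
      ultimately have "cls D s \<in> gpart D 0" unfolding even_root_def by blast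
      then show ?thesis using s(1) by (simp add: cls_gpart_iff)
    qed
  qed
  have S1: "x \<beta> \<in> S 1" if FE: "\<beta> \<in> F - E" for \<beta>
  proof -
    obtain s where s: "x \<beta> = em s" "wt hg \<beta> (em s)" using F(3) FE by blast
    have \<beta>: "\<beta> \<in> roots D" "\<not> even_root D \<beta>" using FE F(2) by (auto simp: E_def)
    then obtain d where d: "\<beta> = root_map (rt D) d" using root_degree by blast
    then have "pdeg (par D) d \<noteq> 0" using even_root_iff[of d] \<beta> by blast
    then have "pdeg (par D) d = 1" by (cases "pdeg (par D) d") auto
    then show ?thesis using root_space_parity[of d s] s d by simp
  qed
  have sumE: "(\<Sum>\<beta>\<in>E. x \<beta>) \<in> S 0" and sumO: "(\<Sum>\<beta>\<in>F - E. x \<beta>) \<in> S 1"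
    using S0 S1 unfolding S_def by (auto intro: qv.span_sum)
  have "em t = (\<Sum>\<beta>\<in>E. x \<beta>) + (\<Sum>\<beta>\<in>F - E. x \<beta>)"
    unfolding F(4) using F(1) by (simp add: E_def sum.subset_diff[of E F] add.commute)
  then have "(\<Sum>\<beta>\<in>F - E. x \<beta>) = em t + (- 1) *q (\<Sum>\<beta>\<in>E. x \<beta>)" by simp
  also have "\<dots> \<in> S 0" using t0 sumE by (blast intro: S_add S_sc)
  finally have "(\<Sum>\<beta>\<in>F - E. x \<beta>) = 0" using S_disjoint sumO by blast
  then have et: "em t = (\<Sum>\<beta>\<in>E. x \<beta>)" using \<open>em t = _ + _\<close> by simp
  have "\<exists>s. x \<beta> = em s \<and> cls D s \<in> borel_of D B'" if "\<beta> \<in> E" for \<beta>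
  proof -
    obtain s where s: "x \<beta> = em s" "wt hg \<beta> (em s)"
      using E_obtain[OF \<open>\<beta> \<in> E\<close>] by blast
    show ?thesis
    proof (cases "\<beta> = 0")
      case True
      then obtain y where "em s = hg y" using weight_0 s(2) by blast
      then show ?thesis using s(1) borel_generators(1) by metis
    next
      case False
      then have "\<beta> \<in> roots D" "\<beta> \<in> nat_span B'" using assms that F(2) unfolding E_def by auto
      then show ?thesis using s borel_generators(2) cls_root_space_iff by blast
    qed
  qed
  then obtain s where "em t = em s" "cls D s \<in> borel_of D B'"
    using g_subspace_sum[OF g_subspace_borel, of E x] F(1) unfolding et E_def by auto
  then show "X \<in> borel_of D B'" using t cls_eq_iff by metis
qed

lemma presents_refl: "presents D D"
  unfolding presents_def using real by (intro conjI exI[of _ id]) (auto simp: bij_betw_def)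

end

section \<open>Independence of the presenting datum\<close>

lemma presents_real: "presents D D' \<Longrightarrow> realization D'"
  by (simp add: presents_def)

text \<open>The isomorphism fixes the Cartan subalgebra pointwise and preserves parity, so it
  carries root spaces to root spaces of the same weight and parity.\<close>

lemma presents_transfer:
  assumes D: "realization D" and "presents D D'"
  shows "roots D' = roots D" "even_root D' \<alpha> \<longleftrightarrow> even_root D \<alpha>"
proof -
  interpret A: km_alg D by unfold_locales (rule D)
  interpret A': km_alg D' by unfold_locales (rule presents_real[OF assms(2)])
  obtain \<phi> where bij: "bij_betw \<phi> (gcar D') (gcar D)"
    and sc: "\<And>c X. X \<in> gcar D' \<Longrightarrow> \<phi> (gscal D' c X) = gscal D c (\<phi> X)"
    and br: "\<And>X Y. X \<in> gcar D' \<Longrightarrow> Y \<in> gcar D' \<Longrightarrow> \<phi> (gbr D' X Y) = gbr D (\<phi> X) (\<phi> Y)"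
    and par: "\<And>a. \<phi> ` gpart D' a = gpart D a"
    and H: "\<And>x. \<phi> (cls D' (Hgen x)) = cls D (Hgen x)"
    using assms(2) unfolding presents_def by metis
  have inj: "inj_on \<phi> (gcar D')" and im: "\<phi> ` gcar D' = gcar D" using bij by (auto simp: bij_betw_def)
  have iff: "\<phi> X \<in> root_space D \<alpha> \<longleftrightarrow> X \<in> root_space D' \<alpha>" if X: "X \<in> gcar D'" for X \<alpha>
  proof -
    have "gbr D (cls D (Hgen x)) (\<phi> X) = gscal D (ev \<alpha> x) (\<phi> X) \<longleftrightarrow>
        gbr D' (cls D' (Hgen x)) X = gscal D' (ev \<alpha> x) X" for x
    proof -
      obtain t where t: "X = cls D' t" using X unfolding A'.gcar_eq by blast
      have "gbr D (cls D (Hgen x)) (\<phi> X) = \<phi> (gbr D' (cls D' (Hgen x)) X)"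
        using br[OF _ X, of "cls D' (Hgen x)"] by (simp add: H A'.gcar_eq)
      moreover have "gbr D' (cls D' (Hgen x)) X \<in> gcar D'" "gscal D' (ev \<alpha> x) X \<in> gcar D'"
        unfolding t A'.gbr_cls A'.gscal_cls A'.gcar_eq by auto
      ultimately show ?thesis using sc[OF X] inj by (metis inj_onD)
    qed
    moreover have "\<phi> X \<in> gcar D" using X im by blast
    ultimately show ?thesis using X unfolding root_space_def by blast
  qed
  have rs: "root_space D \<alpha> = \<phi> ` root_space D' \<alpha>" for \<alpha>
  proof (intro equalityI subsetI)
    fix Y assume "Y \<in> root_space D \<alpha>"
    then obtain X where "X \<in> gcar D'" "Y = \<phi> X" using im unfolding root_space_def by blast
    then show "Y \<in> \<phi> ` root_space D' \<alpha>" using iff \<open>Y \<in> _\<close> by blast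
  next
    fix Y assume "Y \<in> \<phi> ` root_space D' \<alpha>"
    then show "Y \<in> root_space D \<alpha>" using iff unfolding root_space_def by blast
  qed
  have z: "\<phi> (gzero D') = gzero D" unfolding gzero_def by (rule H)
  have sub: "root_space D' \<alpha> \<subseteq> gcar D'" "gpart D' a \<subseteq> gcar D'" "{gzero D'} \<subseteq> gcar D'" for \<alpha> a
    unfolding root_space_def gpart_def gzero_def A'.gcar_eq by auto
  have "root_space D \<alpha> = {gzero D} \<longleftrightarrow> root_space D' \<alpha> = {gzero D'}" for \<alpha>
    using inj_on_image_eq_iff[OF inj sub(1)[of \<alpha>] sub(3)] by (simp add: rs z)
  then show "roots D' = roots D" unfolding roots_def by simp
  show "even_root D' \<alpha> \<longleftrightarrow> even_root D \<alpha>"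
    unfolding even_root_def rs par[symmetric]
    using inj_on_image_subset_iff[OF inj sub(1)[of \<alpha>] sub(2)[of 0]] by simp
qed

context
  fixes D :: "('i::finite, 'h::finite) km_datum"
  assumes D: "realization D"
begin

interpretation A: km_alg D by unfold_locales (rule D)

lemma presents_km_alg: "presents D D' \<Longrightarrow> km_alg D'"
  by unfold_locales (rule presents_real)

lemma baseE:
  assumes "base D B"
  obtains D' where "presents D D'" "B = range (rt D')" "inj (rt D')" "vec.independent B"
  using assms presents_real unfolding base_def realization_def by metis

lemma base_standard: "base D (range (rt D))"
  unfolding base_def using A.presents_refl by blast

lemma base_sign:
  assumes "base D B" "\<alpha> \<in> roots D"
  shows "\<alpha> \<in> nat_span B \<or> - \<alpha> \<in> nat_span B"
proof -
  obtain D' where D': "presents D D'" "B = range (rt D')" using baseE[OF assms(1)] .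
  interpret A': km_alg D' by (rule presents_km_alg[OF D'(1)])
  show ?thesis using A'.root_sign assms(2) unfolding D'(2) presents_transfer(1)[OF D D'(1)] by blast
qed

lemma base_roots:
  assumes "base D B"
  shows "B \<subseteq> roots D"
proof -
  obtain D' where D': "presents D D'" "B = range (rt D')" using baseE[OF assms(1)] .
  interpret A': km_alg D' by (rule presents_km_alg[OF D'(1)])
  show ?thesis using A'.simple_root unfolding D'(2) presents_transfer(1)[OF D D'(1)] by blast
qed

text \<open>The left side asks for some presentation of \<open>B\<close>; the right side depends on
  \<alpha> alone. Hence every presentation of \<open>B\<close> gives the same answer.\<close>

lemma isotropic_iff:
  assumes "base D B" "\<alpha> \<in> B"
  shows "isotropic D B \<alpha> \<longleftrightarrow> \<not> even_root D \<alpha> \<and> 2 *s \<alpha> \<notin> roots D"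
proof
  assume "isotropic D B \<alpha>"
  then obtain D' i where D': "presents D D'" "B = range (rt D')" "\<alpha> = rt D' i"
    and i: "par D' i = 1" "cmat D' $ i $ i = 0" unfolding isotropic_def by blast
  interpret A': km_alg D' by (rule presents_km_alg[OF D'(1)])
  show "\<not> even_root D \<alpha> \<and> 2 *s \<alpha> \<notin> roots D"
    using A'.even_root_simple[of i] A'.isotropic_multiple[OF i, of 2] i(1)
    unfolding presents_transfer[OF D D'(1)] D'(3) by simp
next
  assume \<alpha>: "\<not> even_root D \<alpha> \<and> 2 *s \<alpha> \<notin> roots D"
  obtain D' where D': "presents D D'" "B = range (rt D')" using baseE[OF assms(1)] .
  then obtain i where i: "\<alpha> = rt D' i" using assms(2) by blast
  interpret A': km_alg D' by (rule presents_km_alg[OF D'(1)])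
  have "par D' i \<noteq> 0" using A'.even_root_simple[of i] \<alpha> unfolding presents_transfer[OF D D'(1)] i by simp
  then have "par D' i = 1" by (cases "par D' i") auto
  moreover have "cmat D' $ i $ i = 0"
    using A'.nonisotropic_double[OF calculation] \<alpha> unfolding presents_transfer[OF D D'(1)] i by blast
  ultimately show "isotropic D B \<alpha>" unfolding isotropic_def using D' i by blast
qed

lemma isotropic_multiple_not_root:
  assumes "isotropic D B \<alpha>" "2 \<le> k"
  shows "of_nat k *s \<alpha> \<notin> roots D"
proof -
  obtain D' i where D': "presents D D'" "\<alpha> = rt D' i"
    and i: "par D' i = 1" "cmat D' $ i $ i = 0" using assms(1) unfolding isotropic_def by blast
  interpret A': km_alg D' by (rule presents_km_alg[OF D'(1)])
  show ?thesis using A'.isotropic_multiple[OF i assms(2)] unfolding presents_transfer[OF D D'(1)] D'(2) .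
qed

lemma isotropic_base: "isotropic D B \<alpha> \<Longrightarrow> base D B \<and> \<alpha> \<in> B"
  unfolding isotropic_def base_def by blast

end

subsection \<open>Bases and odd reflections\<close>

lemma root_map_sum: "root_map x (\<Sum>k\<in>A. g k) = (\<Sum>k\<in>A. root_map x (g k))"
  by (induction A rule: infinite_finite_induct) (simp_all add: root_map_add)

lemma root_map_scale: "root_map x (c *s v) = of_int c *s root_map x v"
  by (simp add: root_map_def vec.scale_sum_right)

lemma root_map_sroot [simp]: "root_map x (sroot i) = x i"
  by (simp add: root_map_axis)

lemma root_map_change:
  assumes "\<And>j. x j = root_map y (v j)"
  shows "root_map y (\<Sum>j\<in>UNIV. (d $ j) *s v j) = root_map x d"
  unfolding root_map_sum root_map_scale assms[symmetric] by (simp add: root_map_def)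

lemma double_nat_span: "\<alpha> \<in> nat_span B \<Longrightarrow> 2 *s \<alpha> \<in> nat_span B"
proof -
  assume "\<alpha> \<in> nat_span B"
  then obtain c where c: "\<alpha> = (\<Sum>\<beta>\<in>B. of_nat (c \<beta>) *s \<beta>)" unfolding nat_span_def by blast
  have "2 *s \<alpha> = (\<Sum>\<beta>\<in>B. of_nat (2 * c \<beta>) *s \<beta>)" unfolding c vec.scale_sum_right by simp
  then show ?thesis unfolding nat_span_def by (intro CollectI exI[of _ "\<lambda>\<beta>. 2 * c \<beta>"])
qed

text \<open>The old simple roots in terms of the new ones: \<open>x j\<close> is the new j-th root
  plus this multiple of the new i-th root \<open>- x i\<close>. For j = i this gives -2, and if
  \<open>x i + x j\<close> is the new root, then \<open>x j\<close> is recovered by adding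
  \<open>- x i\<close> once.\<close>

definition coef :: "('i::finite, 'h::finite) km_datum \<Rightarrow> ('i \<Rightarrow> complex^'h) \<Rightarrow> 'i \<Rightarrow> 'i \<Rightarrow> int" where
  "coef D x i j = (if j = i then - 2 else if x i + x j \<in> roots D then 1 else 0)"

lemma refl_at_coef:
  assumes "inj x"
  shows "x j = refl_at D i x j + of_int (coef D x i j) *s refl_at D i x i"
proof (cases "j = i")
  case True
  then show ?thesis by (simp add: refl_at_def odd_refl_def coef_def vec_eq_iff)
next
  case False
  then have "x j \<noteq> x i" using assms by (auto dest: injD)
  then show ?thesis using False by (auto simp: refl_at_def odd_refl_def coef_def vec_eq_iff)
qed

lemma refl_at_i: "refl_at D i x i = - x i"
  by (simp add: refl_at_def odd_refl_def)

text \<open>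
  The coordinate change of a reflection: an isotropic odd reflection and \<open>s\<^sub>i\<close> are both of this form.
\<close>

definition shear :: "('i::finite \<Rightarrow> int) \<Rightarrow> 'i \<Rightarrow> int^'i \<Rightarrow> int^'i" where
  "shear c i v = (\<Sum>j\<in>UNIV. (v $ j) *s (sroot j + c j *s sroot i))"

lemma shear_add: "shear c i (u + v) = shear c i u + shear c i v"
  unfolding shear_def by (simp only: vector_add_component vector_sadd_rdistrib sum.distrib)

lemma shear_scale_sroot: "shear c i (a *s sroot k) = a *s (sroot k + c k *s sroot i)"
proof -
  have "shear c i (a *s sroot k) = (\<Sum>l\<in>UNIV. if l = k then a *s (sroot k + c k *s sroot i) else 0)"
    unfolding shear_def by (intro sum.cong) (auto simp: axis_def)
  then show ?thesis by simp
qed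

lemma shear_sroot: "shear c i (sroot k) = sroot k + c k *s sroot i"
  using shear_scale_sroot[of c i 1 k] by simp

lemma shear_coord: assumes "k \<noteq> i" shows "shear c i v $ k = v $ k"
proof -
  have "shear c i v $ k = (\<Sum>j\<in>UNIV. if j = k then v $ j else 0)"
    unfolding shear_def sum_component using assms by (intro sum.cong) (auto simp: axis_def)
  then show ?thesis by simp
qed

lemma refl_root_map:
  assumes "inj x"
  shows "root_map (refl_at D i x) (shear (coef D x i) i d) = root_map x d"
  unfolding shear_def
  by (rule root_map_change) (simp add: root_map_add root_map_scale refl_at_coef[OF assms, symmetric])

context
  fixes D :: "('i::finite, 'h::finite) km_datum"
  assumes D: "realization D"
begin

interpretation A: km_alg D by unfold_locales (rule D)

text \<open>A base has as many elements as the index type, so an enumeration of it cannot repeat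
  any.\<close>

lemma base_inj:
  fixes x :: "'i \<Rightarrow> complex^'h"
  assumes "base D (range x)" shows "inj x"
proof -
  obtain D' where "presents D D'" "range x = range (rt D')" "inj (rt D')" "vec.independent (range x)"
    using baseE[OF D assms] .
  then have "card (range x) = card (UNIV :: 'i set)" by (simp add: card_image)
  then show ?thesis by (simp add: eq_card_imp_inj_on)
qed

lemma base_independent: "base D B \<Longrightarrow> vec.independent B"
  by (erule baseE[OF D])

lemma base_root_map_0:
  fixes x :: "'i \<Rightarrow> complex^'h"
  assumes "base D (range x)" "root_map x d = 0" shows "d = 0"
  by (rule root_map_eq_0[OF base_inj[OF assms(1)] base_independent[OF assms(1)] assms(2)])

lemma base_root_map_inj:
  fixes x :: "'i \<Rightarrow> complex^'h"
  assumes "base D (range x)" shows "root_map x c = root_map x d \<longleftrightarrow> c = d"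
  using base_root_map_0[OF assms, of "c - d"] by (auto simp: root_map_diff)

lemma base_nat_span:
  fixes x :: "'i \<Rightarrow> complex^'h"
  assumes "base D (range x)"
  shows "\<alpha> \<in> nat_span (range x) \<longleftrightarrow> (\<exists>d. \<alpha> = root_map x d \<and> (\<forall>i. 0 \<le> d $ i))"
  unfolding nat_span_range[OF base_inj[OF assms]] by simp

lemma base_family: assumes "base D B" obtains x where "B = range (x :: 'i \<Rightarrow> complex^'h)"
  by (rule baseE[OF D assms]) (rule that)

lemma simple_in_nat_span:
  fixes x :: "'i \<Rightarrow> complex^'h"
  assumes "base D (range x)" shows "x i \<in> nat_span (range x)"
  unfolding base_nat_span[OF assms]
  by (intro exI[of _ "sroot i"] conjI allI) (simp only: root_map_sroot, simp add: axis_def)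

lemma base_nat_span_antisym:
  assumes "base D B" "\<alpha> \<in> nat_span B" "- \<alpha> \<in> nat_span B"
  shows "\<alpha> = 0"
proof -
  obtain x where x: "B = range (x :: 'i \<Rightarrow> complex^'h)" using base_family[OF assms(1)] .
  note b = assms(1)[unfolded x]
  obtain c d where c: "\<alpha> = root_map x c" "\<forall>i. 0 \<le> c $ i" and d: "- \<alpha> = root_map x d" "\<forall>i. 0 \<le> d $ i"
    using assms(2,3) unfolding x base_nat_span[OF b] by blast
  have "root_map x (c + d) = 0" using c(1) d(1) by (simp add: root_map_add flip: c(1) d(1))
  then have "c + d = 0" by (rule base_root_map_0[OF b])
  then have "c $ i = 0" for i using c(2) d(2) by (metis add_nonneg_eq_0_iff vector_add_component zero_index)
  then have "c = 0" by (simp add: vec_eq_iff)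
  then show ?thesis using c(1) by simp
qed

lemma root_nonzero: "\<alpha> \<in> roots D \<Longrightarrow> \<alpha> \<noteq> 0"
  by (simp add: roots_def)

lemma base_pos_iff:
  assumes "base D B" "\<alpha> \<in> roots D"
  shows "- \<alpha> \<in> nat_span B \<longleftrightarrow> \<alpha> \<notin> nat_span B"
  using base_sign[OF D assms] base_nat_span_antisym[OF assms(1)] root_nonzero[OF assms(2)] by blast

text \<open>The transition matrices are inverse to each other and have nonnegative integer entries,
  so they are permutation matrices. Concretely, some \<open>y j\<close> occurs in \<open>x i\<close>
  and involves \<open>x i\<close>; nothing can cancel, so all its other coordinates vanish.\<close>

lemma base_subset_aux:
  fixes x y :: "'i \<Rightarrow> complex^'h"
  assumes x: "base D (range x)" and y: "base D (range y)"
    and xy: "range x \<subseteq> nat_span (range y)" "range y \<subseteq> nat_span (range x)"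
  shows "range x \<subseteq> range y"
proof
  fix \<alpha> assume "\<alpha> \<in> range x"
  then obtain i where i: "\<alpha> = x i" by blast
  obtain d where d: "x i = root_map y d" "\<forall>j. 0 \<le> d $ j"
    using xy(1) unfolding image_subset_iff base_nat_span[OF y] by blast
  have "\<forall>j. \<exists>c. y j = root_map x c \<and> (\<forall>k. 0 \<le> c $ k)"
    using xy(2) unfolding image_subset_iff base_nat_span[OF x] by blast
  then obtain c where c: "\<And>j. y j = root_map x (c j)" "\<And>j k. 0 \<le> c j $ k" by metis
  have "root_map x (\<Sum>j\<in>UNIV. (d $ j) *s c j) = root_map x (sroot i)"
    using root_map_change[of y x c d] c(1) d(1) by simp
  then have eq: "(\<Sum>j\<in>UNIV. (d $ j) *s c j) = sroot i" using base_root_map_inj[OF x] by blast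
  have eqk: "(\<Sum>j\<in>UNIV. d $ j * c j $ k) = sroot i $ k" for k
    unfolding eq[symmetric] sum_component by simp
  have "(\<Sum>j\<in>UNIV. d $ j * c j $ i) \<noteq> 0" unfolding eqk by simp
  then obtain j where j: "d $ j * c j $ i \<noteq> 0" by (meson sum.not_neutral_contains_not_neutral)
  have "c j $ k = sroot i $ k" for k
  proof (cases "k = i")
    case True
    have "d $ j * c j $ i \<le> (\<Sum>j\<in>UNIV. d $ j * c j $ i)"
      using d(2) c(2) by (intro member_le_sum) auto
    then have "d $ j * c j $ i \<le> 1" unfolding eqk by simp
    moreover have "0 < d $ j" "0 < c j $ i" using j d(2) c(2) by (auto simp: order.strict_iff_order)
    moreover have "c j $ i \<le> d $ j * c j $ i"
      using mult_right_mono[of 1 "d $ j" "c j $ i"] calculation by simp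
    ultimately have "c j $ i = 1" by linarith
    then show ?thesis using True by simp
  next
    case False
    have "(\<Sum>j\<in>UNIV. d $ j * c j $ k) = 0" unfolding eqk using False by (simp add: axis_def)
    then have "d $ j * c j $ k = 0" using d(2) c(2) by (subst (asm) sum_nonneg_eq_0_iff) auto
    then show ?thesis using j False by (auto simp: axis_def)
  qed
  then have "c j = sroot i" by (simp add: vec_eq_iff)
  then have "y j = x i" using c(1)[of j] by simp
  then show "\<alpha> \<in> range y" using i by (metis rangeI)
qed

lemma base_eqI:
  assumes B: "base D B" and B': "base D B'"
    and eq: "roots D \<inter> nat_span B = roots D \<inter> nat_span B'"
  shows "B = B'"
proof -
  obtain x y where x: "B = range (x :: 'i \<Rightarrow> complex^'h)" and y: "B' = range (y :: 'i \<Rightarrow> complex^'h)"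
    using base_family B B' by metis
  have "range x \<subseteq> nat_span (range x)" "range y \<subseteq> nat_span (range y)"
    using simple_in_nat_span B B' x y by auto
  then have "range x \<subseteq> nat_span (range y)" "range y \<subseteq> nat_span (range x)"
    using base_roots[OF D B] base_roots[OF D B'] eq x y by blast+
  then show ?thesis using base_subset_aux B B' x y by (metis subset_antisym)
qed

lemma simple_roots_borel: assumes "base D B" shows "simple_roots D (borel_of D B) = B"
  unfolding simple_roots_def
proof (rule the_equality)
  fix B' assume "base D B' \<and> borel_of D B = borel_of D B'"
  then show "B' = B" using base_eqI[of B' B] assms A.pos_roots_borel by metis
qed (use assms in simp)

text \<open>No multiple of an isotropic root by 2 or more is a root, so \<beta> has a positive
  coordinate at some k other than i. The reflection keeps this coordinate, and in the new base all
  coordinates have one sign.\<close>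

lemma pos_refl_aux:
  assumes x: "base D (range x)" and y: "base D (range (refl_at D i x))"
    and iso: "isotropic D (range x) (x i)" and \<beta>: "\<beta> \<in> roots D" "\<beta> \<in> nat_span (range x)" "\<beta> \<noteq> x i"
  shows "\<beta> \<in> nat_span (range (refl_at D i x))"
proof -
  obtain d where d: "\<beta> = root_map x d" "\<forall>j. 0 \<le> d $ j"
    using \<beta>(2) unfolding base_nat_span[OF x] by blast
  have "\<exists>k. k \<noteq> i \<and> d $ k \<noteq> 0"
  proof (rule ccontr)
    assume "\<not> ?thesis"
    then have "d = axis i (d $ i)" by (auto simp: vec_eq_iff axis_def)
    then have "root_map x d = of_int (d $ i) *s x i" using root_map_axis[of x i "d $ i"] by simp
    then have b: "\<beta> = of_nat (nat (d $ i)) *s x i" using d by simp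
    have "nat (d $ i) \<noteq> 0" using b root_nonzero[OF \<beta>(1)] by auto
    moreover have "nat (d $ i) \<noteq> 1" using b \<beta>(3) by auto
    ultimately have "2 \<le> nat (d $ i)" by linarith
    then show False using isotropic_multiple_not_root[OF D iso] b \<beta>(1) by blast
  qed
  then obtain k where k: "k \<noteq> i" "0 < d $ k" using d(2) by (metis order.strict_iff_order)
  let ?d = "shear (coef D x i) i d"
  have \<beta>y: "\<beta> = root_map (refl_at D i x) ?d"
    unfolding d(1) by (rule refl_root_map[OF base_inj[OF x], symmetric])
  show ?thesis
  proof (rule ccontr)
    assume "\<not> ?thesis"
    then have "- \<beta> \<in> nat_span (range (refl_at D i x))" using base_sign[OF D y \<beta>(1)] by blast
    then obtain c where c: "- \<beta> = root_map (refl_at D i x) c" "\<forall>j. 0 \<le> c $ j"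
      unfolding base_nat_span[OF y] by blast
    have "root_map (refl_at D i x) (?d + c) = 0" unfolding root_map_add \<beta>y[symmetric] c(1)[symmetric] by simp
    then have "?d + c = 0" by (rule base_root_map_0[OF y])
    from arg_cong[OF this, of "\<lambda>v. v $ k"] have "d $ k + c $ k = 0"
      by (simp only: vector_add_component zero_index shear_coord[OF k(1)])
    moreover have "0 \<le> c $ k" using c(2) by blast
    ultimately show False using k(2) by linarith
  qed
qed

lemma pos_refl:
  assumes x: "base D (range x)" and y: "base D (range (refl_at D i x))"
    and iso: "isotropic D (range x) (x i)" and \<beta>: "\<beta> \<in> roots D"
  shows "\<beta> \<in> nat_span (range (refl_at D i x)) \<longleftrightarrow> \<beta> \<in> nat_span (range x) \<and> \<beta> \<noteq> x i \<or> \<beta> = - x i"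
proof -
  have yi: "- x i \<in> nat_span (range (refl_at D i x))"
    using simple_in_nat_span[OF y, of i] by (simp add: refl_at_i)
  have xi: "x i \<in> roots D" using base_roots[OF D x] by blast
  show ?thesis
  proof
    assume b: "\<beta> \<in> nat_span (range (refl_at D i x))"
    show "\<beta> \<in> nat_span (range x) \<and> \<beta> \<noteq> x i \<or> \<beta> = - x i"
    proof (cases "\<beta> \<in> nat_span (range x)")
      case True
      then show ?thesis using b yi base_pos_iff[OF y xi] by blast
    next
      case False
      then have "- \<beta> \<in> nat_span (range x)" using base_pos_iff[OF x \<beta>] by blast
      moreover have "- \<beta> \<notin> nat_span (range (refl_at D i x))" using base_pos_iff[OF y \<beta>] b by blast
      ultimately have "- \<beta> = x i" using pos_refl_aux[OF x y iso A.uminus_root[OF \<beta>]] by blast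
      then have "\<beta> = - x i" by (metis minus_minus)
      then show ?thesis by blast
    qed
  qed (use yi pos_refl_aux[OF x y iso \<beta>] in auto)
qed

text \<open>The definition of \<open>borels\<close> demands an inclusion only. It is an equality,
  because each side contains exactly one of two opposite roots.\<close>

lemma borels_even:
  assumes "base D B" "borel_of D B \<in> borels D" "\<alpha> \<in> roots D" "even_root D \<alpha>"
  shows "\<alpha> \<in> nat_span B \<longleftrightarrow> \<alpha> \<in> nat_span (range (rt D))"
proof -
  have sub: "\<beta> \<in> nat_span B" if "\<beta> \<in> roots D" "even_root D \<beta>" "\<beta> \<in> nat_span (range (rt D))" for \<beta>
  proof -
    have "root_space D \<beta> \<subseteq> borel_of D (range (rt D)) \<inter> gpart D 0"
      using that A.borel_generators(2) unfolding even_root_def by blast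
    then have "\<beta> \<in> pos_roots D (borel_of D B)"
      using assms(2) that(1) unfolding borels_def pos_roots_def by blast
    then show ?thesis unfolding A.pos_roots_borel by blast
  qed
  show ?thesis
    using sub[of \<alpha>] sub[of "- \<alpha>"] assms A.uminus_root A.even_root_uminus
      base_pos_iff[OF assms(1,3)] base_pos_iff[OF base_standard[OF D] assms(3)] by blast
qed

lemma borels_base:
  assumes "b \<in> borels D"
  obtains B where "base D B" "b = borel_of D B"
  using assms unfolding borels_def by blast

text \<open>
  All Borel subalgebras under consideration have the same even part, so a root on which two positive
  systems disagree is odd.
\<close>

lemma disagree_odd:
  assumes "base D B" "borel_of D B \<in> borels D" "base D B'" "borel_of D B' \<in> borels D"
    and "\<alpha> \<in> roots D" "\<alpha> \<in> nat_span B" "\<alpha> \<notin> nat_span B'"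
  shows "\<not> even_root D \<alpha>" "\<alpha> \<notin> doubles (roots D)"
proof -
  show odd: "\<not> even_root D \<alpha>"
    using borels_even[OF assms(1,2,5)] borels_even[OF assms(3,4,5)] assms(6,7) by blast
  show "\<alpha> \<notin> doubles (roots D)"
    using A.even_root_double odd assms(5) unfolding doubles_def by blast
qed

text \<open>If \<alpha> had a root as its double, this double would be positive for both bases,
  since positive systems never disagree on doubles. But \<open>- \<alpha>\<close> is positive for
  \<open>B'\<close>, and so would be the negative of the double.\<close>

lemma disagree_isotropic:
  assumes "base D B" "borel_of D B \<in> borels D" "base D B'" "borel_of D B' \<in> borels D"
    and "\<alpha> \<in> B" "\<alpha> \<notin> nat_span B'"
  shows "isotropic D B \<alpha>"
proof -
  have \<alpha>: "\<alpha> \<in> roots D" using base_roots[OF D assms(1)] assms(5) by blast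
  obtain x where x: "B = range (x :: 'i \<Rightarrow> complex^'h)" using base_family[OF assms(1)] .
  have pos: "\<alpha> \<in> nat_span B" using simple_in_nat_span assms(1,5) unfolding x by blast
  have "2 *s \<alpha> \<notin> roots D"
  proof
    assume r: "2 *s \<alpha> \<in> roots D"
    have "2 *s \<alpha> \<in> nat_span B'"
      using disagree_odd(2)[OF assms(1-4) r double_nat_span[OF pos]] \<alpha> unfolding doubles_def by blast
    moreover have "- \<alpha> \<in> nat_span B'" using base_pos_iff[OF assms(3) \<alpha>] assms(6) by blast
    then have "- (2 *s \<alpha>) \<in> nat_span B'" using double_nat_span[of "- \<alpha>" B'] by simp
    ultimately show False using base_pos_iff[OF assms(3) r] by blast
  qed
  then show ?thesis
    using disagree_odd(1)[OF assms(1-4) \<alpha> pos assms(6)] isotropic_iff[OF D assms(1,5)] by blast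
qed

text \<open>The only positive root lost is \<open>x i\<close>, which is odd, so the even part is
  kept.\<close>

lemma refl_borel:
  assumes x: "base D (range x)" "borel_of D (range x) \<in> borels D"
    and y: "base D (range (refl_at D i x))" and iso: "isotropic D (range x) (x i)"
  shows "borel_of D (range (refl_at D i x)) \<in> borels D"
proof -
  have "\<not> even_root D (x i)" using iso isotropic_iff[OF D x(1)] by blast
  then have "borel_of D (range x) \<inter> gpart D 0 \<subseteq> borel_of D (range (refl_at D i x))"
    using pos_refl[OF x(1) y iso] by (intro A.borel_even_subset) blast
  then show ?thesis using x(2) y unfolding borels_def by blast
qed

lemma borel_of_cong:
  "roots D \<inter> nat_span B = roots D \<inter> nat_span B' \<Longrightarrow> borel_of D B = borel_of D B'"
  unfolding borel_of_def by simp

text \<open>Each positive system contains exactly one of two opposite roots, so an inclusion is an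
  equality.\<close>

lemma pos_roots_subset_eq:
  assumes "base D B" "base D B'" "roots D \<inter> nat_span B \<subseteq> nat_span B'"
  shows "roots D \<inter> nat_span B = roots D \<inter> nat_span B'"
proof -
  have "\<alpha> \<in> nat_span B" if "\<alpha> \<in> roots D" "\<alpha> \<in> nat_span B'" for \<alpha>
    using that assms(3) base_pos_iff[OF assms(1)] base_pos_iff[OF assms(2)] A.uminus_root by blast
  then show ?thesis using assms(3) by blast
qed

lemma nat_span_mono:
  assumes "base D B" "base D B'" "B \<subseteq> nat_span B'"
  shows "nat_span B \<subseteq> nat_span B'"
proof
  obtain x y where x: "B = range (x :: 'i \<Rightarrow> complex^'h)" and y: "B' = range (y :: 'i \<Rightarrow> complex^'h)"
    using base_family assms(1,2) by metis
  note bx = assms(1)[unfolded x] and by' = assms(2)[unfolded y]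
  have "\<forall>j. \<exists>c. x j = root_map y c \<and> (\<forall>k. 0 \<le> c $ k)"
    using assms(3) unfolding x y image_subset_iff base_nat_span[OF by'] by blast
  then obtain c where c: "\<And>j. x j = root_map y (c j)" "\<And>j k. 0 \<le> c j $ k" by metis
  fix \<alpha> assume "\<alpha> \<in> nat_span B"
  then obtain d where d: "\<alpha> = root_map x d" "\<forall>j. 0 \<le> d $ j" unfolding x base_nat_span[OF bx] by blast
  have "\<alpha> = root_map y (\<Sum>j\<in>UNIV. (d $ j) *s c j)" using root_map_change[of x y c d] c(1) d(1) by simp
  moreover have "0 \<le> (\<Sum>j\<in>UNIV. (d $ j) *s c j) $ k" for k
    unfolding sum_component using d(2) c(2) by (auto intro: sum_nonneg)
  ultimately show "\<alpha> \<in> nat_span B'" unfolding y base_nat_span[OF by'] by blast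
qed

end

subsection \<open>The Cartan graph\<close>

lemma smap_eq: "smap G i x = shear (\<lambda>j. - cartan G x $ i $ j) i"
  unfolding smap_def shear_def
  by (intro ext sum.cong refl arg_cong[of _ _ "(*s) _"]) (simp add: vec_eq_iff)

lemma path_word_W_hom: "path_word G x y w \<Longrightarrow> W_hom G x y w"
  by (induction rule: path_word.induct) (rule W_hom.intros; assumption)+

lemma W_hom_real_roots:
  assumes "path_word G x y w" "v \<in> real_roots G x"
  shows "w v \<in> real_roots G y"
proof -
  obtain u z i where u: "v = u (sroot i)" "z \<in> verts G" "W_hom G z x u"
    using assms(2) unfolding real_roots_def by blast
  have "W_hom G z y (w \<circ> u)"
    using assms(1) u(3)
  proof (induction rule: path_word.induct)
    case (2 x y w i)
    from W_hom.intros(2)[OF 2(3)[OF 2(4)], of i] show ?case unfolding comp_assoc .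
  qed simp
  then show ?thesis unfolding real_roots_def u(1) using u(2) by (intro CollectI exI[of _ "w \<circ> u"]) auto
qed

lemma path_word_comp:
  assumes "path_word G y z w'" "path_word G x y w"
  shows "path_word G x z (w' \<circ> w)"
  using assms
proof (induction rule: path_word.induct)
  case (2 y z w' i)
  from path_word.intros(2)[OF 2(3)[OF 2(4)] 2(2)] show ?case unfolding comp_assoc .
qed simp

locale cartan_graph_of =
  fixes D :: "('i::finite, 'h::finite) km_datum"
    and G :: "('i \<Rightarrow> complex^'h, 'i \<times> ('i \<Rightarrow> complex^'h) set, 'i) cgraph"
    and x0 :: "'i \<Rightarrow> complex^'h" and M :: "('i \<Rightarrow> complex^'h) \<Rightarrow> int^'i^'i"
  assumes D: "realization D" and x0: "ordered_root_basis D x0" and G: "G = E_graph D x0 M"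
    and cartan: "cartan_graph G" and finite_G: "finite_cgraph G" and connected_G: "connected_graph G"
    and bij: "\<And>x. x \<in> verts G \<Longrightarrow> bij_betw (root_map x) (pos_real_roots G x)
      (roots D \<inter> nat_span (range x) - doubles (roots D \<inter> nat_span (range x)))"
begin

interpretation A: km_alg D by unfold_locales (rule D)

abbreviation "istr x i \<equiv> isotropic D (range x) (x i)"
abbreviation "rf i x \<equiv> refl_at D i x"
abbreviation "bor x \<equiv> borel_of D (range x)"

section \<open>Vertices and edges\<close>

lemma semi: "semi_cartan_graph G"
  using cartan by (simp add: cartan_graph_def)

lemma graph_simps: "verts G = {x. odd_reachable D x0 x}" "ends G = snd" "col G = fst"
  by (simp_all add: G E_graph_def)

lemma x0_vertex: "x0 \<in> verts G"
  by (simp add: graph_simps odd_reachable.intros)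

lemma edges_G: "edges G = {(i, {x, rf i x}) | i x. x \<in> verts G \<and> istr x i} \<union>
    {(i, {x}) | i x. x \<in> verts G \<and> \<not> istr x i}"
  by (simp add: G E_graph_def)

lemma iso_edge: "x \<in> verts G \<Longrightarrow> istr x i \<Longrightarrow> (i, {x, rf i x}) \<in> edges G"
  unfolding edges_G by blast

lemma loop_edge: "x \<in> verts G \<Longrightarrow> \<not> istr x i \<Longrightarrow> (i, {x}) \<in> edges G"
  unfolding edges_G by blast

lemma rf_vertex: "x \<in> verts G \<Longrightarrow> istr x i \<Longrightarrow> rf i x \<in> verts G"
  unfolding graph_simps by (auto intro: odd_reachable.intros)

lemma edge_unique:
  assumes "x \<in> verts G" "(i, E) \<in> edges G" "(i, E') \<in> edges G" "x \<in> E" "x \<in> E'"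
  shows "E = E'"
proof -
  have "\<exists>!e. e \<in> edges G \<and> x \<in> ends G e \<and> col G e = i"
    using semi assms(1) unfolding semi_cartan_graph_def by blast
  then show ?thesis using assms(2-) unfolding graph_simps by fastforce
qed

lemma base_x0: "base D (range x0)" "bor x0 \<in> borels D"
proof -
  obtain b where b: "b \<in> borels D" "range x0 = simple_roots D b"
    using x0 unfolding ordered_root_basis_def by blast
  obtain B where B: "base D B" "b = borel_of D B" using borels_base[OF D b(1)] .
  then have "range x0 = B" using b(2) simple_roots_borel[OF D B(1)] by simp
  then show "base D (range x0)" "bor x0 \<in> borels D" using B b by auto
qed

lemma rf_neq: "base D (range x) \<Longrightarrow> rf i x \<noteq> x"
proof
  assume x: "base D (range x)" and "rf i x = x"
  then have "- x i = x i" using refl_at_i[of D i x] by metis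
  moreover have "x i \<noteq> 0" using base_roots[OF D x] root_nonzero[OF D, of "x i"] by blast
  ultimately show False by (auto simp: vec_eq_iff complex_eq_iff)
qed

text \<open>
  That an odd reflection of a vertex is again a base is forced by the axioms of a semi Cartan
  graph: otherwise the new vertex would carry a loop of the same color.
\<close>

lemma vertex_base: "x \<in> verts G \<Longrightarrow> base D (range x) \<and> bor x \<in> borels D"
  unfolding graph_simps(1) mem_Collect_eq
proof (induction rule: odd_reachable.induct)
  case 1
  show ?case using base_x0 by blast
next
  case (2 x i)
  have x: "x \<in> verts G" using 2(1) by (simp add: graph_simps)
  have "istr (rf i x) i"
  proof (rule ccontr)
    assume "\<not> istr (rf i x) i"
    from edge_unique[OF rf_vertex[OF x 2(2)] iso_edge[OF x 2(2)] loop_edge[OF rf_vertex[OF x 2(2)] this]]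
    have "{x, rf i x} = {rf i x}" by simp
    then have "x = rf i x" by blast
    then show False using rf_neq 2(3) by metis
  qed
  then have "base D (range (rf i x))" using isotropic_base[OF D, of "range (rf i x)"] by blast
  then show ?case using refl_borel[OF D] 2 by blast
qed

text \<open>The reflected vertex has exactly one edge of color \<open>i\<close>, namely the one back
  to \<open>x\<close>; a reflection there must use it.\<close>

lemma iso_rf: assumes "x \<in> verts G" "istr x i" shows "istr (rf i x) i" "rf i (rf i x) = x"
proof -
  note y = rf_vertex[OF assms]
  show iso: "istr (rf i x) i"
  proof (rule ccontr)
    assume "\<not> istr (rf i x) i"
    from edge_unique[OF y iso_edge[OF assms] loop_edge[OF y this]]
    have "{x, rf i x} = {rf i x}" by simp
    then have "x = rf i x" by blast
    then show False using rf_neq vertex_base[OF assms(1)] by metis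
  qed
  have "{x, rf i x} = {rf i x, rf i (rf i x)}"
    by (rule edge_unique[OF y iso_edge[OF assms] iso_edge[OF y iso]]) auto
  then show "rf i (rf i x) = x" using rf_neq vertex_base[OF y] by (metis doubleton_eq_iff)
qed

lemma nbr_eq: assumes "x \<in> verts G" shows "nbr G i x = (if istr x i then rf i x else x)"
  unfolding nbr_def
proof (rule the_equality)
  show "\<exists>e\<in>edges G. col G e = i \<and> ends G e = {x, if istr x i then rf i x else x}"
    unfolding graph_simps
    by (rule bexI[of _ "(i, {x, if istr x i then rf i x else x})"])
      (use iso_edge[OF assms, of i] loop_edge[OF assms, of i] in \<open>auto split: if_splits\<close>)
next
  fix y assume "\<exists>e\<in>edges G. col G e = i \<and> ends G e = {x, y}"
  then have e: "(i, {x, y}) \<in> edges G" unfolding graph_simps by force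
  show "y = (if istr x i then rf i x else x)"
  proof (cases "istr x i")
    case True
    from edge_unique[OF assms e iso_edge[OF assms True]] show ?thesis using True by (auto simp: doubleton_eq_iff)
  next
    case False
    from edge_unique[OF assms e loop_edge[OF assms False]] show ?thesis using False by auto
  qed
qed

lemma nbr_neq_iff: "x \<in> verts G \<Longrightarrow> nbr G i x \<noteq> x \<longleftrightarrow> istr x i"
  using nbr_eq rf_neq vertex_base by auto

lemma gcm: "x \<in> verts G \<Longrightarrow> generalized_cartan_matrix (cartan G x)"
  using semi unfolding semi_cartan_graph_def by blast

lemma cartan_row:
  assumes "x \<in> verts G" "istr x i"
  shows "cartan G (rf i x) $ i = cartan G x $ i"
proof -
  have "\<forall>e\<in>edges G. \<forall>x y. ends G e = {x, y} \<longrightarrow> cartan G x $ col G e = cartan G y $ col G e"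
    using semi unfolding semi_cartan_graph_def by blast
  from bspec[OF this iso_edge[OF assms]] show ?thesis unfolding graph_simps by simp
qed

lemma real_roots_sign: "x \<in> verts G \<Longrightarrow> real_roots G x = pos_real_roots G x \<union> uminus ` pos_real_roots G x"
  using cartan unfolding cartan_graph_def by blast

lemma sroot_real: "x \<in> verts G \<Longrightarrow> sroot i \<in> real_roots G x"
  unfolding real_roots_def using W_hom.intros(1)[of x G] by (intro CollectI exI[of _ id] exI[of _ x]) auto

lemma path_word_step:
  assumes "x \<in> verts G" "istr x i"
  shows "path_word G x (rf i x) (smap G i x)"
proof -
  have n: "nbr G i x = rf i x" "nbr G i x \<noteq> x"
    using nbr_eq[OF assms(1), of i] nbr_neq_iff[OF assms(1), of i] assms(2) by presburger+
  show ?thesis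
    using path_word.intros(2)[OF path_word.intros(1)[OF assms(1)] n(2)] unfolding n(1) by simp
qed

lemma smap_real:
  assumes "x \<in> verts G" "istr x i" "v \<in> real_roots G x"
  shows "smap G i x v \<in> real_roots G (rf i x)"
  by (rule W_hom_real_roots[OF path_word_step[OF assms(1,2)] assms(3)])

lemma real_root_signs:
  assumes "x \<in> verts G" "v \<in> real_roots G x"
  shows "(\<forall>k. 0 \<le> v $ k) \<or> (\<forall>k. v $ k \<le> 0)"
proof -
  have "v \<in> pos_real_roots G x \<union> uminus ` pos_real_roots G x"
    using assms real_roots_sign by blast
  then show ?thesis by (auto simp: pos_real_roots_def)
qed

text \<open>
  With \<open>m = - a\<^sub>i\<^sub>j\<close>, the vector \<open>\<alpha>\<^sub>j + m \<alpha>\<^sub>i\<close> is a real root. Since the corresponding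
  root has coordinates of one sign in the reflected base, \<open>m\<close> is at most 1, and 0 unless
  \<open>x\<^sub>i + x\<^sub>j\<close> is a root. Conversely, if \<open>\<alpha>\<^sub>i + \<alpha>\<^sub>j\<close> is a real root, so is its image
  \<open>\<alpha>\<^sub>j + (m - 1) \<alpha>\<^sub>i\<close>, whence \<open>m\<close> is at least 1.
\<close>

lemma cartan_eq:
  assumes x: "x \<in> verts G" and i: "istr x i"
  shows "- cartan G x $ i $ j = coef D x i j"
proof (cases "j = i")
  case True
  then show ?thesis using gcm[OF x] unfolding generalized_cartan_matrix_def coef_def by simp
next
  case False
  let ?y = "rf i x"
  have bx: "base D (range x)" using vertex_base[OF x] by blast
  have y: "?y \<in> verts G" by (rule rf_vertex[OF x i])
  have by': "base D (range ?y)" using vertex_base[OF y] by blast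
  define m where "m = - cartan G x $ i $ j"
  have m0: "0 \<le> m" using gcm[OF x] False unfolding generalized_cartan_matrix_def m_def by simp
  have "smap G i ?y (sroot j) \<in> real_roots G x"
    using smap_real[OF y iso_rf(1)[OF x i] sroot_real[OF y]] iso_rf(2)[OF x i] by simp
  moreover have "smap G i ?y (sroot j) = sroot j + m *s sroot i"
    unfolding smap_eq shear_sroot m_def cartan_row[OF x i] by (simp add: vec_eq_iff)
  ultimately have v: "sroot j + m *s sroot i \<in> real_roots G x" by simp
  have "sroot j + m *s sroot i \<in> pos_real_roots G x"
    using v m0 unfolding pos_real_roots_def by (auto simp: axis_def)
  then have r: "root_map x (sroot j + m *s sroot i) \<in> roots D"
    using bij[OF x] by (auto simp: bij_betw_def)
  let ?c = "coef D x i"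
  \<comment> \<open>The coordinates of the root in the reflected base: 1 at j, and
    \<open>?c j - m\<close> at i. The former makes the root positive, and the latter is then
    nonnegative.\<close>
  let ?T = "shear ?c i (sroot j + m *s sroot i)"
  have ry: "root_map ?y ?T \<in> roots D"
    using r refl_root_map[OF base_inj[OF D bx], of D i "sroot j + m *s sroot i"] by simp
  have T: "?T = sroot j + (?c j - m) *s sroot i"
    unfolding shear_add shear_sroot shear_scale_sroot by (simp add: coef_def vec_eq_iff algebra_simps)
  have pos: "root_map ?y ?T \<in> nat_span (range ?y)"
  proof (rule ccontr)
    assume "\<not> ?thesis"
    then have "- root_map ?y ?T \<in> nat_span (range ?y)" using base_sign[OF D by' ry] by blast
    then obtain d where d: "root_map ?y (- ?T) = root_map ?y d" "\<forall>k. 0 \<le> d $ k"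
      unfolding base_nat_span[OF D by'] root_map_uminus by metis
    then have "- ?T = d" using base_root_map_inj[OF D by'] by blast
    then have "0 \<le> (- ?T) $ j" using d(2) by simp
    then show False unfolding T using False by (simp add: axis_def)
  qed
  then obtain d where d: "root_map ?y ?T = root_map ?y d" "\<forall>k. 0 \<le> d $ k"
    unfolding base_nat_span[OF D by'] by metis
  then have "?T = d" using base_root_map_inj[OF D by'] by blast
  then have "0 \<le> ?T $ i" using d(2) by simp
  then have le: "m \<le> ?c j" unfolding T using False by (simp add: axis_def)
  have "?c j \<le> m"
  proof (cases "x i + x j \<in> roots D")
    case True
    have eq: "root_map x (sroot i + sroot j) = x i + x j" by (simp add: root_map_add)
    have p: "x i + x j \<in> nat_span (range x)"
      unfolding base_nat_span[OF D bx] eq[symmetric]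
      by (intro exI[of _ "sroot i + sroot j"]) (simp add: axis_def)
    \<comment> \<open>Needed because only roots that are not doubles correspond to real roots; here
      the coordinate at j is 1, which is odd.\<close>
    have "x i + x j \<notin> doubles (roots D \<inter> nat_span (range x))"
    proof
      assume "x i + x j \<in> doubles (roots D \<inter> nat_span (range x))"
      then obtain \<gamma> where g: "\<gamma> \<in> nat_span (range x)" "x i + x j = 2 *s \<gamma>" unfolding doubles_def by blast
      then obtain d where "\<gamma> = root_map x d" unfolding base_nat_span[OF D bx] by blast
      then have "root_map x (sroot i + sroot j) = root_map x (2 *s d)"
        using g(2) unfolding eq root_map_scale by simp
      then have "sroot i + sroot j = 2 *s d" using base_root_map_inj[OF D bx] by blast
      from arg_cong[OF this, of "\<lambda>v. v $ j"] have "1 = 2 * d $ j" using False by (simp add: axis_def)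
      then show False by presburger
    qed
    then obtain v where "v \<in> pos_real_roots G x" "x i + x j = root_map x v"
      using bij[OF x] True p unfolding bij_betw_def by blast
    then have "sroot i + sroot j \<in> real_roots G x"
      using base_root_map_inj[OF D bx] unfolding eq[symmetric] pos_real_roots_def by auto
    from smap_real[OF x i this]
    have "sroot j + (m - 1) *s sroot i \<in> real_roots G ?y"
    proof -
      have "smap G i x (sroot i + sroot j) = sroot j + (m - 1) *s sroot i"
        using gcm[OF x] unfolding smap_eq shear_add shear_sroot generalized_cartan_matrix_def m_def
        by (simp add: vec_eq_iff algebra_simps)
      then show ?thesis using smap_real[OF x i \<open>sroot i + sroot j \<in> real_roots G x\<close>] by simp
    qed
    moreover have "0 < (sroot j + (m - 1) *s sroot i) $ j" using False by (simp add: axis_def)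
    ultimately have "0 \<le> (sroot j + (m - 1) *s sroot i) $ i"
      using real_root_signs[OF y] by (metis not_le)
    then show ?thesis using False True by (simp add: axis_def coef_def)
  next
    case no: False
    then show ?thesis using m0 False by (simp add: coef_def)
  qed
  then show ?thesis using le m_def by simp
qed

section \<open>The path subgroupoid as change of coordinates\<close>

lemma smap_root_map:
  assumes "x \<in> verts G" "istr x i"
  shows "root_map (rf i x) (smap G i x v) = root_map x v"
proof -
  have "smap G i x = shear (coef D x i) i" unfolding smap_eq using cartan_eq[OF assms] by presburger
  then show ?thesis using refl_root_map[OF base_inj[OF D]] vertex_base[OF assms(1)] by simp
qed

lemma smap_smap:
  assumes "x \<in> verts G" "istr x i"
  shows "smap G i (rf i x) (smap G i x v) = v"
proof -
  have "root_map x (smap G i (rf i x) (smap G i x v)) = root_map x v"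
    using smap_root_map[OF rf_vertex[OF assms] iso_rf(1)[OF assms]] smap_root_map[OF assms] iso_rf(2)[OF assms]
    by simp
  then show ?thesis using base_root_map_inj[OF D] vertex_base[OF assms(1)] by blast
qed

lemma path_word_root_map:
  "path_word G x y w \<Longrightarrow> x \<in> verts G \<and> y \<in> verts G \<and> surj w \<and> (\<forall>v. root_map y (w v) = root_map x v)"
proof (induction rule: path_word.induct)
  case (2 x y w i)
  then have y: "y \<in> verts G" "istr y i" using nbr_neq_iff by auto
  then have n: "nbr G i y = rf i y" using nbr_eq by simp
  have "surj (smap G i y)"
    using smap_smap[OF rf_vertex[OF y] iso_rf(1)[OF y]] iso_rf(2)[OF y] by (metis surjI)
  then have "surj (smap G i y \<circ> w)" using 2(3) comp_surj by blast
  then show ?case using 2(3) rf_vertex[OF y] smap_root_map[OF y] n by simp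
qed auto

text \<open>Surjectivity belongs to the invariant because \<open>inv w\<close> is a right inverse
  only of a surjective map. Injectivity comes from the coordinates.\<close>

lemma P_hom_root_map:
  "P_hom G x y w \<Longrightarrow> x \<in> verts G \<and> y \<in> verts G \<and> surj w \<and> (\<forall>v. root_map y (w v) = root_map x v)"
proof (induction rule: P_hom.induct)
  case (1 x y w)
  then show ?case by (rule path_word_root_map)
next
  case (2 x y w z w')
  then have "surj (w' \<circ> w)" using comp_surj by blast
  then show ?case using 2 by simp
next
  case (3 x y w)
  have bx: "base D (range x)" and by': "base D (range y)" using 3 vertex_base by auto
  have "inj w" using 3 base_root_map_inj[OF D bx] by (metis injI)
  moreover have "root_map x (inv w v) = root_map y v" for v
    using 3(2) by (metis surj_f_inv_f)
  ultimately show ?case using 3 inj_imp_surj_inv by blast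
qed

lemma P_hom_unique: "P_hom G x y w \<Longrightarrow> P_hom G x y w' \<Longrightarrow> w = w'"
  using P_hom_root_map base_root_map_inj[OF D] vertex_base by (metis ext)

text \<open>Reachability is generated from \<open>x0\<close>, so words in both directions between
  \<open>x0\<close> and each vertex are built and then composed.\<close>

lemma path_word_exists:
  assumes "x \<in> verts G" "y \<in> verts G"
  shows "\<exists>w. path_word G x y w"
proof -
  have "(\<exists>w. path_word G x0 z w) \<and> (\<exists>w. path_word G z x0 w)" if "z \<in> verts G" for z
    using that unfolding graph_simps(1) mem_Collect_eq
  proof (induction rule: odd_reachable.induct)
    case 1
    show ?case using path_word.intros(1)[OF x0_vertex] by blast
  next
    case (2 z i)
    then have z: "z \<in> verts G" by (simp add: graph_simps)
    have "path_word G z (rf i z) (smap G i z)" by (rule path_word_step[OF z 2(2)])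
    moreover have "path_word G (rf i z) z (smap G i (rf i z))"
      using path_word_step[OF rf_vertex[OF z 2(2)] iso_rf(1)[OF z 2(2)]] iso_rf(2)[OF z 2(2)] by simp
    ultimately show ?case using 2(3) path_word_comp[of G z "rf i z" _ x0] path_word_comp[of G z x0 _ "rf i z"]
      by meson
  qed
  then obtain u v where "path_word G x x0 u" "path_word G x0 y v" using assms by blast
  then have "path_word G x y (v \<circ> u)" by (rule path_word_comp[rotated])
  then show ?thesis by (rule exI[of "path_word G x y"])
qed

lemma path_simply_connected: "path_simply_connected G"
  unfolding path_simply_connected_def
proof (intro conjI ballI)
  fix x y assume "x \<in> verts G" "y \<in> verts G"
  then obtain w where "path_word G x y w" using path_word_exists by blast
  then show "\<exists>!w. P_hom G x y w" by (intro ex1I[of _ w] P_hom.intros(1)) (auto intro: P_hom_unique P_hom.intros(1))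
qed (rule semi connected_G)+

lemma P_hom_exists: "x \<in> verts G \<Longrightarrow> y \<in> verts G \<Longrightarrow> \<exists>w. path_word G x y w \<and> P_hom G x y w"
  using path_word_exists[of x y] P_hom.intros(1)[of G x y] by auto

subsection \<open>Orbits of real roots\<close>

text \<open>The common image of the real roots at all vertices under their coordinate maps.\<close>

definition nondouble :: "(complex^'h) set" where
  "nondouble = roots D - doubles (roots D)"

text \<open>The bijections given with the Cartan graph remove doubles of positive roots only.
  Nothing else is removed here, since a root with a positive double is positive.\<close>

lemma nondouble_pos:
  assumes "base D B"
  shows "nondouble \<inter> nat_span B = roots D \<inter> nat_span B - doubles (roots D \<inter> nat_span B)"
proof -
  have "\<gamma> \<in> nat_span B" if "\<gamma> \<in> roots D" "2 *s \<gamma> \<in> roots D" "2 *s \<gamma> \<in> nat_span B" for \<gamma>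
  proof (rule ccontr)
    assume "\<gamma> \<notin> nat_span B"
    then have "- \<gamma> \<in> nat_span B" using base_pos_iff[OF D assms that(1)] by blast
    then have "- (2 *s \<gamma>) \<in> nat_span B" using double_nat_span[of "- \<gamma>" B] by simp
    then show False using base_pos_iff[OF D assms that(2)] that(3) by blast
  qed
  then show ?thesis unfolding nondouble_def doubles_def by auto
qed

lemma nondouble_uminus: "\<alpha> \<in> nondouble \<Longrightarrow> - \<alpha> \<in> nondouble"
proof -
  assume a: "\<alpha> \<in> nondouble"
  have "- \<alpha> \<notin> doubles (roots D)"
  proof
    assume "- \<alpha> \<in> doubles (roots D)"
    then obtain \<gamma> where "\<gamma> \<in> roots D" "- \<alpha> = 2 *s \<gamma>" unfolding doubles_def by blast
    then have "- \<gamma> \<in> roots D" "\<alpha> = 2 *s (- \<gamma>)" using A.uminus_root by (auto simp: minus_equation_iff[of \<alpha>])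
    then show False using a unfolding nondouble_def doubles_def by blast
  qed
  then show ?thesis using a A.uminus_root unfolding nondouble_def by blast
qed

lemma root_map_pos: "x \<in> verts G \<Longrightarrow> root_map x ` pos_real_roots G x = nondouble \<inter> nat_span (range x)"
  using bij nondouble_pos vertex_base by (simp add: bij_betw_def)

lemma root_map_real:
  assumes "x \<in> verts G"
  shows "root_map x ` real_roots G x = nondouble"
proof -
  have b: "base D (range x)" using vertex_base[OF assms] by blast
  have "root_map x ` real_roots G x =
      (nondouble \<inter> nat_span (range x)) \<union> uminus ` (nondouble \<inter> nat_span (range x))"
    unfolding real_roots_sign[OF assms] image_Un root_map_pos[OF assms, symmetric]
    by (simp add: image_image root_map_uminus)
  also have "\<dots> = nondouble"
  proof (intro equalityI subsetI)
    fix \<alpha> assume a: "\<alpha> \<in> nondouble"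
    show "\<alpha> \<in> nondouble \<inter> nat_span (range x) \<union> uminus ` (nondouble \<inter> nat_span (range x))"
    proof (cases "\<alpha> \<in> nat_span (range x)")
      case False
      then have "- \<alpha> \<in> nondouble \<inter> nat_span (range x)"
        using a nondouble_uminus base_pos_iff[OF D b] unfolding nondouble_def by blast
      then have "- (- \<alpha>) \<in> uminus ` (nondouble \<inter> nat_span (range x))" by (rule imageI)
      then show ?thesis by simp
    qed (use a in blast)
  qed (use nondouble_uminus in auto)
  finally show ?thesis .
qed

lemma finite_nondouble: "finite nondouble"
proof -
  show ?thesis using root_map_real[OF x0_vertex] x0_vertex finite_G unfolding finite_cgraph_def by (metis finite_imageI)
qed

lemma orb_eq:
  assumes "x \<in> verts G" "\<alpha> \<in> real_roots G x"
  shows "orb G x \<alpha> = {(y, v). y \<in> verts G \<and> root_map y v = root_map x \<alpha>}"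
proof (intro equalityI subsetI)
  fix p assume "p \<in> orb G x \<alpha>"
  then show "p \<in> {(y, v). y \<in> verts G \<and> root_map y v = root_map x \<alpha>}"
    unfolding orb_def using P_hom_root_map by blast
next
  fix p assume "p \<in> {(y, v). y \<in> verts G \<and> root_map y v = root_map x \<alpha>}"
  then obtain y v where p: "p = (y, v)" "y \<in> verts G" "root_map y v = root_map x \<alpha>" by blast
  obtain w where w: "P_hom G x y w" using P_hom_exists assms(1) p(2) by blast
  then have "root_map y v = root_map y (w \<alpha>)" using P_hom_root_map p(3) by metis
  then have "v = w \<alpha>" using base_root_map_inj[OF D] vertex_base[OF p(2)] by blast
  then show "p \<in> orb G x \<alpha>" unfolding orb_def p(1) using p(2) w by blast
qed

definition orbit_of :: "complex^'h \<Rightarrow> (('i \<Rightarrow> complex^'h) \<times> (int^'i)) set" where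
  "orbit_of \<beta> = {(y, v). y \<in> verts G \<and> root_map y v = \<beta>}"

lemma orbit_set_eq: "orbit_set G = orbit_of ` nondouble"
proof (intro equalityI subsetI)
  fix Ob assume "Ob \<in> orbit_set G"
  then show "Ob \<in> orbit_of ` nondouble"
    unfolding orbit_set_def orbit_of_def using orb_eq root_map_real by fastforce
next
  fix Ob assume "Ob \<in> orbit_of ` nondouble"
  then obtain \<beta> where b: "\<beta> \<in> nondouble" "Ob = orbit_of \<beta>" by blast
  have "\<beta> \<in> root_map x0 ` real_roots G x0" unfolding root_map_real[OF x0_vertex] by (rule b(1))
  then obtain \<alpha> where "\<alpha> \<in> real_roots G x0" "root_map x0 \<alpha> = \<beta>" by blast
  then show "Ob \<in> orbit_set G"
    unfolding orbit_set_def b(2) orbit_of_def using orb_eq[OF x0_vertex] x0_vertex by blast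
qed

lemma at_vertex:
  assumes "\<beta> \<in> nondouble" "x \<in> verts G"
  shows "root_map x (at_vertex (orbit_of \<beta>) x) = \<beta>" "at_vertex (orbit_of \<beta>) x \<in> real_roots G x"
proof -
  have "\<beta> \<in> root_map x ` real_roots G x" unfolding root_map_real[OF assms(2)] by (rule assms(1))
  then obtain v where v: "v \<in> real_roots G x" "root_map x v = \<beta>" by blast
  have "at_vertex (orbit_of \<beta>) x = v"
    unfolding at_vertex_def orbit_of_def
    using v(2) assms(2) base_root_map_inj[OF D] vertex_base[OF assms(2)] by (intro the_equality) auto
  then show "root_map x (at_vertex (orbit_of \<beta>) x) = \<beta>" "at_vertex (orbit_of \<beta>) x \<in> real_roots G x"
    using v by auto
qed

lemma inj_orbit_of: "inj_on orbit_of nondouble"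
proof (rule inj_onI)
  fix \<beta> \<gamma> assume *: "\<beta> \<in> nondouble" "\<gamma> \<in> nondouble" "orbit_of \<beta> = orbit_of \<gamma>"
  show "\<beta> = \<gamma>" using at_vertex(1)[OF _ x0_vertex] * by metis
qed

lemma at_vertex_simple:
  assumes "\<beta> \<in> nondouble" "x \<in> verts G"
  shows "at_vertex (orbit_of \<beta>) x \<in> {sroot i, - sroot i} \<longleftrightarrow> \<beta> \<in> {x i, - x i}"
proof -
  have b: "base D (range x)" using vertex_base[OF assms(2)] by blast
  let ?v = "at_vertex (orbit_of \<beta>) x"
  have "?v = sroot i \<longleftrightarrow> \<beta> = x i" "?v = - sroot i \<longleftrightarrow> \<beta> = - x i"
    using at_vertex(1)[OF assms] base_root_map_inj[OF D b, of ?v "sroot i"]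
      base_root_map_inj[OF D b, of ?v "- sroot i"]
    by (auto simp: root_map_uminus)
  then show ?thesis by blast
qed

lemma orbit_bijection:
  "\<exists>\<phi>. bij_betw \<phi> (orbit_set G) (roots D - doubles (roots D)) \<and>
     (\<forall>x\<in>verts G. \<forall>Ob\<in>orbit_set G. \<phi> Ob = root_map x (at_vertex Ob x))"
proof (intro exI[of _ "inv_into nondouble orbit_of"] conjI ballI)
  show "bij_betw (inv_into nondouble orbit_of) (orbit_set G) (roots D - doubles (roots D))"
    unfolding orbit_set_eq nondouble_def[symmetric]
    by (rule bij_betw_inv_into) (simp add: bij_betw_def inj_orbit_of)
  fix x Ob assume *: "x \<in> verts G" "Ob \<in> orbit_set G"
  then obtain \<beta> where "\<beta> \<in> nondouble" "Ob = orbit_of \<beta>" unfolding orbit_set_eq by blast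
  then show "inv_into nondouble orbit_of Ob = root_map x (at_vertex Ob x)"
    using at_vertex(1) * inj_orbit_of by simp
qed

lemma pos_orbits_eq:
  assumes "x \<in> verts G"
  shows "pos_orbits G x = orbit_of ` (nondouble \<inter> nat_span (range x))"
proof -
  have b: "base D (range x)" using vertex_base[OF assms] by blast
  have "at_vertex (orbit_of \<beta>) x \<in> pos_real_roots G x \<longleftrightarrow> \<beta> \<in> nat_span (range x)" if "\<beta> \<in> nondouble" for \<beta>
  proof
    assume "at_vertex (orbit_of \<beta>) x \<in> pos_real_roots G x"
    then have "root_map x (at_vertex (orbit_of \<beta>) x) \<in> root_map x ` pos_real_roots G x" by (rule imageI)
    then show "\<beta> \<in> nat_span (range x)" unfolding at_vertex(1)[OF that assms] root_map_pos[OF assms] by blast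
  next
    assume "\<beta> \<in> nat_span (range x)"
    then have "\<beta> \<in> root_map x ` pos_real_roots G x" using root_map_pos[OF assms] that by simp
    then obtain v where v: "v \<in> pos_real_roots G x" "\<beta> = root_map x v" by blast
    then have "v = at_vertex (orbit_of \<beta>) x"
      using at_vertex(1)[OF that assms] base_root_map_inj[OF D b] by metis
    then show "at_vertex (orbit_of \<beta>) x \<in> pos_real_roots G x" using v(1) by simp
  qed
  then show ?thesis unfolding pos_orbits_def orbit_set_eq by blast
qed

text \<open>Both vertices order the same base. The path morphism between them permutes the simple
  roots, so it sends them to positive roots, and the last axiom of Cartan graphs forces the vertices
  to be equal.\<close>

lemma bor_inj: assumes x: "x \<in> verts G" and y: "y \<in> verts G" and "bor x = bor y" shows "x = y"
proof -
  have b: "base D (range x)" "base D (range y)" using vertex_base[OF x] vertex_base[OF y] by blast+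
  have "range x = simple_roots D (bor x)" by (rule simple_roots_borel[OF D b(1), symmetric])
  also have "\<dots> = simple_roots D (bor y)" unfolding assms(3) ..
  also have "\<dots> = range y" by (rule simple_roots_borel[OF D b(2)])
  finally have r: "range x = range y" .
  obtain w where w: "path_word G x y w" using path_word_exists x y by blast
  have "w (sroot i) \<in> pos_real_roots G y" for i
  proof -
    obtain j where j: "x i = y j" using r by blast
    have "root_map y (w (sroot i)) = root_map y (sroot j)" using path_word_root_map[OF w] j by simp
    then have "w (sroot i) = sroot j" using base_root_map_inj[OF D b(2)] by blast
    then show ?thesis using sroot_real[OF y, of j] unfolding pos_real_roots_def by (auto simp: axis_def)
  qed
  then show ?thesis
    using cartan x y path_word_W_hom[OF w] unfolding cartan_graph_def by metis
qed

end

subsection \<open>Edge-colored graphs\<close>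

lemma is_walk_Cons:
  "is_walk G vs es \<Longrightarrow> v \<in> verts G \<Longrightarrow> e \<in> edges G \<Longrightarrow> ends G e = {v, hd vs} \<Longrightarrow> is_walk G (v # vs) (e # es)"
  unfolding is_walk_def by (cases vs) (auto simp: nth_Cons split: nat.splits)

lemma is_walk_ConsE:
  assumes "is_walk G vs (e # es)"
  obtains v vs' where "vs = v # vs'" "is_walk G vs' es" "e \<in> edges G" "ends G e = {v, hd vs'}"
proof -
  from assms obtain v vs' where vs: "vs = v # vs'" "length vs' = Suc (length es)"
    unfolding is_walk_def by (cases vs) auto
  have e: "\<forall>i<Suc (length es). ends G ((e # es) ! i) = {(v # vs') ! i, vs' ! i}"
    using assms unfolding is_walk_def vs(1) by simp
  have "vs' \<noteq> []" using vs(2) by auto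
  then have "ends G e = {v, hd vs'}" using e[rule_format, of 0] by (simp add: hd_conv_nth)
  moreover have "ends G (es ! i) = {vs' ! i, vs' ! Suc i}" if "i < length es" for i
    using e[rule_format, of "Suc i"] that by simp
  ultimately show ?thesis using that[of v vs'] assms vs unfolding is_walk_def by auto
qed

lemma sym_diff_step:
  assumes "sym_diff A B = {c}"
  shows "sym_diff A C \<subseteq> insert c (sym_diff B C)"
    and "c \<notin> sym_diff B C \<Longrightarrow> sym_diff A C = insert c (sym_diff B C)"
    and "c \<in> sym_diff A C \<Longrightarrow> sym_diff A C = insert c (sym_diff B C) \<and> c \<notin> sym_diff B C"
proof -
  have m: "z \<in> A \<longleftrightarrow> (z \<in> B) \<noteq> (z = c)" for z using assms by blast
  show "sym_diff A C \<subseteq> insert c (sym_diff B C)" using m by auto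
  show "c \<notin> sym_diff B C \<Longrightarrow> sym_diff A C = insert c (sym_diff B C)" using m by auto
  show "c \<in> sym_diff A C \<Longrightarrow> sym_diff A C = insert c (sym_diff B C) \<and> c \<notin> sym_diff B C"
    using m by auto
qed

text \<open>Every edge toggles the membership of its color. So the sets at the two ends differ at
  most in colors that occur, and in all of these if none occurs twice.\<close>

lemma walk_sym_diff:
  assumes edge: "\<And>e u v. e \<in> edges G \<Longrightarrow> ends G e = {u, v} \<Longrightarrow> sym_diff (S u) (S v) = {col G e}"
  shows "is_walk G vs es \<Longrightarrow> sym_diff (S (hd vs)) (S (last vs)) \<subseteq> col G ` set es \<and>
    (distinct (map (col G) es) \<longrightarrow> sym_diff (S (hd vs)) (S (last vs)) = col G ` set es)"
proof (induction es arbitrary: vs)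
  case Nil
  then obtain v where "vs = [v]" unfolding is_walk_def by (cases vs) auto
  then show ?case by simp
next
  case (Cons e es)
  obtain v vs' where vs: "vs = v # vs'" "is_walk G vs' es" "e \<in> edges G" "ends G e = {v, hd vs'}"
    using is_walk_ConsE[OF Cons.prems] .
  have "vs' \<noteq> []" using vs(2) unfolding is_walk_def by auto
  then have l: "last vs = last vs'" "hd vs = v" using vs(1) by auto
  note step = sym_diff_step[OF edge[OF vs(3,4)], of "S (last vs')"] and IH = Cons.IH[OF vs(2)]
  have "sym_diff (S v) (S (last vs')) \<subseteq> col G ` set (e # es)" using step(1) IH by auto
  moreover have "sym_diff (S v) (S (last vs')) = col G ` set (e # es)" if "distinct (map (col G) (e # es))"
  proof -
    have eq: "sym_diff (S (hd vs')) (S (last vs')) = col G ` set es" and "col G e \<notin> col G ` set es"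
      using IH that by auto
    then show ?thesis using step(2) unfolding eq by simp
  qed
  ultimately show ?case unfolding l by blast
qed

text \<open>
  The sets \<open>S v\<close> embed the graph isometrically into a hypercube, each edge of color \<open>c\<close> changing
  the membership of \<open>c\<close> only.
\<close>

lemma rainbow_boomerangI:
  assumes G: "edge_colored_graph G" "properly_colored G"
    and edge: "\<And>e u v. e \<in> edges G \<Longrightarrow> ends G e = {u, v} \<Longrightarrow> sym_diff (S u) (S v) = {col G e}"
    and walk: "\<And>u v. u \<in> verts G \<Longrightarrow> v \<in> verts G \<Longrightarrow>
      \<exists>vs es. is_walk G vs es \<and> hd vs = u \<and> last vs = v \<and> length es = card (sym_diff (S u) (S v))"
  shows "rainbow_boomerang G"
  unfolding rainbow_boomerang_def
proof (intro conjI G allI impI)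
  have sd: "sym_diff (S (hd vs)) (S (last vs)) \<subseteq> col G ` set es \<and>
      (distinct (map (col G) es) \<longrightarrow> sym_diff (S (hd vs)) (S (last vs)) = col G ` set es)"
    if "is_walk G vs es" for vs es
    using edge that by (rule walk_sym_diff)
  have len: "card (sym_diff (S (hd vs)) (S (last vs))) \<le> length es" if "is_walk G vs es" for vs es
  proof -
    have "card (sym_diff (S (hd vs)) (S (last vs))) \<le> card (col G ` set es)"
      using sd[OF that] by (intro card_mono) auto
    also have "\<dots> \<le> card (set es)" by (rule card_image_le) simp
    also have "\<dots> \<le> length es" by (rule card_length)
    finally show ?thesis .
  qed
  fix vs es assume w: "is_walk G vs es"
  show "shortest_walk G vs es \<longleftrightarrow> rainbow_walk G vs es"
  proof
    assume sh: "shortest_walk G vs es"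
    have "vs \<noteq> []" "set vs \<subseteq> verts G" using w unfolding is_walk_def by auto
    then have "hd vs \<in> verts G" "last vs \<in> verts G" by auto
    from walk[OF this] have "length es \<le> card (sym_diff (S (hd vs)) (S (last vs)))"
      using sh unfolding shortest_walk_def by metis
    also have "\<dots> \<le> card (col G ` set es)" using sd[OF w] by (intro card_mono) auto
    finally have "length (map (col G) es) \<le> card (set (map (col G) es))" by simp
    then have "distinct (map (col G) es)" by (metis card_distinct card_length le_antisym)
    then show "rainbow_walk G vs es" using w by (simp add: rainbow_walk_def)
  next
    assume "rainbow_walk G vs es"
    then have d: "distinct (map (col G) es)" by (simp add: rainbow_walk_def)
    have "length es = card (set (map (col G) es))" using distinct_card[OF d] by simp
    then have "length es = card (sym_diff (S (hd vs)) (S (last vs)))" using sd[OF w] d by simp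
    then show "shortest_walk G vs es" unfolding shortest_walk_def using w len by metis
  qed
qed

text \<open>The inverse maps invert only on the vertices and colors of the graph; coloredness places
  the ends and colors of edges there. An isomorphism is easier to write from \<open>RB\<close>,
  where an edge goes to the image of its set of ends.\<close>

lemma ec_isomorphic_sym:
  assumes "edge_colored_graph G" "ec_isomorphic G G'"
  shows "ec_isomorphic G' G"
proof -
  obtain f g k where f: "bij_betw f (verts G) (verts G')" and g: "bij_betw g (edges G) (edges G')"
    and k: "bij_betw k (colors G) (colors G')"
    and c: "\<forall>e\<in>edges G. ends G' (g e) = f ` ends G e \<and> col G' (g e) = k (col G e)"
    using assms(2) unfolding ec_isomorphic_def by blast
  have "ends G (inv_into (edges G) g e') = inv_into (verts G) f ` ends G' e' \<and>
      col G (inv_into (edges G) g e') = inv_into (colors G) k (col G' e')" if "e' \<in> edges G'" for e'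
  proof -
    define e where "e = inv_into (edges G) g e'"
    have e: "e \<in> edges G" "g e = e'"
      using g that unfolding e_def bij_betw_def by (auto simp: inv_into_into f_inv_into_f)
    have "ends G e \<subseteq> verts G" "col G e \<in> colors G"
      using assms(1) e(1) unfolding edge_colored_graph_def by auto
    moreover have "inv_into (verts G) f ` f ` ends G e = ends G e"
      using f calculation(1) unfolding bij_betw_def by (auto simp: image_image subset_iff)
    moreover have "inv_into (colors G) k (k (col G e)) = col G e"
      using k calculation(2) unfolding bij_betw_def by (simp add: inv_into_f_f)
    ultimately show ?thesis unfolding e_def[symmetric] using c e by auto
  qed
  then show ?thesis
    unfolding ec_isomorphic_def using bij_betw_inv_into[OF f] bij_betw_inv_into[OF g] bij_betw_inv_into[OF k]
    by blast
qed

subsection \<open>The graph of Borel subalgebras\<close>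

context cartan_graph_of
begin

interpretation A: km_alg D by unfold_locales (rule D)

lemma pos_roots_bor: "pos_roots D (borel_of D B) = roots D \<inter> nat_span B"
  by (rule A.pos_roots_borel)

lemma pos_roots_uminus:
  assumes "b \<in> borels D" "\<alpha> \<in> roots D"
  shows "- \<alpha> \<in> pos_roots D b \<longleftrightarrow> \<alpha> \<notin> pos_roots D b"
proof -
  obtain B where B: "base D B" "b = borel_of D B" using borels_base[OF D assms(1)] .
  show ?thesis
    unfolding B(2) pos_roots_bor using base_pos_iff[OF D B(1) assms(2)] A.uminus_root assms(2) by blast
qed

lemma bor_borels: "x \<in> verts G \<Longrightarrow> bor x \<in> borels D"
  using vertex_base by blast

lemma simple_root_vertex: "x \<in> verts G \<Longrightarrow> x i \<in> roots D"
  using base_roots[OF D] vertex_base by blast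

lemma simple_pos: "x \<in> verts G \<Longrightarrow> x i \<in> pos_roots D (bor x)"
  unfolding pos_roots_bor using simple_root_vertex simple_in_nat_span[OF D] vertex_base by blast

lemma pos_roots_rf:
  assumes "x \<in> verts G" "istr x i"
  shows "pos_roots D (bor (rf i x)) = insert (- x i) (pos_roots D (bor x) - {x i})"
  using pos_refl[OF D] vertex_base[OF assms(1)] vertex_base[OF rf_vertex[OF assms]] assms(2)
    A.uminus_root[OF simple_root_vertex[OF assms(1), of i]]
  unfolding pos_roots_bor by blast

lemma odd_adjacent_rf:
  assumes "x \<in> verts G" "istr x i"
  shows "odd_adjacent D (bor x) (bor (rf i x))"
proof -
  have s: "simple_roots D (bor x) = range x" "simple_roots D (bor (rf i x)) = range (rf i x)"
    using simple_roots_borel[OF D] vertex_base assms rf_vertex[OF assms] by blast+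
  have "range (rf i x) = odd_refl D (x i) ` range x" by (auto simp: refl_at_def)
  then show ?thesis unfolding odd_adjacent_def s using assms(2) by blast
qed

section \<open>Colors and states with respect to a fixed Borel subalgebra\<close>

context
  fixes b0 :: "('i, 'h) tm set set"
  assumes b0: "b0 \<in> borels D"
begin

definition impure :: "(complex^'h) set" where
  "impure = pos_roots D b0 - pure_pos_roots D"

text \<open>Colors are positive roots of \<open>b0\<close>, while reflections occur in simple roots
  of other Borel subalgebras. This picks the right sign.\<close>

definition normal :: "complex^'h \<Rightarrow> complex^'h" where
  "normal \<alpha> = (if \<alpha> \<in> pos_roots D b0 then \<alpha> else - \<alpha>)"

text \<open>The vertex of the hypercube assigned to \<open>b\<close>: the colors that are still
  positive for it.\<close>

definition state :: "('i, 'h) tm set set \<Rightarrow> (complex^'h) set" where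
  "state b = impure \<inter> pos_roots D b"

lemma pos_roots_sub: "pos_roots D b \<subseteq> roots D"
  by (auto simp: pos_roots_def)

lemma normal_cases: "normal \<alpha> = \<alpha> \<or> normal \<alpha> = - \<alpha>"
  by (simp add: normal_def)

text \<open>If \<open>normal \<alpha>\<close> is \<alpha>, it is not positive for \<open>b'\<close>;
  if it is \<open>- \<alpha>\<close>, it is not positive for \<open>b\<close>. Either way it is not
  pure.\<close>

lemma impure_normal:
  assumes "b \<in> borels D" "b' \<in> borels D" "\<alpha> \<in> pos_roots D b" "\<alpha> \<notin> pos_roots D b'"
  shows "normal \<alpha> \<in> impure"
proof -
  have \<alpha>: "\<alpha> \<in> roots D" using assms(3) pos_roots_sub by blast
  show ?thesis
    using assms pos_roots_uminus[OF b0 \<alpha>] pos_roots_uminus[OF assms(1) \<alpha>]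
    unfolding impure_def normal_def pure_pos_roots_def by auto
qed

lemma impure_nondouble: "impure \<subseteq> nondouble"
proof
  fix \<alpha> assume "\<alpha> \<in> impure"
  then obtain b where b: "\<alpha> \<in> pos_roots D b0" "b \<in> borels D" "\<alpha> \<notin> pos_roots D b"
    unfolding impure_def pure_pos_roots_def by blast
  obtain B where B: "base D B" "b = borel_of D B" using borels_base[OF D b(2)] .
  obtain B0 where B0: "base D B0" "b0 = borel_of D B0" using borels_base[OF D b0] .
  have "\<alpha> \<in> roots D" "\<alpha> \<in> nat_span B0" "\<alpha> \<notin> nat_span B"
    using b(1,3) unfolding B(2) B0(2) pos_roots_bor by auto
  then show "\<alpha> \<in> nondouble"
    unfolding nondouble_def using disagree_odd(2)[OF D B0(1) _ B(1)] b0 b(2) B(2) B0(2) by blast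
qed

lemma finite_state: "finite (state b)"
  using finite_subset[OF impure_nondouble finite_nondouble] by (simp add: state_def)

lemma impure_rf:
  assumes "x \<in> verts G" "istr x i"
  shows "normal (x i) \<in> impure"
proof -
  have "x i \<notin> pos_roots D (bor (rf i x))"
  proof -
    have "- x i \<in> pos_roots D (bor (rf i x))" unfolding pos_roots_rf[OF assms] by simp
    then show ?thesis
      using pos_roots_uminus[OF bor_borels[OF rf_vertex[OF assms]] simple_root_vertex[OF assms(1)]] by blast
  qed
  then show ?thesis
    using impure_normal bor_borels rf_vertex assms simple_pos by blast
qed

lemma impure_sign: "\<alpha> \<in> impure \<Longrightarrow> - \<alpha> \<notin> impure"
  using pos_roots_uminus[OF b0] pos_roots_sub unfolding impure_def by blast

text \<open>The reflection exchanges \<open>x i\<close> for \<open>- x i\<close> in the positive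
  system, and exactly one of these two is a color.\<close>

lemma state_rf:
  assumes "x \<in> verts G" "istr x i"
  shows "sym_diff (state (bor x)) (state (bor (rf i x))) = {normal (x i)}"
proof -
  have neg: "- x i \<notin> pos_roots D (bor x)"
    using pos_roots_uminus[OF bor_borels[OF assms(1)] simple_root_vertex[OF assms(1)]] simple_pos[OF assms(1)]
    by blast
  have "sym_diff (state (bor x)) (state (bor (rf i x))) = impure \<inter> {x i, - x i}"
    unfolding state_def pos_roots_rf[OF assms] using neg simple_pos[OF assms(1), of i] by auto
  also have "\<dots> = {normal (x i)}"
    using impure_rf[OF assms] impure_sign[of "x i"] normal_cases[of "x i"] impure_sign[of "- x i"] by auto
  finally show ?thesis .
qed

section \<open>Distances and colors in the graph of odd reflections\<close>

abbreviation "OR \<equiv> OR_graph D b0"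

lemma OR_simps:
  "verts OR = borels D" "ends OR e = e" "colors OR = impure"
  "edges OR = {{b, b'} | b b'. b \<in> borels D \<and> b' \<in> borels D \<and> odd_adjacent D b b'}"
  "col OR e = (THE \<alpha>. \<alpha> \<in> impure \<and> (\<exists>b b'. e = {b, b'} \<and> \<alpha> \<in> pos_roots D b \<and> \<alpha> \<notin> pos_roots D b'))"
  by (simp_all add: OR_graph_def impure_def)

lemma OR_edge: "x \<in> verts G \<Longrightarrow> istr x i \<Longrightarrow> {bor x, bor (rf i x)} \<in> edges OR"
  unfolding OR_simps(4) by (intro CollectI exI[of _ "bor x"] exI[of _ "bor (rf i x)"] conjI refl odd_adjacent_rf bor_borels rf_vertex)

text \<open>Serves two purposes: every Borel subalgebra belongs to a vertex of \<open>G\<close>, and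
  there is a walk to it whose length is the number of disagreements. If no simple root of
  \<open>x\<close> is negative for the target, the positive systems coincide; otherwise the
  reflection in such a root lowers the number by one.\<close>

lemma OR_reach:
  assumes "x \<in> verts G" "base D B" "borel_of D B \<in> borels D"
  shows "\<exists>y vs es. y \<in> verts G \<and> bor y = borel_of D B \<and> is_walk OR vs es \<and> hd vs = bor x \<and>
    last vs = borel_of D B \<and> length es = card (sym_diff (state (bor x)) (state (borel_of D B)))"
  using assms(1)
proof (induction "card (sym_diff (state (bor x)) (state (borel_of D B)))" arbitrary: x rule: less_induct)
  case less
  let ?b = "borel_of D B"
  have x: "base D (range x)" "bor x \<in> borels D" using vertex_base[OF less.prems] by blast+
  show ?case
  proof (cases "range x \<subseteq> nat_span B")
    case True
    then have "nat_span (range x) \<subseteq> nat_span B" using nat_span_mono[OF D x(1) assms(2)] by blast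
    then have "bor x = ?b"
      using borel_of_cong[OF D pos_roots_subset_eq[OF D x(1) assms(2)]] by blast
    moreover have "is_walk OR [bor x] []" using x(2) by (simp add: is_walk_def OR_simps)
    ultimately show ?thesis using less.prems
      by (intro exI[of _ x] exI[of _ "[bor x]"] exI[of _ "[]"]) simp
  next
    case False
    then obtain i where i: "x i \<notin> nat_span B" by blast
    have iso: "istr x i" by (rule disagree_isotropic[OF D x assms(2,3) _ i]) simp
    let ?y = "rf i x" and ?c = "normal (x i)"
    have y: "?y \<in> verts G" by (rule rf_vertex[OF less.prems iso])
    have npos: "x i \<notin> pos_roots D ?b" using i unfolding pos_roots_bor by blast
    have r: "x i \<in> roots D" by (rule simple_root_vertex[OF less.prems])
    have "?c \<in> sym_diff (state (bor x)) (state ?b)"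
      using impure_rf[OF less.prems iso] normal_cases[of "x i"] npos simple_pos[OF less.prems, of i]
        pos_roots_uminus[OF assms(3) r] pos_roots_uminus[OF x(2) r] unfolding state_def by auto
    then have sd: "sym_diff (state (bor x)) (state ?b) = insert ?c (sym_diff (state (bor ?y)) (state ?b))"
      and c: "?c \<notin> sym_diff (state (bor ?y)) (state ?b)"
      using sym_diff_step(3)[OF state_rf[OF less.prems iso], of "state ?b"] by blast+
    have card: "card (sym_diff (state (bor x)) (state ?b)) = Suc (card (sym_diff (state (bor ?y)) (state ?b)))"
      unfolding sd using c finite_state by (intro card_insert_disjoint) auto
    then obtain z vs es where z: "z \<in> verts G" "bor z = ?b" "is_walk OR vs es" "hd vs = bor ?y"
      "last vs = ?b" "length es = card (sym_diff (state (bor ?y)) (state ?b))"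
      using less.hyps[OF _ y] by auto
    have "is_walk OR (bor x # vs) ({bor x, bor ?y} # es)"
      using z(3,4) x(2) OR_edge[OF less.prems iso] by (intro is_walk_Cons) (simp_all add: OR_simps(1,2))
    moreover have "vs \<noteq> []" using z(3) unfolding is_walk_def by auto
    ultimately show ?thesis using z card
      by (intro exI[of _ z] exI[of _ "bor x # vs"] exI[of _ "{bor x, bor ?y} # es"]) simp
  qed
qed

lemma borels_eq: "borels D = bor ` verts G"
proof (intro equalityI subsetI)
  fix b assume b: "b \<in> borels D"
  obtain B where B: "base D B" "b = borel_of D B" using borels_base[OF D b] .
  then show "b \<in> bor ` verts G" using OR_reach[OF x0_vertex B(1)] b by blast
qed (use bor_borels in blast)

lemma edges_OR: "edges OR = {{bor x, bor (rf i x)} | x i. x \<in> verts G \<and> istr x i}"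
proof (intro equalityI subsetI)
  fix e assume "e \<in> edges OR"
  then obtain b b' where e: "e = {b, b'}" "b \<in> borels D" "b' \<in> borels D" "odd_adjacent D b b'"
    unfolding OR_simps by blast
  obtain x y where x: "x \<in> verts G" "b = bor x" and y: "y \<in> verts G" "b' = bor y"
    using e(2,3) unfolding borels_eq by blast
  have s: "simple_roots D b = range x" "simple_roots D b' = range y"
    using simple_roots_borel[OF D] vertex_base x y by blast+
  obtain i where i: "istr x i" "range y = odd_refl D (x i) ` range x"
    using e(4) unfolding odd_adjacent_def s by blast
  \<comment> \<open>Adjacency compares bases as sets. Equal ranges suffice, since the Borel
    subalgebra depends on the range only.\<close>
  have "range (rf i x) = range y" unfolding i(2) by (auto simp: refl_at_def)
  then show "e \<in> {{bor x, bor (rf i x)} | x i. x \<in> verts G \<and> istr x i}"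
    using e(1) x y i(1) by (intro CollectI exI[of _ x] exI[of _ i]) simp
qed (use OR_edge in blast)

lemma OR_edge_at:
  assumes "e \<in> edges OR" "x \<in> verts G" "bor x \<in> e"
  shows "\<exists>i. istr x i \<and> e = {bor x, bor (rf i x)}"
proof -
  obtain u i where u: "u \<in> verts G" "istr u i" "e = {bor u, bor (rf i u)}" using assms(1) unfolding edges_OR by blast
  consider "x = u" | "x = rf i u" using assms(2,3) u bor_inj rf_vertex[OF u(1,2)] by blast
  then show ?thesis
  proof cases
    case 2
    then show ?thesis using iso_rf[OF u(1,2)] u(3) by (intro exI[of _ i]) (simp add: insert_commute)
  qed (use u in blast)
qed

lemma col_OR:
  assumes "x \<in> verts G" "istr x i"
  shows "col OR {bor x, bor (rf i x)} = normal (x i)"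
  unfolding OR_simps
proof (rule the_equality)
  have sd: "sym_diff (pos_roots D (bor x)) (pos_roots D (bor (rf i x))) = {x i, - x i}"
    using pos_roots_uminus[OF bor_borels[OF assms(1)] simple_root_vertex[OF assms(1)], of i] simple_pos[OF assms(1), of i]
    unfolding pos_roots_rf[OF assms] by auto
  have "normal (x i) \<in> sym_diff (pos_roots D (bor x)) (pos_roots D (bor (rf i x)))"
    unfolding sd using normal_cases by blast
  then show "normal (x i) \<in> impure \<and> (\<exists>b b'. {bor x, bor (rf i x)} = {b, b'} \<and>
      normal (x i) \<in> pos_roots D b \<and> normal (x i) \<notin> pos_roots D b')"
    using impure_rf[OF assms] by blast
  fix \<alpha> assume \<alpha>: "\<alpha> \<in> impure \<and> (\<exists>b b'. {bor x, bor (rf i x)} = {b, b'} \<and>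
      \<alpha> \<in> pos_roots D b \<and> \<alpha> \<notin> pos_roots D b')"
  then have "\<alpha> \<in> sym_diff (pos_roots D (bor x)) (pos_roots D (bor (rf i x)))"
    by (auto simp: doubleton_eq_iff)
  then have "\<alpha> \<in> {x i, - x i}" unfolding sd .
  then show "\<alpha> = normal (x i)" using \<alpha> impure_rf[OF assms] impure_sign normal_cases[of "x i"] by fastforce
qed

lemma OR_state:
  assumes "e \<in> edges OR" "ends OR e = {u, v}"
  shows "sym_diff (state u) (state v) = {col OR e}"
proof -
  obtain x i where x: "x \<in> verts G" "istr x i" "e = {bor x, bor (rf i x)}" using assms(1) unfolding edges_OR by blast
  then have "u = bor x \<and> v = bor (rf i x) \<or> v = bor x \<and> u = bor (rf i x)"
    using assms(2) by (auto simp: OR_simps(2) doubleton_eq_iff)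
  then show ?thesis using state_rf[OF x(1,2)] col_OR[OF x(1,2)] x(3) by (auto simp: Un_commute)
qed

lemma OR_walk:
  assumes "u \<in> verts OR" "v \<in> verts OR"
  shows "\<exists>vs es. is_walk OR vs es \<and> hd vs = u \<and> last vs = v \<and> length es = card (sym_diff (state u) (state v))"
proof -
  obtain x where x: "x \<in> verts G" "u = bor x" using assms(1) unfolding OR_simps(1) borels_eq by blast
  have v: "v \<in> borels D" using assms(2) by (simp add: OR_simps(1))
  obtain B where B: "base D B" "v = borel_of D B" using borels_base[OF D v] .
  show ?thesis using OR_reach[OF x(1) B(1)] v unfolding B(2) x(2) by blast
qed

lemma OR_connected: "connected_graph OR"
  unfolding connected_graph_def
proof (intro conjI ballI)
  show "verts OR \<noteq> {}" using b0 unfolding OR_simps(1) by blast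
qed (use OR_walk in blast)

lemma OR_colored: "edge_colored_graph OR"
  unfolding edge_colored_graph_def
proof (intro conjI ballI equalityI subsetI)
  fix e assume "e \<in> edges OR"
  then show "\<exists>u\<in>verts OR. \<exists>v\<in>verts OR. ends OR e = {u, v}" unfolding OR_simps by blast
next
  fix c assume "c \<in> col OR ` edges OR"
  then show "c \<in> colors OR" unfolding edges_OR OR_simps(3) using col_OR impure_rf by auto
next
  fix \<alpha> assume "\<alpha> \<in> colors OR"
  then have \<alpha>: "\<alpha> \<in> impure" by (simp add: OR_simps(3))
  then obtain b where b: "\<alpha> \<in> pos_roots D b0" "b \<in> borels D" "\<alpha> \<notin> pos_roots D b"
    unfolding impure_def pure_pos_roots_def by blast
  obtain vs es where w: "is_walk OR vs es" "hd vs = b0" "last vs = b"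
    using OR_walk[of b0 b] b0 b(2) unfolding OR_simps(1) by blast
  \<comment> \<open>A color is by definition a root on which \<open>b0\<close> and some
    \<open>b\<close> disagree, so every walk between these two has an edge of that color.\<close>
  have "\<alpha> \<in> sym_diff (state b0) (state b)" using b \<alpha> unfolding state_def by blast
  then have "\<alpha> \<in> col OR ` set es" using walk_sym_diff[of OR state vs es, OF OR_state] w by blast
  then show "\<alpha> \<in> col OR ` edges OR" using w(1) unfolding is_walk_def by blast
qed

lemma simple_inj:
  assumes "x \<in> verts G" "x i = x j \<or> x i = - x j"
  shows "i = j"
proof -
  have b: "base D (range x)" using vertex_base[OF assms(1)] by blast
  have "x i \<noteq> - x j"
    using simple_pos[OF assms(1)] pos_roots_uminus[OF bor_borels[OF assms(1)] simple_root_vertex[OF assms(1)]]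
    by metis
  then show ?thesis using assms(2) base_inj[OF D b] by (auto dest: injD)
qed

lemma normal_eqD: "normal \<alpha> = normal \<beta> \<Longrightarrow> \<alpha> = \<beta> \<or> \<alpha> = - \<beta>"
  using normal_cases[of \<alpha>] normal_cases[of \<beta>] by (metis minus_minus)

lemma OR_proper: "properly_colored OR"
  unfolding properly_colored_def
proof (intro ballI impI)
  fix v e e' assume v: "v \<in> verts OR" and e: "e \<in> edges OR" "e' \<in> edges OR"
    and *: "v \<in> ends OR e \<and> v \<in> ends OR e' \<and> e \<noteq> e'"
  obtain x where x: "x \<in> verts G" "v = bor x" using v unfolding OR_simps(1) borels_eq by blast
  obtain i where i: "istr x i" "e = {bor x, bor (rf i x)}"
    using OR_edge_at[OF e(1) x(1)] * x(2) unfolding OR_simps(2) by blast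
  obtain j where j: "istr x j" "e' = {bor x, bor (rf j x)}"
    using OR_edge_at[OF e(2) x(1)] * x(2) unfolding OR_simps(2) by blast
  show "col OR e \<noteq> col OR e'"
  proof
    assume "col OR e = col OR e'"
    then have "normal (x i) = normal (x j)" using col_OR x(1) i j by simp
    then have "i = j" using normal_eqD simple_inj[OF x(1)] by blast
    then show False using * i j by blast
  qed
qed

lemma OR_rainbow: "rainbow_boomerang OR"
  using rainbow_boomerangI[OF OR_colored OR_proper, of state] OR_state OR_walk by blast

section \<open>The isomorphism with the recolored Cartan graph\<close>

context
  fixes x1 :: "'i \<Rightarrow> complex^'h"
  assumes x1: "x1 \<in> verts G"
begin

abbreviation "RB \<equiv> RB_graph G x1"

text \<open>The two graphs fix their colors by independent choices, \<open>b0\<close> for one and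
  \<open>x1\<close> for the other. This is \<open>impure\<close> for the second choice.\<close>

definition impure1 :: "(complex^'h) set" where
  "impure1 = pos_roots D (bor x1) - pure_pos_roots D"

lemma impure1_nondouble: "impure1 \<subseteq> nondouble"
  using cartan_graph_of.impure_nondouble[OF cartan_graph_of_axioms bor_borels[OF x1]]
  unfolding impure1_def cartan_graph_of.impure_def[OF cartan_graph_of_axioms bor_borels[OF x1]] .

lemma rf_bor_neq: "x \<in> verts G \<Longrightarrow> istr x i \<Longrightarrow> rf i x \<noteq> x"
  using rf_neq vertex_base by blast

lemma RB_edges: "edges RB = {(i, {x, rf i x}) | i x. x \<in> verts G \<and> istr x i}"
proof (intro equalityI subsetI)
  fix e assume "e \<in> edges RB"
  then have "e \<in> edges G" "\<nexists>x. snd e = {x}" by (auto simp: RB_graph_def graph_simps)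
  then show "e \<in> {(i, {x, rf i x}) | i x. x \<in> verts G \<and> istr x i}" unfolding edges_G by force
next
  fix e assume "e \<in> {(i, {x, rf i x}) | i x. x \<in> verts G \<and> istr x i}"
  then obtain i x where e: "e = (i, {x, rf i x})" "x \<in> verts G" "istr x i" by blast
  have "\<nexists>z. {x, rf i x} = {z}" using rf_bor_neq[OF e(2,3)] by blast
  then show "e \<in> edges RB" using iso_edge[OF e(2,3)] by (simp add: RB_graph_def graph_simps e(1))
qed

lemma RB_simps: "verts RB = verts G" "ends RB e = snd e"
  by (simp_all add: RB_graph_def graph_simps)

lemma RB_edge_at:
  assumes "(i, E) \<in> edges RB" "x \<in> E"
  shows "x \<in> verts G \<and> istr x i \<and> E = {x, rf i x}"
proof -
  obtain u where u: "u \<in> verts G" "istr u i" "E = {u, rf i u}" using assms(1) unfolding RB_edges by blast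
  show ?thesis
  proof (cases "x = u")
    case False
    then have "x = rf i u" using assms(2) u(3) by blast
    then show ?thesis using iso_rf[OF u(1,2)] rf_vertex[OF u(1,2)] u(3) by (simp add: insert_commute)
  qed (use u in blast)
qed

lemma pure_pos_roots_eq: "pure_pos_roots D = (\<Inter>x\<in>verts G. pos_roots D (bor x))"
  unfolding pure_pos_roots_def borels_eq by simp

lemma pos_orbits_bor: "x \<in> verts G \<Longrightarrow> pos_orbits G x = orbit_of ` (nondouble \<inter> pos_roots D (bor x))"
  unfolding pos_orbits_eq pos_roots_bor nondouble_def by (rule arg_cong[of _ _ "image orbit_of"]) blast

lemma pure_pos_orbits_eq: "pure_pos_orbits G = orbit_of ` (nondouble \<inter> pure_pos_roots D)"
proof (intro equalityI subsetI)
  fix Ob assume Ob: "Ob \<in> pure_pos_orbits G"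
  then have in_pos: "Ob \<in> orbit_of ` (nondouble \<inter> pos_roots D (bor x))" if "x \<in> verts G" for x
    using that pos_orbits_bor unfolding pure_pos_orbits_def by blast
  then obtain \<beta> where b: "\<beta> \<in> nondouble" "Ob = orbit_of \<beta>" using x0_vertex by blast
  have "\<beta> \<in> pos_roots D (bor x)" if x: "x \<in> verts G" for x
  proof -
    obtain \<gamma> where "\<gamma> \<in> nondouble" "\<gamma> \<in> pos_roots D (bor x)" "Ob = orbit_of \<gamma>" using in_pos[OF x] by blast
    then show ?thesis using b inj_orbit_of by (metis inj_onD)
  qed
  then show "Ob \<in> orbit_of ` (nondouble \<inter> pure_pos_roots D)" unfolding pure_pos_roots_eq using b by blast
next
  fix Ob assume "Ob \<in> orbit_of ` (nondouble \<inter> pure_pos_roots D)"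
  then show "Ob \<in> pure_pos_orbits G"
    unfolding pure_pos_orbits_def pure_pos_roots_eq using pos_orbits_bor by blast
qed

lemma RB_colors: "colors RB = orbit_of ` impure1"
proof -
  have "colors RB = orbit_of ` (nondouble \<inter> pos_roots D (bor x1)) - orbit_of ` (nondouble \<inter> pure_pos_roots D)"
    by (simp add: RB_graph_def pos_orbits_bor[OF x1] pure_pos_orbits_eq)
  also have "\<dots> = orbit_of ` (nondouble \<inter> pos_roots D (bor x1) - nondouble \<inter> pure_pos_roots D)"
    by (rule inj_on_image_set_diff[OF inj_orbit_of, symmetric]) auto
  also have "nondouble \<inter> pos_roots D (bor x1) - nondouble \<inter> pure_pos_roots D =
      impure1"
    using impure1_nondouble unfolding impure1_def by blast
  finally show ?thesis .
qed

lemma col_RB: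
  assumes "x \<in> verts G" "istr x i" "\<beta> \<in> impure1" "\<beta> = x i \<or> \<beta> = - x i"
  shows "col RB (i, {x, rf i x}) = orbit_of \<beta>"
proof -
  have at: "(\<forall>z\<in>{x, rf i x}. at_vertex (orbit_of \<gamma>) z \<in> {sroot i, - sroot i}) \<longleftrightarrow> \<gamma> \<in> {x i, - x i}"
    if "\<gamma> \<in> nondouble" for \<gamma>
    using at_vertex_simple[OF that assms(1)] at_vertex_simple[OF that rf_vertex[OF assms(1,2)]]
    by (auto simp: refl_at_i)
  have "(THE Ob. Ob \<in> orbit_of ` impure1 \<and> (\<forall>z\<in>{x, rf i x}. at_vertex Ob z \<in> {sroot i, - sroot i})) = orbit_of \<beta>"
  proof (rule the_equality)
    show "orbit_of \<beta> \<in> orbit_of ` impure1 \<and> (\<forall>z\<in>{x, rf i x}. at_vertex (orbit_of \<beta>) z \<in> {sroot i, - sroot i})"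
      using assms(3,4) at[of \<beta>] impure1_nondouble by blast
    fix Ob assume Ob: "Ob \<in> orbit_of ` impure1 \<and> (\<forall>z\<in>{x, rf i x}. at_vertex Ob z \<in> {sroot i, - sroot i})"
    then obtain \<gamma> where g: "\<gamma> \<in> impure1" "Ob = orbit_of \<gamma>" by blast
    then have "\<gamma> = x i \<or> \<gamma> = - x i" using at[of \<gamma>] Ob impure1_nondouble by blast
    then have "\<gamma> = \<beta> \<or> \<gamma> = - \<beta>" using assms(4) by auto
    moreover have "- \<beta> \<notin> pos_roots D (bor x1)"
      using pos_roots_uminus[OF bor_borels[OF x1]] assms(3) pos_roots_sub unfolding impure1_def by blast
    ultimately show "Ob = orbit_of \<beta>" using g unfolding impure1_def by blast
  qed
  then show ?thesis using RB_colors by (simp add: RB_graph_def graph_simps)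
qed

text \<open>Both sets contain exactly one root of each opposite pair on which some Borel subalgebras
  disagree.\<close>

lemma normal_bij: "bij_betw normal impure1 impure"
proof -
  have neg1: "- \<alpha> \<in> pos_roots D (bor x1) \<longleftrightarrow> \<alpha> \<notin> pos_roots D (bor x1)" if "\<alpha> \<in> roots D" for \<alpha>
    by (rule pos_roots_uminus[OF bor_borels[OF x1] that])
  have "normal \<alpha> \<in> impure" if "\<alpha> \<in> impure1" for \<alpha>
    using that impure_normal[OF bor_borels[OF x1]] unfolding impure1_def pure_pos_roots_def by blast
  moreover have "inj_on normal impure1"
  proof (rule inj_onI)
    fix \<alpha> \<beta> assume *: "\<alpha> \<in> impure1" "\<beta> \<in> impure1" "normal \<alpha> = normal \<beta>"
    then have "\<beta> \<in> roots D" using pos_roots_sub unfolding impure1_def by blast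
    then show "\<alpha> = \<beta>" using normal_eqD[OF *(3)] * neg1[of \<beta>] unfolding impure1_def by auto
  qed
  moreover have "\<gamma> \<in> normal ` impure1" if g: "\<gamma> \<in> impure" for \<gamma>
  proof -
    have r: "\<gamma> \<in> roots D" "\<gamma> \<in> pos_roots D b0" "\<gamma> \<notin> pure_pos_roots D"
      using g pos_roots_sub unfolding impure_def by auto
    show ?thesis
    proof (cases "\<gamma> \<in> pos_roots D (bor x1)")
      case True
      then show ?thesis using r by (intro image_eqI[of _ _ \<gamma>]) (auto simp: normal_def impure1_def)
    next
      case False
      have "- \<gamma> \<notin> pos_roots D b0" using pos_roots_uminus[OF b0 r(1)] r(2) by blast
      then have "- \<gamma> \<in> impure1" "normal (- \<gamma>) = \<gamma>"
        using False neg1[OF r(1)] b0 unfolding impure1_def pure_pos_roots_def normal_def by auto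
      then show ?thesis by (metis imageI)
    qed
  qed
  ultimately show ?thesis unfolding bij_betw_def by blast
qed

lemma RB_color_root:
  assumes "x \<in> verts G" "istr x i"
  obtains \<beta> where "\<beta> \<in> impure1" "col RB (i, {x, rf i x}) = orbit_of \<beta>" "normal \<beta> = normal (x i)"
proof -
  have "normal (x i) \<in> normal ` impure1" using impure_rf[OF assms] normal_bij by (simp add: bij_betw_def)
  then obtain \<beta> where b: "\<beta> \<in> impure1" "normal \<beta> = normal (x i)" by (metis imageE)
  show ?thesis using that[OF b(1) _ b(2)] col_RB[OF assms b(1) normal_eqD[OF b(2)]] by simp
qed

lemma RB_isomorphic_OR: "ec_isomorphic RB OR"
proof -
  define f where "f x = bor x" for x :: "'i \<Rightarrow> complex^'h"
  define g where "g e = f ` snd e" for e :: "'i \<times> ('i \<Rightarrow> complex^'h) set"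
  \<comment> \<open>An orbit goes to the root it represents, with the sign that makes it positive
    for \<open>b0\<close>.\<close>
  define k where "k = normal \<circ> inv_into nondouble orbit_of"
  have f: "bij_betw f (verts RB) (verts OR)"
    unfolding bij_betw_def OR_simps(1) RB_simps borels_eq f_def
    using bor_inj by (intro conjI inj_onI) auto
  have inj_f: "inj_on f (verts G)" using f by (simp add: bij_betw_def RB_simps)
  \<comment> \<open>Parallel edges are excluded by colors: the ends determine the color in
    \<open>OR\<close>, so parallel edges of colors i and j would make \<open>x i\<close> and
    \<open>x j\<close> equal up to sign.\<close>
  have "inj_on g (edges RB)"
  proof (rule inj_onI)
    fix e e' assume *: "e \<in> edges RB" "e' \<in> edges RB" "g e = g e'"
    obtain i x where e: "e = (i, {x, rf i x})" "x \<in> verts G" "istr x i" using *(1) unfolding RB_edges by blast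
    obtain j E where e': "e' = (j, E)" by (cases e')
    have "E \<subseteq> verts G" using RB_edge_at[of j E] *(2) unfolding e' by blast
    then have E: "E = {x, rf i x}"
      using *(3) inj_on_image_eq_iff[OF inj_f, of "{x, rf i x}" E] e(2) rf_vertex[OF e(2,3)]
      unfolding g_def e(1) e' by auto
    have "istr x j \<and> E = {x, rf j x}" using RB_edge_at[of j E x] *(2) unfolding e' E by blast
    then have j: "istr x j" "rf j x = rf i x" using E rf_bor_neq[OF e(2)] by (auto simp: doubleton_eq_iff)
    have "normal (x i) = normal (x j)"
      using col_OR[OF e(2,3)] col_OR[OF e(2) j(1)] j(2) by simp
    then have "i = j" using normal_eqD simple_inj[OF e(2)] by blast
    then show "e = e'" using e(1) e' E by simp
  qed
  moreover have "g ` edges RB = edges OR"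
    unfolding RB_edges edges_OR g_def f_def by (auto simp: image_iff) blast+
  ultimately have g: "bij_betw g (edges RB) (edges OR)" by (simp add: bij_betw_def)
  have inv: "inv_into nondouble orbit_of (orbit_of \<beta>) = \<beta>" if "\<beta> \<in> impure1" for \<beta>
    using that impure1_nondouble inj_orbit_of by auto
  have "bij_betw (inv_into nondouble orbit_of) (orbit_of ` impure1) impure1"
    unfolding bij_betw_def
  proof
    show "inj_on (inv_into nondouble orbit_of) (orbit_of ` impure1)"
      using inv by (auto intro!: inj_onI)
    show "inv_into nondouble orbit_of ` orbit_of ` impure1 = impure1"
      unfolding image_image using inv by (auto simp: image_iff)
  qed
  then have k: "bij_betw k (colors RB) (colors OR)"
    unfolding k_def RB_colors OR_simps(3) using normal_bij by (rule bij_betw_trans)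
  have "ends OR (g e) = f ` ends RB e \<and> col OR (g e) = k (col RB e)" if eRB: "e \<in> edges RB" for e
  proof
    show "ends OR (g e) = f ` ends RB e" by (simp add: OR_simps(2) RB_simps g_def)
    obtain i x where e: "e = (i, {x, rf i x})" "x \<in> verts G" "istr x i" using eRB unfolding RB_edges by blast
    obtain \<beta> where b: "\<beta> \<in> impure1" "col RB e = orbit_of \<beta>" "normal \<beta> = normal (x i)"
      unfolding e(1) using RB_color_root[OF e(2,3)] .
    then have "k (col RB e) = normal (x i)" using inv[OF b(1)] b(2,3) by (simp add: k_def)
    moreover have "col OR (g e) = normal (x i)" using col_OR[OF e(2,3)] by (simp add: g_def f_def e(1))
    ultimately show "col OR (g e) = k (col RB e)" by simp
  qed
  then show ?thesis unfolding ec_isomorphic_def using f g k by blast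
qed

lemma RB_colored: "edge_colored_graph RB"
proof -
  have "col RB e \<in> colors RB" if eRB: "e \<in> edges RB" for e
  proof -
    obtain i x where e: "e = (i, {x, rf i x})" "x \<in> verts G" "istr x i" using eRB unfolding RB_edges by blast
    obtain \<beta> where b: "\<beta> \<in> impure1" "col RB e = orbit_of \<beta>"
      unfolding e(1) using RB_color_root[OF e(2,3)] by metis
    then show ?thesis unfolding RB_colors by blast
  qed
  moreover have "colors RB \<subseteq> col RB ` edges RB"
  proof
    fix c assume "c \<in> colors RB"
    then obtain \<beta> where b: "\<beta> \<in> impure1" "c = orbit_of \<beta>" unfolding RB_colors by blast
    have "normal \<beta> \<in> impure" using b(1) normal_bij unfolding bij_betw_def by blast
    then have "normal \<beta> \<in> col OR ` edges OR" using OR_colored unfolding edge_colored_graph_def OR_simps(3) by simp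
    then obtain x i where x: "x \<in> verts G" "istr x i" "normal \<beta> = normal (x i)"
      unfolding edges_OR using col_OR by auto
    have "col RB (i, {x, rf i x}) = c"
      unfolding b(2) using normal_eqD[OF x(3)] by (rule col_RB[OF x(1,2) b(1)])
    then show "c \<in> col RB ` edges RB" unfolding RB_edges using x(1,2) by blast
  qed
  ultimately show ?thesis
    unfolding edge_colored_graph_def RB_simps using rf_vertex by (auto simp: RB_edges)
qed

lemma OR_isomorphic_RB: "ec_isomorphic OR RB"
  by (rule ec_isomorphic_sym[OF RB_colored RB_isomorphic_OR])

end

end

end

theorem theorem4p10:
  fixes D :: "('i::finite, 'h::finite) km_datum"
    and G :: "('i \<Rightarrow> complex^'h, 'i \<times> ('i \<Rightarrow> complex^'h) set, 'i) cgraph"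
  assumes "regular_symmetrizable D"
    and "is_cartan_graph_of D G"
  shows "path_simply_connected G
    \<and> (\<exists>\<phi>. bij_betw \<phi> (orbit_set G) (roots D - doubles (roots D)) \<and>
           (\<forall>x\<in>verts G. \<forall>Ob\<in>orbit_set G. \<phi> Ob = root_map x (at_vertex Ob x)))
    \<and> (\<forall>b\<in>borels D. \<forall>x\<in>verts G. ec_isomorphic (OR_graph D b) (RB_graph G x))
    \<and> (\<forall>b\<in>borels D. connected_graph (OR_graph D b) \<and> rainbow_boomerang (OR_graph D b))"
proof -
  have D: "realization D" using assms(1) by (simp add: regular_symmetrizable_def)
  interpret A: km_alg D by unfold_locales (rule D)
  obtain x0 M where G: "ordered_root_basis D x0" "G = E_graph D x0 M"
    and c: "cartan_graph G" "finite_cgraph G" "connected_graph G"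
    and b: "\<forall>x\<in>verts G. let \<Delta>p = pos_roots D (borel_of D (range x))
        in bij_betw (root_map x) (pos_real_roots G x) (\<Delta>p - doubles \<Delta>p)"
    using assms(2) unfolding is_cartan_graph_of_def by blast
  interpret C: cartan_graph_of D G x0 M
    by unfold_locales (use D G c b in \<open>auto simp: Let_def A.pos_roots_borel\<close>)
  show ?thesis
    using C.path_simply_connected C.orbit_bijection C.OR_isomorphic_RB C.OR_connected C.OR_rainbow by blast
qed

end
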